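(* Let $\mu_1,\ldots,\mu_n$ be pairwise different nonzero complex numbers and let $z_1,\ldots,z_n\in\mathbb{C}^n$ be nonzero linearly independent vectors. Denote $$\widetilde{\lambda}_k^m=\ln|\mu_m|+\mathrm{i}(\operatorname{Arg}\mu_m+2\pi k),\qquad m=1,\ldots,n,\ k\in\mathbb{Z}.$$ Let $\{\lambda_k^m\}_{k\in\mathbb{Z},\,m=1,\ldots,n}$ be a sequence of pairwise different complex numbers such that $$\sum_{k\in\mathbb{Z}}|\lambda_k^m-\widetilde{\lambda}_k^m|^2<\infty,\qquad m=1,\ldots,n,$$ indexed so that if $\lambda_{k_0}^{m_0}=\widetilde{\lambda}_k^m$ for some indices, then $m_0=m$ and $k_0=k$. Let $\{\widehat d_k^m\}_{k\in\mathbb{Z},\,m=1,\ldots,n}\subset\mathbb{C}^n$ be a sequence of vectors satisfying $$\sum_{k\in\mathbb{Z}}\|\widehat d_k^m-z_m\|^2<\infty,\qquad m=1,\ldots,n.$$ Let, in addition, the complex numbers $\lambda_j^0$, $j=1,\ldots,n$, be different from each other and different from all $\lambda_k^m$, and let $d_j^0\in\mathbb{C}^n$, $j=1,\ldots,n$, be linearly independent vectors. Then for any $\varepsilon>0$ there exist $N>0$, a sequence $\{d_k^m\}_{k\in\mathbb{Z},\,m=1,\ldots,n}\subset\mathbb{C}^n$ with $$\sum_{k\in\mathbb{Z}}\|d_k^m-\widehat d_k^m\|^2<\varepsilon,\qquad d_k^m=\widehat d_k^m\ \text{ for } |k|>N,\qquad m=1,\ldots,n,$$ and a choice of matrices $A_{-1},A_2(\theta),A_3(\theta)$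 such that the characteristic matrix $\Delta(\lambda)$ of the corresponding neutral type system satisfies: (i) all the numbers $\{\lambda_k^m\}_{k\in\mathbb{Z},\,m=1,\ldots,n}\cup\{\lambda_j^0\}_{j=1,\ldots,n}$ are roots of the characteristic equation $\det\Delta(\lambda)=0$; (ii) $(d_k^m)^*\Delta(\lambda_k^m)=0$ for $m=1,\ldots,n$, $k\in\mathbb{Z}$, and $(d_j^0)^*\Delta(\lambda_j^0)=0$ for $j=1,\ldots,n$.
   Context: The neutral type system is $$\dot z(t)=A_{-1}\dot z(t-1)+\int_{-1}^0A_2(\theta)\dot z(t+\theta)\,\mathrm{d}\theta+\int_{-1}^0A_3(\theta)z(t+\theta)\,\mathrm{d}\theta,$$ where $A_{-1}$ is a constant complex $n\times n$ matrix and $A_2(\cdot),A_3(\cdot)$ are $n\times n$ matrices whose (complex-valued) entries belong to $L_2[-1,0]$. Its characteristic matrix is $$\Delta(\lambda)=\lambda I-\lambda \mathrm{e}^{-\lambda}A_{-1}-\int_{-1}^0\lambda \mathrm{e}^{\lambda\theta}A_2(\theta)\,\mathrm{d}\theta-\int_{-1}^0\mathrm{e}^{\lambda\theta}A_3(\theta)\,\mathrm{d}\theta,\qquad\lambda\in\mathbb{C}.$$ Here $v^*$ denotes the conjugate transpose of a vector $v$, and $\operatorname{Arg}$ the principal argument. *)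

theory Defs
  imports "HOL-Analysis.Analysis"
begin

definition L2_on :: "real set \<Rightarrow> (real \<Rightarrow> complex) \<Rightarrow> bool" where
  "L2_on S f \<longleftrightarrow> set_borel_measurable lebesgue S f
     \<and> set_integrable lebesgue S (\<lambda>x. (cmod (f x))\<^sup>2)"

definition L2_matrix_on :: "real set \<Rightarrow> (real \<Rightarrow> complex^'n^'n) \<Rightarrow> bool" where
  "L2_matrix_on S A \<longleftrightarrow> (\<forall>i j. L2_on S (\<lambda>\<theta>. A \<theta> $ i $ j))"

text \<open>
  The neutral type system
  \<open>z'(t) = A1 z'(t - 1) + \<integral> A2(\<theta>) z'(t + \<theta>) d\<theta> + \<integral> A3(\<theta>) z(t + \<theta>) d\<theta>\<close>, with both integrals over
  \<open>[-1,0]\<close>, is represented by its coefficients \<open>A1\<close> (the matrix usually written \<open>A\<close> with index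
  \<open>-1\<close>), \<open>A2\<close> and \<open>A3\<close>. The integrals of matrix-valued functions are taken entrywise.
\<close>

definition char_matrix ::
  "complex^'n^'n \<Rightarrow> (real \<Rightarrow> complex^'n^'n) \<Rightarrow> (real \<Rightarrow> complex^'n^'n) \<Rightarrow> complex \<Rightarrow> complex^'n^'n" where
  "char_matrix A1 A2 A3 w = (\<chi> i j.
     w * (mat 1 :: complex^'n^'n) $ i $ j
     - w * exp (- w) * A1 $ i $ j
     - (LINT \<theta>:{-1..0}|lebesgue. w * exp (w * complex_of_real \<theta>) * A2 \<theta> $ i $ j)
     - (LINT \<theta>:{-1..0}|lebesgue. exp (w * complex_of_real \<theta>) * A3 \<theta> $ i $ j))"

definition conj_transpose :: "complex^'n \<Rightarrow> complex^'n" where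
  "conj_transpose v = (\<chi> i. cnj (v $ i))"

text \<open>
  Linear independence over the complex numbers of a family of vectors: \<open>vec.independent\<close> refers
  to scalar multiplication by the component field, whereas \<open>independent\<close> would be independence
  over the reals.
\<close>

definition lin_indep_family :: "('i \<Rightarrow> complex^'n) \<Rightarrow> bool" where
  "lin_indep_family v \<longleftrightarrow> inj v \<and> vec.independent (range v)"

text \<open>The constant \<open>Arg\<close> is the principal argument, with values in \<open>(-pi, pi]\<close>.\<close>

definition lambda_tilde :: "('n \<Rightarrow> complex) \<Rightarrow> int \<Rightarrow> 'n \<Rightarrow> complex" where
  "lambda_tilde \<mu> k m = complex_of_real (ln (cmod (\<mu> m)))
     + \<i> * complex_of_real (Arg (\<mu> m) + 2 * pi * real_of_int k)"

end

theory Submission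
  imports Defs
begin

text \<open>
  Why the theorem is true. The columns of the system decouple: for each column, a row condition
  \<open>d\<^sup>* \<Delta>(\<lambda>) = 0\<close> is a linear equation for a function in \<open>L\<^sub>2[-1,0]\<close> and a constant vector.
  Indeed, since \<open>w \<integral> exp (w t) (t + 1) dt + \<integral> exp (w t) dt = 1\<close> over \<open>[-1,0]\<close>, the choice
  \<open>A\<^sub>2 = f + (t + 1) c\<close>, \<open>A\<^sub>3 = c\<close> contributes \<open>\<Phi>(w) = w u(w) + c\<close> with the transform
  \<open>u(w) = \<integral> exp (w t) f(t) dt\<close>. Let \<open>Z\<close> have the rows \<open>z\<^sub>m\<^sup>*\<close> and take
  \<open>Z\<^sup>-\<^sup>1 diag(\<mu>) Z\<close> as the matrix of the neutral term. After the change of basis \<open>q = d\<^sup>* Z\<^sup>-\<^sup>1\<close> the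
  rows converge to the unit rows, and the required values of \<open>q \<Phi>(\<lambda>)\<close> are \<open>\<lambda>\<close> times a
  square-summable family, because \<open>\<mu>\<^sub>m exp (- \<lambda>)\<close> is close to 1.

  For the unperturbed points and unit rows the left-hand sides \<open>q u(\<lambda>)\<close> are the moments of \<open>f\<close> against the
  functions \<open>exp ((a\<^sub>m + 2 \<pi> i k) t)\<close> with \<open>exp a\<^sub>m = \<mu>\<^sub>m\<close>, that is, Fourier coefficients of a weighted function.
  For the given data the moment operator restricted to the equations with \<open>|k| > N\<close> differs from the
  unperturbed one by an operator whose Hilbert-Schmidt norm is small for large \<open>N\<close>
  (\<open>tail_operator_small\<close>, from Bessel's inequality), so a Neumann series solves these equations with the
  unperturbed moments for \<open>|k| \<le> N\<close> and the constant \<open>c\<close> free. This leaves \<open>n (2 N + 1) + n\<close>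
  parameters for as many equations, and it has to be shown that the homogeneous system has only the
  zero solution.

  The \<open>n\<close> equations at the \<open>\<lambda>\<^sub>j\<^sup>0\<close> come first. When \<open>N\<close> is large, the solution of the homogeneous tail
  equations with vanishing moments for \<open>|k| \<le> N\<close> is small compared with \<open>c\<close>, so that
  \<open>\<Phi>(\<lambda>\<^sub>j\<^sup>0)\<close> is nearly \<open>c\<close>; as the \<open>d\<^sub>j\<^sup>0\<close> are linearly independent, the equations at the
  \<open>\<lambda>\<^sub>j\<^sup>0\<close> force \<open>c = 0\<close> (\<open>tail_and_extra_uniqueness\<close>). Hence the functions \<open>\<Phi>\<close> that
  satisfy the tail equations and those at the \<open>\<lambda>\<^sub>j\<^sup>0\<close> form a space of dimension at most
  \<open>n (2 N + 1)\<close>. The rows with \<open>|k| \<le> N\<close> are then chosen one at a time, arbitrarily close to the given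
  ones, so that each lowers the dimension (\<open>generic_rows\<close>). This is possible unless all functions of
  the space vanish at the point \<open>\<lambda>\<close> in question. But the space is closed under division by
  \<open>w - \<lambda>\<close>, so in that case each \<open>\<Phi>\<close> could be divided by arbitrarily high powers of
  \<open>w - \<lambda>\<close>, which in finite dimension is possible only for \<open>\<Phi> = 0\<close>
  (\<open>vanishing_at_point_imp_zero\<close>).

  Closure under division comes from Fubini's theorem, and the fact that a transform is determined by
  its moments from the completeness of the trigonometric system, that is, from the
  Stone-Weierstrass theorem on the unit circle.
\<close>

section \<open>Transforms of square-integrable functions on the delay interval\<close>

text \<open>
  A density on the whole line, not a restricted space: its measurable sets are the Borel sets of the
  line, so that functions on \<open>[-1,0]\<close> need no separate measurability theory.
\<close>

definition delay :: "real measure" where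
  "delay = density lborel (\<lambda>t. ennreal (indicator {-1..0} t))"

text \<open>
  Borel measurability, which is stronger than what \<open>L2_on\<close> demands, makes Fubini's theorem applicable;
  every class in \<open>L\<^sub>2[-1,0]\<close> has such a representative.
\<close>

definition L2_borel :: "(real \<Rightarrow> complex) \<Rightarrow> bool" where
  "L2_borel f \<longleftrightarrow> f \<in> borel_measurable borel \<and> integrable delay (\<lambda>t. (cmod (f t))\<^sup>2)"

definition laplace :: "(real \<Rightarrow> complex) \<Rightarrow> complex \<Rightarrow> complex" where
  "laplace f w = (\<integral>t. exp (w * of_real t) * f t \<partial>delay)"

definition unit_laplace :: "complex \<Rightarrow> complex" where
  "unit_laplace = laplace (\<lambda>_. 1)"

text \<open>
  The zeros of \<open>1 - exp (- w)\<close>, so that the functions \<open>exp (freq l * t)\<close> are orthonormal on \<open>[-1,0]\<close>.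
\<close>

definition freq :: "int \<Rightarrow> complex" where
  "freq l = 2 * of_real pi * \<i> * of_int l"

lemma sets_delay [measurable_cong, simp]: "sets delay = sets borel"
  by (simp add: delay_def)

lemma space_delay [simp]: "space delay = UNIV"
  by (simp add: delay_def)

lemma borel_measurable_delay [simp]:
  "borel_measurable delay = (borel_measurable borel :: (real \<Rightarrow> 'b::topological_space) set)"
  by (rule measurable_cong_sets) auto

lemma AE_delay: "AE t in delay. t \<in> {-1..0}"
  unfolding delay_def by (subst AE_density) (auto split: split_indicator)

lemma emeasure_delay: "emeasure delay UNIV = 1"
  unfolding delay_def
  by (subst emeasure_density) (auto simp: ennreal_indicator)

lemma finite_delay: "finite_measure delay"
  by (rule finite_measureI) (simp add: emeasure_delay)

interpretation delay: finite_measure delay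
  by (rule finite_delay)

lemma measure_delay [simp]: "measure delay UNIV = 1"
  by (simp add: measure_def emeasure_delay)

lemma integral_delay_const [simp]: "(\<integral>t. c \<partial>delay) = (c::'b::{banach, second_countable_topology})"
  by (simp add: integral_const)

lemma integral_delay:
  fixes f :: "real \<Rightarrow> 'b::{banach, second_countable_topology}"
  assumes "f \<in> borel_measurable borel"
  shows "(\<integral>t. f t \<partial>delay) = (LINT t:{-1..0}|lborel. f t)"
  unfolding delay_def set_lebesgue_integral_def
  by (rule integral_density) (use assms in auto)

lemma integrable_delay:
  fixes f :: "real \<Rightarrow> 'b::{banach, second_countable_topology}"
  assumes "f \<in> borel_measurable borel"
  shows "integrable delay f \<longleftrightarrow> set_integrable lborel {-1..0} f"
  unfolding delay_def set_integrable_def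
  by (rule integrable_density) (use assms in auto)

lemma integrable_delay_bounded:
  fixes f :: "real \<Rightarrow> 'b::{banach, second_countable_topology}"
  assumes "f \<in> borel_measurable borel" "\<And>t. t \<in> {-1..0} \<Longrightarrow> norm (f t) \<le> B"
  shows "integrable delay f"
proof (rule delay.integrable_const_bound)
  show "AE x in delay. norm (f x) \<le> B"
    using AE_delay by eventually_elim (use assms in auto)
qed (use assms in auto)

lemma integral_delay_mono:
  fixes f g :: "real \<Rightarrow> real"
  assumes "integrable delay f" "integrable delay g"
    "\<And>t. t \<in> {-1..0} \<Longrightarrow> f t \<le> g t"
  shows "(\<integral>t. f t \<partial>delay) \<le> (\<integral>t. g t \<partial>delay)"
proof (rule integral_mono_AE)
  show "AE x in delay. f x \<le> g x"
    using AE_delay by eventually_elim (use assms in auto)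
qed (use assms in auto)

text \<open>
  The total mass of \<open>delay\<close> is 1, so pointwise bounds pass to integrals unchanged.
\<close>

lemma integral_delay_le:
  fixes f :: "real \<Rightarrow> real"
  assumes "f \<in> borel_measurable borel" "\<And>t. t \<in> {-1..0} \<Longrightarrow> 0 \<le> f t" "\<And>t. t \<in> {-1..0} \<Longrightarrow> f t \<le> B"
  shows "(\<integral>t. f t \<partial>delay) \<le> B"
proof -
  have "(\<integral>t. f t \<partial>delay) \<le> (\<integral>t. B \<partial>delay)"
    using assms by (intro integral_delay_mono integrable_delay_bounded[where B=B and f=f]) auto
  then show ?thesis by simp
qed

lemma L2_borel_measurable [measurable_dest]:
  "L2_borel f \<Longrightarrow> f \<in> borel_measurable borel"
  by (simp add: L2_borel_def)

lemma L2_borel_integrable: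
  assumes "L2_borel f"
  shows "integrable delay f"
proof (rule Bochner_Integration.integrable_bound)
  show "integrable delay (\<lambda>t. 1 + (cmod (f t))\<^sup>2)"
    using assms by (auto simp: L2_borel_def)
  show "f \<in> borel_measurable delay"
    using assms by (simp add: L2_borel_def)
  have "x \<le> 1 + x\<^sup>2" for x :: real
    using sum_power2_ge_zero[of "x - 1/2" 0] by (simp add: power2_eq_square algebra_simps)
  then show "AE x in delay. cmod (f x) \<le> norm (1 + (cmod (f x))\<^sup>2)"
    by (simp add: abs_of_nonneg add_nonneg_nonneg)
qed

lemma L2_borel_mult_bounded:
  assumes "L2_borel f" "g \<in> borel_measurable borel" "\<And>t. t \<in> {-1..0} \<Longrightarrow> cmod (g t) \<le> B"
  shows "L2_borel (\<lambda>t. g t * f t)"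
proof -
  note [measurable] = assms(1,2)
  have "integrable delay (\<lambda>t. (cmod (g t * f t))\<^sup>2)"
  proof (rule Bochner_Integration.integrable_bound)
    show "integrable delay (\<lambda>t. B\<^sup>2 * (cmod (f t))\<^sup>2)"
      using assms by (auto simp: L2_borel_def)
    show "AE x in delay. norm ((cmod (g x * f x))\<^sup>2) \<le> norm (B\<^sup>2 * (cmod (f x))\<^sup>2)"
      using AE_delay
      by eventually_elim (use assms(3) in \<open>auto simp: norm_mult power_mult_distrib intro!: mult_right_mono power_mono\<close>)
  qed measurable
  then show ?thesis
    using assms by (auto simp: L2_borel_def)
qed

lemma L2_borel_bounded:
  assumes "g \<in> borel_measurable borel" "\<And>t. t \<in> {-1..0} \<Longrightarrow> cmod (g t) \<le> B"
  shows "L2_borel g"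
proof -
  have "L2_borel (\<lambda>_. 1)" by (simp add: L2_borel_def)
  from L2_borel_mult_bounded[OF this assms] show ?thesis by simp
qed

lemma L2_borel_add:
  assumes "L2_borel f" "L2_borel g"
  shows "L2_borel (\<lambda>t. f t + g t)"
proof -
  note [measurable] = assms
  have "integrable delay (\<lambda>t. (cmod (f t + g t))\<^sup>2)"
  proof (rule Bochner_Integration.integrable_bound)
    show "integrable delay (\<lambda>t. 2 * (cmod (f t))\<^sup>2 + 2 * (cmod (g t))\<^sup>2)"
      using assms by (auto simp: L2_borel_def)
    have "(cmod (a + b))\<^sup>2 \<le> 2 * (cmod a)\<^sup>2 + 2 * (cmod b)\<^sup>2" for a b
    proof -
      have "(cmod (a + b))\<^sup>2 \<le> (cmod a + cmod b)\<^sup>2" by (intro power_mono norm_triangle_ineq) auto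
      also have "\<dots> \<le> 2 * (cmod a)\<^sup>2 + 2 * (cmod b)\<^sup>2"
        using sum_power2_ge_zero[of "cmod a - cmod b" 0] by (simp add: power2_eq_square algebra_simps)
      finally show ?thesis .
    qed
    then show "AE x in delay. norm ((cmod (f x + g x))\<^sup>2) \<le> norm (2 * (cmod (f x))\<^sup>2 + 2 * (cmod (g x))\<^sup>2)"
      by auto
  qed measurable
  then show ?thesis using assms by (auto simp: L2_borel_def)
qed

lemma L2_borel_cmult:
  "L2_borel f \<Longrightarrow> L2_borel (\<lambda>t. c * f t)"
  by (rule L2_borel_mult_bounded[where B="cmod c"]) auto

lemma L2_borel_sum:
  "(\<And>i. i \<in> A \<Longrightarrow> L2_borel (f i)) \<Longrightarrow> L2_borel (\<lambda>t. \<Sum>i\<in>A. f i t)"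
proof (induction A rule: infinite_finite_induct)
  case (insert x F)
  then show ?case by (simp add: L2_borel_add)
qed (auto intro!: L2_borel_bounded[where B=0])

lemma cmod_exp_delay:
  assumes "t \<in> {-1..0}"
  shows "cmod (exp (w * of_real t)) \<le> exp (cmod w)"
proof -
  have "cmod (exp (w * of_real t)) \<le> exp (cmod (w * of_real t))"
    by (rule norm_exp)
  also have "\<dots> \<le> exp (cmod w)"
    using assms mult_left_le[of "\<bar>t\<bar>" "cmod w"] by (auto simp: norm_mult)
  finally show ?thesis .
qed

lemma L2_borel_exp_mult:
  "L2_borel f \<Longrightarrow> L2_borel (\<lambda>t. exp (w * of_real t) * f t)"
  by (rule L2_borel_mult_bounded[OF _ _ cmod_exp_delay[of _ w]]) auto

lemma L2_borel_exp: "L2_borel (\<lambda>t. exp (w * of_real t))"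
  by (rule L2_borel_bounded[OF _ cmod_exp_delay[of _ w]]) auto

lemma laplace_add:
  assumes "L2_borel f" "L2_borel g"
  shows "laplace (\<lambda>t. f t + g t) w = laplace f w + laplace g w"
  unfolding laplace_def distrib_left
  by (intro Bochner_Integration.integral_add L2_borel_integrable L2_borel_exp_mult assms)

lemma laplace_cmult: "laplace (\<lambda>t. c * f t) w = c * laplace f w"
  unfolding laplace_def by (simp add: mult.left_commute)

lemma laplace_diff:
  assumes "L2_borel f" "L2_borel g"
  shows "laplace (\<lambda>t. f t - g t) w = laplace f w - laplace g w"
  using laplace_add[OF assms(1) L2_borel_cmult[OF assms(2), of "-1"], of w]
    laplace_cmult[of "-1" g w] by simp

lemma laplace_sum:
  "(\<And>i. i \<in> A \<Longrightarrow> L2_borel (f i)) \<Longrightarrow> laplace (\<lambda>t. \<Sum>i\<in>A. f i t) w = (\<Sum>i\<in>A. laplace (f i) w)"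
proof (induction A rule: infinite_finite_induct)
  case (insert x F)
  then show ?case by (simp add: laplace_add L2_borel_sum)
qed (auto simp: laplace_def)

text \<open>
  Weighting by an exponential turns moments at \<open>a + freq l\<close> into Fourier coefficients; in
  this way every statement about Fourier series below extends to shifted lattices.
\<close>

lemma laplace_shift: "laplace (\<lambda>t. exp (a * of_real t) * f t) w = laplace f (w + a)"
  unfolding laplace_def by (simp add: distrib_right exp_add mult.assoc)

lemma laplace_exp: "laplace (\<lambda>t. exp (a * of_real t)) w = unit_laplace (w + a)"
  using laplace_shift[of a "\<lambda>_. 1" w] by (simp add: unit_laplace_def)

lemma unit_laplace_0: "unit_laplace 0 = 1"
  by (simp add: unit_laplace_def laplace_def)

lemma unit_laplace_eq:
  assumes "w \<noteq> 0"
  shows "unit_laplace w = (1 - exp (- w)) / w"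
proof -
  have "unit_laplace w = (LINT t:{-1..0}|lborel. exp (w * of_real t))"
    unfolding unit_laplace_def laplace_def by (simp add: integral_delay)
  also have "\<dots> = (LBINT t. indicator {-1..0} t *\<^sub>R exp (w * of_real t))"
    by (simp add: set_lebesgue_integral_def)
  also have "\<dots> = exp (w * of_real 0) / w - exp (w * of_real (-1)) / w"
    by (rule integral_FTC_atLeastAtMost)
      (auto intro!: continuous_intros derivative_eq_intros has_vector_derivative_real_field simp: assms)
  also have "\<dots> = (1 - exp (- w)) / w" by (simp add: diff_divide_distrib)
  finally show ?thesis .
qed

lemma exp_freq: "exp (freq l) = 1" "exp (- freq l) = 1"
proof -
  show "exp (freq l) = 1" for l
    unfolding freq_def exp_eq_1 by (simp add: mult.commute)
  from this[of "-l"] show "exp (- freq l) = 1" by (simp add: freq_def)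
qed

lemma freq_arith: "freq l - freq k = freq (l - k)" "freq 0 = 0" "freq l + freq k = freq (l + k)" "- freq l = freq (- l)"
  by (simp_all add: freq_def algebra_simps)

lemma unit_laplace_freq: "unit_laplace (freq l) = (if l = 0 then 1 else 0)"
proof (cases "l = 0")
  case False
  then have "freq l \<noteq> 0" by (simp add: freq_def)
  then show ?thesis using False by (simp add: unit_laplace_eq exp_freq)
qed (simp add: unit_laplace_0 freq_arith)

lemma cnj_exp_freq: "cnj (exp (freq l * of_real t)) = exp (- freq l * of_real t)"
  by (simp add: exp_cnj freq_def)

lemma norm_sq_trig_sum:
  assumes "finite F"
  shows "(\<integral>t. (cmod (\<Sum>l\<in>F. x l * exp (- freq l * of_real t)))\<^sup>2 \<partial>delay) = (\<Sum>l\<in>F. (cmod (x l))\<^sup>2)"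
proof -
  let ?s = "\<lambda>t::real. \<Sum>l\<in>F. x l * exp (- freq l * of_real t)"
  have "complex_of_real (\<integral>t. (cmod (?s t))\<^sup>2 \<partial>delay) = (\<integral>t. ?s t * cnj (?s t) \<partial>delay)"
    by (subst integral_complex_of_real[symmetric])
      (rule Bochner_Integration.integral_cong[OF refl], rule complex_norm_square)
  also have "\<dots> = (\<integral>t. (\<Sum>l\<in>F. \<Sum>k\<in>F. (x l * cnj (x k)) * exp (freq (k - l) * of_real t)) \<partial>delay)"
    unfolding cnj_sum sum_product
  proof (intro Bochner_Integration.integral_cong refl sum.cong)
    fix t :: real and l k :: int
    have "exp (freq (k - l) * of_real t) = exp (- freq l * of_real t) * cnj (exp (- freq k * of_real t))"
      by (simp add: freq_def exp_cnj ring_distribs exp_add[symmetric])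
    then show "x l * exp (- freq l * of_real t) * cnj (x k * exp (- freq k * of_real t))
        = x l * cnj (x k) * exp (freq (k - l) * of_real t)" by simp
  qed
  also have "\<dots> = (\<Sum>l\<in>F. \<Sum>k\<in>F. (x l * cnj (x k)) * unit_laplace (freq (k - l)))"
    unfolding unit_laplace_def laplace_def
    by (simp add: L2_borel_integrable L2_borel_exp Bochner_Integration.integral_sum)
  also have "\<dots> = (\<Sum>l\<in>F. x l * cnj (x l))"
    using assms by (intro sum.cong refl) (simp add: unit_laplace_freq if_distrib[of "\<lambda>u. _ * u"] cong: if_cong)
  also have "\<dots> = complex_of_real (\<Sum>l\<in>F. (cmod (x l))\<^sup>2)"
    by (simp add: complex_norm_square del: of_real_power)
  finally show ?thesis using of_real_eq_iff by blast
qed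

text \<open>
  The norm of \<open>f\<close> minus its partial Fourier sum is nonnegative.
\<close>

lemma bessel:
  assumes f: "L2_borel f" and F: "finite F"
  shows "(\<Sum>l\<in>F. (cmod (laplace f (freq l)))\<^sup>2) \<le> (\<integral>t. (cmod (f t))\<^sup>2 \<partial>delay)"
proof -
  define s where "s t = (\<Sum>l\<in>F. laplace f (freq l) * exp (- freq l * of_real t))" for t :: real
  have s: "L2_borel s"
    unfolding s_def by (intro L2_borel_sum L2_borel_cmult L2_borel_exp)
  have cs: "(\<lambda>t. f t * cnj (s t)) = (\<lambda>t. \<Sum>l\<in>F. cnj (laplace f (freq l)) * (exp (freq l * of_real t) * f t))"
    unfolding s_def by (auto simp: fun_eq_iff sum_distrib_left exp_cnj freq_def mult_ac)
  have ifs: "integrable delay (\<lambda>t. f t * cnj (s t))"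
    unfolding cs by (intro L2_borel_integrable L2_borel_sum L2_borel_cmult L2_borel_exp_mult f)
  have "(\<integral>t. f t * cnj (s t) \<partial>delay) = (\<Sum>l\<in>F. cnj (laplace f (freq l)) * laplace f (freq l))"
    unfolding cs laplace_def
    by (subst Bochner_Integration.integral_sum)
      (auto intro!: L2_borel_integrable L2_borel_cmult L2_borel_exp_mult f)
  also have "\<dots> = of_real (\<Sum>l\<in>F. (cmod (laplace f (freq l)))\<^sup>2)"
    by (simp add: complex_norm_square mult.commute del: of_real_power)
  finally have A: "(\<integral>t. Re (f t * cnj (s t)) \<partial>delay) = (\<Sum>l\<in>F. (cmod (laplace f (freq l)))\<^sup>2)"
    by (simp only: integral_Re[OF ifs] Re_complex_of_real)
  have B: "(\<integral>t. (cmod (s t))\<^sup>2 \<partial>delay) = (\<Sum>l\<in>F. (cmod (laplace f (freq l)))\<^sup>2)"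
    unfolding s_def by (rule norm_sq_trig_sum[OF F])
  have "0 \<le> (\<integral>t. (cmod (f t - s t))\<^sup>2 \<partial>delay)"
    by simp
  also have "(\<lambda>t. (cmod (f t - s t))\<^sup>2) = (\<lambda>t. (cmod (f t))\<^sup>2 - 2 * Re (f t * cnj (s t)) + (cmod (s t))\<^sup>2)"
    unfolding cmod_power2 by (simp add: fun_eq_iff power2_eq_square algebra_simps)
  also have "(\<integral>t. (cmod (f t))\<^sup>2 - 2 * Re (f t * cnj (s t)) + (cmod (s t))\<^sup>2 \<partial>delay)
     = (\<integral>t. (cmod (f t))\<^sup>2 \<partial>delay) - 2 * (\<integral>t. Re (f t * cnj (s t)) \<partial>delay) + (\<integral>t. (cmod (s t))\<^sup>2 \<partial>delay)"
  proof -
    define r where "r t = Re (f t * cnj (s t))" for t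
    have "integrable delay r" unfolding r_def using ifs by (rule integrable_Re)
    then show ?thesis
      unfolding r_def[symmetric] using f s by (simp add: L2_borel_def)
  qed
  finally show ?thesis using A B by simp
qed

section \<open>Square-summable families and Neumann series\<close>

text \<open>
  A bound on the norm, tested on finite index sets, stands in for membership in \<open>l\<^sub>2\<close> together with a
  value of the norm; no summability conditions have to be carried along.
\<close>

definition l2_le :: "('a \<Rightarrow> complex) \<Rightarrow> real \<Rightarrow> bool" where
  "l2_le x B \<longleftrightarrow> (\<forall>F. finite F \<longrightarrow> L2_set (\<lambda>i. cmod (x i)) F \<le> B)"

lemma l2_leD: "l2_le x B \<Longrightarrow> finite F \<Longrightarrow> L2_set (\<lambda>i. cmod (x i)) F \<le> B"
  by (simp add: l2_le_def)

lemma l2_le_nonneg: "l2_le x B \<Longrightarrow> 0 \<le> B"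
  using l2_leD[of x B "{}"] by simp

lemma l2_le_component: "l2_le x B \<Longrightarrow> cmod (x i) \<le> B"
  using l2_leD[of x B "{i}"] by simp

lemma l2_le_iff_sum:
  assumes "0 \<le> B"
  shows "l2_le x B \<longleftrightarrow> (\<forall>F. finite F \<longrightarrow> (\<Sum>i\<in>F. (cmod (x i))\<^sup>2) \<le> B\<^sup>2)"
  unfolding l2_le_def L2_set_def using assms by (auto simp: sum_nonneg real_sqrt_le_iff intro: real_le_lsqrt dest: sqrt_le_D)

lemma l2_le_sum_le:
  "l2_le x B \<Longrightarrow> finite F \<Longrightarrow> (\<Sum>i\<in>F. (cmod (x i))\<^sup>2) \<le> B\<^sup>2"
  using l2_le_iff_sum l2_le_nonneg by blast

lemma l2_le_mono: "l2_le x B \<Longrightarrow> (\<And>i. cmod (y i) \<le> cmod (x i)) \<Longrightarrow> B \<le> C \<Longrightarrow> l2_le y C"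
  unfolding l2_le_def by (meson L2_set_mono norm_ge_zero order_trans)

lemma l2_le_add:
  assumes "l2_le x A" "l2_le y B"
  shows "l2_le (\<lambda>i. x i + y i) (A + B)"
  unfolding l2_le_def
proof (intro allI impI)
  fix F :: "'a set" assume "finite F"
  have "L2_set (\<lambda>i. cmod (x i + y i)) F \<le> L2_set (\<lambda>i. cmod (x i) + cmod (y i)) F"
    by (intro L2_set_mono norm_triangle_ineq) auto
  also have "\<dots> \<le> L2_set (\<lambda>i. cmod (x i)) F + L2_set (\<lambda>i. cmod (y i)) F"
    by (rule L2_set_triangle_ineq)
  also have "\<dots> \<le> A + B"
    using assms \<open>finite F\<close> by (intro add_mono l2_leD)
  finally show "L2_set (\<lambda>i. cmod (x i + y i)) F \<le> A + B" .
qed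

lemma l2_le_cmult:
  assumes "l2_le x A"
  shows "l2_le (\<lambda>i. c * x i) (cmod c * A)"
  unfolding l2_le_def
  using assms by (auto simp: norm_mult L2_set_right_distrib[symmetric] l2_leD mult_left_mono)

lemma l2_le_0 [simp]: "l2_le (\<lambda>_. 0) 0"
  by (auto simp: l2_le_def L2_set_0')

lemma l2_le_sum:
  "finite A \<Longrightarrow> (\<And>a. a \<in> A \<Longrightarrow> l2_le (x a) (B a)) \<Longrightarrow> l2_le (\<lambda>i. \<Sum>a\<in>A. x a i) (\<Sum>a\<in>A. B a)"
  by (induction A rule: finite_induct) (auto intro: l2_le_add)

lemma l2_le_comp_inj:
  assumes "l2_le x B" "inj f"
  shows "l2_le (\<lambda>i. x (f i)) B"
proof -
  have "(\<Sum>i\<in>F. (cmod (x (f i)))\<^sup>2) \<le> B\<^sup>2" if "finite F" for F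
    using l2_le_sum_le[OF assms(1), of "f ` F"] that assms(2)
    by (simp add: sum.reindex inj_on_subset)
  then show ?thesis using l2_le_nonneg[OF assms(1)] by (simp add: l2_le_iff_sum)
qed

lemma summable_on_imp_l2_le:
  assumes "(\<lambda>i. (cmod (x i))\<^sup>2) summable_on UNIV"
  shows "\<exists>B. l2_le x B"
proof -
  let ?s = "\<Sum>\<^sub>\<infinity>i. (cmod (x i))\<^sup>2"
  have "(\<Sum>i\<in>F. (cmod (x i))\<^sup>2) \<le> ?s" if "finite F" for F
    by (rule finite_sum_le_infsum[OF assms that]) auto
  moreover have "0 \<le> ?s" by (simp add: infsum_nonneg)
  ultimately have "l2_le x (sqrt ?s)" by (simp add: l2_le_iff_sum)
  then show ?thesis ..
qed

lemma l2_le_imp_summable_on: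
  assumes "l2_le x B"
  shows "(\<lambda>i. (cmod (x i))\<^sup>2) summable_on UNIV"
  by (rule nonneg_bdd_above_summable_on) (auto intro!: bdd_aboveI2 l2_le_sum_le[OF assms])

lemma l2_le_cauchy_schwarz:
  assumes "l2_le x A" "l2_le y B"
  shows "(\<lambda>i. cmod (x i * y i)) summable_on UNIV" "cmod (\<Sum>\<^sub>\<infinity>i. x i * y i) \<le> A * B"
proof -
  have le: "(\<Sum>i\<in>F. cmod (x i * y i)) \<le> A * B" if "finite F" for F
  proof -
    have "(\<Sum>i\<in>F. cmod (x i * y i)) \<le> L2_set (\<lambda>i. cmod (x i)) F * L2_set (\<lambda>i. cmod (y i)) F"
      using L2_set_mult_ineq[of "\<lambda>i. cmod (x i)" "\<lambda>i. cmod (y i)" F] by (simp add: norm_mult)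
    also have "\<dots> \<le> A * B"
      using assms that by (intro mult_mono l2_leD) (auto intro: l2_le_nonneg)
    finally show ?thesis .
  qed
  then show s: "(\<lambda>i. cmod (x i * y i)) summable_on UNIV"
    by (intro nonneg_bdd_above_summable_on) (auto intro!: bdd_aboveI2)
  have "cmod (\<Sum>\<^sub>\<infinity>i. x i * y i) \<le> (\<Sum>\<^sub>\<infinity>i. cmod (x i * y i))"
    by (rule norm_infsum_bound[OF s])
  also have "\<dots> \<le> A * B" by (rule infsum_le_finite_sums[OF s]) (use le in auto)
  finally show "cmod (\<Sum>\<^sub>\<infinity>i. x i * y i) \<le> A * B" .
qed

lemma l2_le_has_sum:
  assumes "l2_le x A" "l2_le y B"
  shows "((\<lambda>i. x i * y i) has_sum (\<Sum>\<^sub>\<infinity>i. x i * y i)) UNIV"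
  using abs_summable_summable[OF l2_le_cauchy_schwarz(1)[OF assms]] by simp

lemma summable_on_small_tail:
  fixes g :: "'a \<Rightarrow> real"
  assumes "g summable_on UNIV" "e > 0"
  obtains S where "finite S" "\<And>F. finite F \<Longrightarrow> F \<inter> S = {} \<Longrightarrow> sum g F < e"
proof -
  let ?s = "infsum g UNIV"
  have "(sum g \<longlongrightarrow> ?s) (finite_subsets_at_top UNIV)"
    using has_sum_infsum[OF assms(1)] by (simp add: has_sum_def)
  then have "eventually (\<lambda>F. dist (sum g F) ?s < e/2) (finite_subsets_at_top UNIV)"
    using assms(2) by (intro tendstoD) auto
  then obtain S where S: "finite S" "\<And>F. finite F \<Longrightarrow> S \<subseteq> F \<Longrightarrow> dist (sum g F) ?s < e/2"
    by (auto simp: eventually_finite_subsets_at_top)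
  have "sum g F < e" if "finite F" "F \<inter> S = {}" for F
  proof -
    have "sum g (S \<union> F) = sum g S + sum g F"
      using that S(1) by (intro sum.union_disjoint) auto
    moreover have "dist (sum g (S \<union> F)) ?s < e/2" "dist (sum g S) ?s < e/2"
      using that S by auto
    ultimately show ?thesis unfolding dist_real_def by linarith
  qed
  with S(1) show ?thesis using that by blast
qed

text \<open>
  With the least bound \<open>C\<close> the fact that \<open>B + q C\<close> is a bound, too, becomes an inequality that can be solved for \<open>C\<close>.
\<close>

lemma l2_le_least:
  assumes "l2_le x B"
  obtains C where "l2_le x C" "\<And>D. l2_le x D \<Longrightarrow> C \<le> D"
proof
  define A where "A = (\<lambda>F. L2_set (\<lambda>i. cmod (x i)) F) ` {F. finite F}"
  have bdd: "bdd_above A" unfolding A_def using l2_leD[OF assms] by (auto intro!: bdd_aboveI2)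
  show "l2_le x (Sup A)"
    unfolding l2_le_def using bdd by (auto simp: A_def intro!: cSup_upper)
  have "A \<noteq> {}" by (auto simp: A_def)
  show "Sup A \<le> D" if "l2_le x D" for D
    by (rule cSup_least[OF \<open>A \<noteq> {}\<close>]) (use that in \<open>auto simp: A_def l2_leD\<close>)
qed

definition row_apply :: "('a \<Rightarrow> 'b \<Rightarrow> complex) \<Rightarrow> ('b \<Rightarrow> complex) \<Rightarrow> 'a \<Rightarrow> complex" where
  "row_apply K x i = (\<Sum>\<^sub>\<infinity>l. K i l * x l)"

text \<open>
  A bound on the Hilbert-Schmidt norm, in terms of bounds \<open>\<rho> i\<close> on the norms of the rows.
\<close>

definition hs_bounded :: "('a \<Rightarrow> 'b \<Rightarrow> complex) \<Rightarrow> real \<Rightarrow> bool" where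
  "hs_bounded K q \<longleftrightarrow> 0 \<le> q \<and> (\<exists>\<rho>. (\<forall>i. l2_le (K i) (\<rho> i)) \<and> l2_le (\<lambda>i. of_real (\<rho> i)) q)"

lemma hs_bounded_row:
  assumes "hs_bounded K q"
  shows "l2_le (K i) q"
proof -
  from assms obtain \<rho> where r: "\<And>i. l2_le (K i) (\<rho> i)" "l2_le (\<lambda>i. of_real (\<rho> i)) q"
    unfolding hs_bounded_def by blast
  have "\<rho> i \<le> q" using l2_le_component[OF r(2), of i] by simp
  then show ?thesis using r(1)[of i] by (auto intro: l2_le_mono)
qed

text \<open>
  By the Cauchy-Schwarz inequality the \<open>i\<close>-th entry of the result is at most \<open>\<rho> i * B\<close>.
\<close>

lemma l2_le_row_apply:
  assumes "hs_bounded K q" "l2_le x B"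
  shows "l2_le (row_apply K x) (q * B)"
proof -
  from assms obtain \<rho> where r: "\<And>i. l2_le (K i) (\<rho> i)" "l2_le (\<lambda>i. of_real (\<rho> i)) q"
    unfolding hs_bounded_def by blast
  have "cmod (row_apply K x i) \<le> \<rho> i * B" for i
    unfolding row_apply_def by (rule l2_le_cauchy_schwarz(2)[OF r(1) assms(2)])
  moreover have "l2_le (\<lambda>i. of_real B * of_real (\<rho> i)) (cmod (of_real B) * q)"
    by (rule l2_le_cmult[OF r(2)])
  ultimately show ?thesis
    using l2_le_nonneg[OF assms(2)] l2_le_nonneg[OF r(1)]
    by (auto elim!: l2_le_mono simp: norm_mult mult.commute)
qed

lemma row_apply_has_sum:
  assumes "hs_bounded K q" "l2_le x B"
  shows "((\<lambda>l. K i l * x l) has_sum row_apply K x i) UNIV"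
  unfolding row_apply_def by (rule l2_le_has_sum[OF hs_bounded_row[OF assms(1)] assms(2)])

lemma has_sum_sum_finite:
  fixes f :: "'i \<Rightarrow> 'a \<Rightarrow> 'b::topological_comm_monoid_add"
  assumes "\<And>i. i \<in> A \<Longrightarrow> (f i has_sum g i) S"
  shows "((\<lambda>x. \<Sum>i\<in>A. f i x) has_sum (\<Sum>i\<in>A. g i)) S"
  using assms by (induction A rule: infinite_finite_induct) (auto intro: has_sum_add)

lemma row_apply_diff:
  assumes "hs_bounded K q" "l2_le x A" "l2_le y B"
  shows "row_apply K (\<lambda>l. x l - y l) i = row_apply K x i - row_apply K y i"
proof -
  have "((\<lambda>l. K i l * x l - K i l * y l) has_sum (row_apply K x i - row_apply K y i)) UNIV"
    using has_sum_add[OF row_apply_has_sum[OF assms(1,2)] has_sum_cmult_right[OF row_apply_has_sum[OF assms(1,3)], of "-1"]]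
    by simp
  then show ?thesis
    using infsumI unfolding row_apply_def right_diff_distrib by blast
qed

lemma neumann_estimate:
  assumes K: "hs_bounded K q" and q: "q < 1" and x: "l2_le x A" and y: "l2_le y B"
    and eq: "\<And>i. x i = y i + row_apply K x i"
  shows "l2_le x (B / (1 - q))"
proof -
  obtain C where C: "l2_le x C" "\<And>D. l2_le x D \<Longrightarrow> C \<le> D"
    using l2_le_least[OF x] by blast
  have "l2_le (\<lambda>i. y i + row_apply K x i) (B + q * C)"
    by (intro l2_le_add y l2_le_row_apply K C)
  then have "l2_le x (B + q * C)" using eq[symmetric] by simp
  from C(2)[OF this] have "C \<le> B / (1 - q)" using q by (simp add: field_simps)
  then show ?thesis using C(1) by (auto intro: l2_le_mono)
qed

text \<open>
  The solution is the series of the iterates of \<open>y\<close>. The sum is formed entrywise; the remainder estimates,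
  obtained on finite index sets and passed to the limit there, show that it is in \<open>l\<^sub>2\<close> and that the
  operator may be applied termwise.
\<close>

lemma neumann_solution:
  assumes K: "hs_bounded K q" and q: "q < 1" and y: "l2_le y B"
  obtains x where "l2_le x (B / (1 - q))" "\<And>i. x i = y i + row_apply K x i"
proof -
  have q0: "0 \<le> q" using K by (simp add: hs_bounded_def)
  define u where "u n = (row_apply K ^^ n) y" for n
  have u0: "u 0 = y" and uS: "u (Suc n) = row_apply K (u n)" for n
    by (simp_all add: u_def)
  have u: "l2_le (u n) (q ^ n * B)" for n
  proof (induction n)
    case (Suc n)
    from l2_le_row_apply[OF K Suc] show ?case by (simp add: uS mult.assoc)
  qed (simp add: u0 y)
  define x where "x i = (\<Sum>n. u n i)" for i
  have gs: "(\<lambda>n. q ^ n * B) sums (B / (1 - q))"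
    using sums_mult2[OF geometric_sums[of q], of B] q q0 by simp
  have su: "summable (\<lambda>n. u n i)" for i
    by (rule summable_comparison_test[OF _ sums_summable[OF gs]])
      (use l2_le_component[OF u] in auto)
  have B0: "0 \<le> B" using l2_le_nonneg[OF y] .
  \<comment> \<open>For \<open>m = 0\<close> this bounds \<open>x\<close>; for \<open>m \<longlonglongrightarrow> \<infinity>\<close> it justifies applying \<open>K\<close> termwise.\<close>
  have tail: "l2_le (\<lambda>i. x i - (\<Sum>n<m. u n i)) (q ^ m * B / (1 - q))" for m
    unfolding l2_le_def
  proof (intro allI impI)
    fix F :: "'a set" assume F: "finite F"
    have lim: "(\<lambda>k. \<Sum>n<k. u (n + m) i) \<longlonglongrightarrow> x i - (\<Sum>n<m. u n i)" for i
      using su[of i] summable_ignore_initial_segment[OF su[of i], of m]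
      unfolding x_def by (subst suminf_minus_initial_segment[symmetric]) (auto intro: summable_LIMSEQ)
    have "(\<lambda>k. L2_set (\<lambda>i. cmod (\<Sum>n<k. u (n + m) i)) F) \<longlonglongrightarrow> L2_set (\<lambda>i. cmod (x i - (\<Sum>n<m. u n i))) F"
      unfolding L2_set_def by (intro tendsto_intros lim)
    moreover have "L2_set (\<lambda>i. cmod (\<Sum>n<k. u (n + m) i)) F \<le> q ^ m * B / (1 - q)" for k
    proof -
      have "l2_le (\<lambda>i. \<Sum>n<k. u (n + m) i) (\<Sum>n<k. q ^ (n + m) * B)"
        by (intro l2_le_sum u) auto
      from l2_leD[OF this F]
      have "L2_set (\<lambda>i. cmod (\<Sum>n<k. u (n + m) i)) F \<le> q ^ m * (\<Sum>n<k. q ^ n * B)"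
        by (simp add: power_add sum_distrib_left mult_ac)
      also have "\<dots> \<le> q ^ m * (B / (1 - q))"
        using q0 B0 gs by (intro mult_left_mono sum_le_suminf[THEN order_trans]) 
          (auto simp: sums_iff)
      finally show ?thesis by simp
    qed
    ultimately show "L2_set (\<lambda>i. cmod (x i - (\<Sum>n<m. u n i))) F \<le> q ^ m * B / (1 - q)"
      by (intro LIMSEQ_le_const2) auto
  qed
  have xb: "l2_le x (B / (1 - q))" using tail[of 0] by simp
  have Ksum: "row_apply K (\<lambda>i. \<Sum>n<m. u n i) i = (\<Sum>n<m. u (Suc n) i)" for m i
  proof -
    have "((\<lambda>l. \<Sum>n<m. K i l * u n l) has_sum (\<Sum>n<m. row_apply K (u n) i)) UNIV"
      by (intro has_sum_sum_finite row_apply_has_sum[OF K u])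
    then show ?thesis unfolding row_apply_def[of K "\<lambda>i. \<Sum>n<m. u n i"] sum_distrib_left uS
      using infsumI by blast
  qed
  have "x i = y i + row_apply K x i" for i
  proof -
    have e: "x i - (\<Sum>n<Suc m. u n i) = (x i - y i - row_apply K x i) + row_apply K (\<lambda>j. x j - (\<Sum>n<m. u n j)) i" for m
    proof -
      have "l2_le (\<lambda>j. \<Sum>n<m. u n j) (\<Sum>n<m. q ^ n * B)"
        by (intro l2_le_sum u) auto
      then show ?thesis
        by (simp add: row_apply_diff[OF K xb] Ksum u0 sum.lessThan_Suc_shift del: sum.lessThan_Suc)
    qed
    have "cmod (x i - y i - row_apply K x i) \<le> 2 * (q ^ Suc m * B / (1 - q))" for m
    proof -
      let ?r = "row_apply K (\<lambda>j. x j - (\<Sum>n<m. u n j)) i"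
      have "cmod (x i - y i - row_apply K x i) \<le> cmod (x i - (\<Sum>n<Suc m. u n i)) + cmod ?r"
        using norm_triangle_ineq4[of "(x i - y i - row_apply K x i) + ?r" ?r]
        unfolding e[of m] add_diff_cancel_right' .
      also have "\<dots> \<le> q ^ Suc m * B / (1 - q) + q * (q ^ m * B / (1 - q))"
        by (intro add_mono l2_le_component[OF tail] l2_le_component[OF l2_le_row_apply[OF K tail]])
      finally show ?thesis by (simp add: mult_ac)
    qed
    moreover have "(\<lambda>m. 2 * (q ^ Suc m * B / (1 - q))) \<longlonglongrightarrow> 2 * (0 * B / (1 - q))"
    proof -
      have "(\<lambda>m. q ^ Suc m) \<longlonglongrightarrow> 0" by (rule LIMSEQ_Suc[OF LIMSEQ_realpow_zero[OF q0 q]])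
      moreover have "1 - q \<noteq> 0" using q by simp
      ultimately show ?thesis by (intro tendsto_intros)
    qed
    ultimately have "cmod (x i - y i - row_apply K x i) \<le> 2 * (0 * B / (1 - q))"
      by (intro LIMSEQ_le_const) auto
    then show ?thesis by (simp add: algebra_simps)
  qed
  with xb show ?thesis using that by blast
qed

section \<open>The Riesz-Fischer theorem, division and continuity\<close>

lemma l2_le_laplace_freq:
  assumes "L2_borel f"
  shows "l2_le (\<lambda>l. laplace f (freq l)) (sqrt (\<integral>t. (cmod (f t))\<^sup>2 \<partial>delay))"
  using bessel[OF assms] by (simp add: l2_le_iff_sum)

lemma l2_le_laplace_freq_uminus:
  assumes "L2_borel f"
  shows "l2_le (\<lambda>l. laplace f (- freq l)) (sqrt (\<integral>t. (cmod (f t))\<^sup>2 \<partial>delay))"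
  using l2_le_comp_inj[OF l2_le_laplace_freq[OF assms], of uminus] by (simp add: freq_arith)

lemma l2_le_unit_laplace:
  "\<exists>B. l2_le (\<lambda>l. unit_laplace (w - freq l)) B"
  using l2_le_laplace_freq_uminus[OF L2_borel_exp[of w]]
  by (auto simp: laplace_exp add.commute[of _ w])

lemma AE_summable_norm:
  fixes h :: "nat \<Rightarrow> real \<Rightarrow> complex"
  assumes h: "\<And>j. integrable M (h j)" and s: "summable (\<lambda>j. \<integral>t. cmod (h j t) \<partial>M)"
  shows "AE t in M. summable (\<lambda>j. cmod (h j t))"
proof -
  have [measurable]: "\<And>j. h j \<in> borel_measurable M" using h by auto
  have "(\<integral>\<^sup>+ t. (\<Sum>j. ennreal (cmod (h j t))) \<partial>M) = (\<Sum>j. \<integral>\<^sup>+ t. ennreal (cmod (h j t)) \<partial>M)"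
    by (rule nn_integral_suminf) measurable
  also have "\<dots> = (\<Sum>j. ennreal (\<integral>t. cmod (h j t) \<partial>M))"
    by (intro suminf_cong nn_integral_eq_integral integrable_norm h) auto
  also have "\<dots> \<noteq> \<infinity>"
    unfolding infinity_ennreal_def by (rule ennreal_suminf_neq_top[OF s]) auto
  finally have "AE t in M. (\<Sum>j. ennreal (cmod (h j t))) \<noteq> \<infinity>"
    by (intro nn_integral_PInf_AE) auto
  then show ?thesis
    by eventually_elim (auto intro: summable_suminf_not_top)
qed

text \<open>
  The Cauchy-Schwarz inequality for a probability measure, in the form that follows from
  \<open>2 x \<le> s + x\<^sup>2 / s\<close>.
\<close>

lemma integral_norm_le_of_square:
  assumes f: "L2_borel f" and s: "s > 0" and b: "(\<integral>t. (cmod (f t))\<^sup>2 \<partial>delay) \<le> s\<^sup>2"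
  shows "(\<integral>t. cmod (f t) \<partial>delay) \<le> s"
proof -
  have i2: "integrable delay (\<lambda>t. (cmod (f t))\<^sup>2)" using f by (simp add: L2_borel_def)
  have "x \<le> (s + x\<^sup>2 / s) / 2" for x :: real
    using s sum_power2_ge_zero[of "x - s" 0] by (simp add: field_simps power2_eq_square)
  then have "(\<integral>t. cmod (f t) \<partial>delay) \<le> (\<integral>t. (s + (cmod (f t))\<^sup>2 / s) / 2 \<partial>delay)"
    using i2 L2_borel_integrable[OF f] by (intro integral_delay_mono) auto
  also have "\<dots> = (s + (\<integral>t. (cmod (f t))\<^sup>2 \<partial>delay) / s) / 2"
    using i2 by simp
  also have "\<dots> \<le> (s + s\<^sup>2 / s) / 2"
    using s b by (intro divide_right_mono add_left_mono) auto
  also have "\<dots> = s" using s by (simp add: power2_eq_square)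
  finally show ?thesis .
qed

text \<open>
  Fatou's lemma.
\<close>

lemma L2_borel_AE_limit:
  assumes [measurable]: "f \<in> borel_measurable borel" and S: "\<And>n. L2_borel (S n)"
    and lim: "AE t in delay. (\<lambda>n. S n t) \<longlonglongrightarrow> f t"
    and b: "\<And>n. (\<integral>t. (cmod (S n t))\<^sup>2 \<partial>delay) \<le> B"
  shows "L2_borel f"
proof -
  note [measurable] = S
  have "(\<integral>\<^sup>+ t. ennreal ((cmod (f t))\<^sup>2) \<partial>delay)
      = (\<integral>\<^sup>+ t. liminf (\<lambda>n. ennreal ((cmod (S n t))\<^sup>2)) \<partial>delay)"
  proof (rule nn_integral_cong_AE)
    show "AE t in delay. ennreal ((cmod (f t))\<^sup>2) = liminf (\<lambda>n. ennreal ((cmod (S n t))\<^sup>2))"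
      using lim
    proof eventually_elim
      case (elim t)
      then have "(\<lambda>n. ennreal ((cmod (S n t))\<^sup>2)) \<longlonglongrightarrow> ennreal ((cmod (f t))\<^sup>2)"
        by (intro tendsto_ennrealI tendsto_intros)
      from lim_imp_Liminf[OF _ this] show ?case by simp
    qed
  qed
  also have "\<dots> \<le> liminf (\<lambda>n. \<integral>\<^sup>+ t. ennreal ((cmod (S n t))\<^sup>2) \<partial>delay)"
    by (rule nn_integral_liminf) measurable
  also have "\<dots> = liminf (\<lambda>n. ennreal (\<integral>t. (cmod (S n t))\<^sup>2 \<partial>delay))"
    using S by (subst nn_integral_eq_integral) (auto simp: L2_borel_def)
  also have "\<dots> \<le> liminf (\<lambda>n. ennreal B)"
    by (intro Liminf_mono always_eventually allI ennreal_leI b)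
  also have "\<dots> < \<infinity>" by (simp add: Liminf_const)
  finally show ?thesis
    unfolding L2_borel_def integrable_iff_bounded by simp
qed

text \<open>
  The Fourier series is summed in blocks \<open>D j\<close> along an exhaustion of the integers in which the tail norms decay
  like \<open>2\<^sup>-\<^sup>j\<close>. The block sums then have summable \<open>L\<^sub>1\<close> norms, so the series converges almost everywhere and may
  be integrated termwise against a bounded exponential.
\<close>

lemma riesz_fischer:
  assumes x: "l2_le x B"
  obtains f where "L2_borel f"
    "\<And>w. ((\<lambda>l. x l * unit_laplace (w - freq l)) has_sum laplace f w) UNIV"
proof -
  have "\<exists>S. finite S \<and> (\<forall>F. finite F \<longrightarrow> F \<inter> S = {} \<longrightarrow> (\<Sum>l\<in>F. (cmod (x l))\<^sup>2) < ((1/2) ^ j)\<^sup>2)" for j :: nat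
    using summable_on_small_tail[OF l2_le_imp_summable_on[OF x], of "((1/2) ^ j)\<^sup>2"]
    by (metis half_gt_zero_iff zero_less_one zero_less_power)
  then obtain A' where A': "\<And>j. finite (A' j)"
     "\<And>j F. finite F \<Longrightarrow> F \<inter> A' j = {} \<Longrightarrow> (\<Sum>l\<in>F. (cmod (x l))\<^sup>2) < ((1/2) ^ j)\<^sup>2" by metis
  define A where "A j = (\<Union>i\<le>j. A' i \<union> {- int i..int i})" for j
  have finA [simp]: "finite (A j)" for j by (auto simp: A_def A')
  have Amono: "A i \<subseteq> A j" if "i \<le> j" for i j
    unfolding A_def by (rule UN_mono) (use that in auto)
  have A'A: "A' j \<subseteq> A j" for j by (auto simp: A_def)
  have Aex: "\<exists>n. F \<subseteq> A n" if "finite F" for F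
  proof -
    have "l \<in> A (Max ((nat \<circ> abs) ` F))" if "l \<in> F" for l
    proof -
      have "nat \<bar>l\<bar> \<le> Max ((nat \<circ> abs) ` F)"
        using \<open>finite F\<close> that by (auto intro!: Max_ge)
      then show ?thesis unfolding A_def by force
    qed
    then show ?thesis by blast
  qed
  define e :: "int \<Rightarrow> real \<Rightarrow> complex" where "e l t = x l * exp (- freq l * of_real t)" for l t
  have e: "L2_borel (e l)" for l
    unfolding e_def by (intro L2_borel_cmult L2_borel_exp)
  define D where "D j = A j - (case j of 0 \<Rightarrow> {} | Suc i \<Rightarrow> A i)" for j
  have finD [simp]: "finite (D j)" for j by (auto simp: D_def)
  define h where "h j t = (\<Sum>l\<in>D j. e l t)" for j t
  have h: "L2_borel (h j)" for j
    unfolding h_def by (intro L2_borel_sum e)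
  note [measurable] = h e
  have sumD: "(\<Sum>j\<le>n. sum g (D j)) = sum g (A n)" for n and g :: "int \<Rightarrow> complex"
  proof (induction n)
    case (Suc n)
    have "sum g (A (Suc n)) = sum g (A (Suc n) - A n) + sum g (A n)"
      using Amono[of n "Suc n"] by (intro sum.subset_diff) auto
    then show ?case using Suc by (simp add: D_def)
  qed (simp add: D_def)
  have hint: "(\<integral>t. cmod (h (Suc i) t) \<partial>delay) \<le> (1/2) ^ i" for i
  proof (rule integral_norm_le_of_square[OF h])
    have "(\<integral>t. (cmod (h (Suc i) t))\<^sup>2 \<partial>delay) = (\<Sum>l\<in>D (Suc i). (cmod (x l))\<^sup>2)"
      unfolding h_def e_def by (rule norm_sq_trig_sum) simp
    also have "\<dots> < ((1/2) ^ i)\<^sup>2"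
      by (rule A'(2)) (use A'A[of i] in \<open>auto simp: D_def\<close>)
    finally show "(\<integral>t. (cmod (h (Suc i) t))\<^sup>2 \<partial>delay) \<le> ((1/2) ^ i)\<^sup>2" by simp
  qed simp
  have hsum: "summable (\<lambda>j. \<integral>t. cmod (h j t) \<partial>delay)"
  proof -
    have "summable (\<lambda>i. \<integral>t. cmod (h (Suc i) t) \<partial>delay)"
      by (rule summable_comparison_test[of _ "\<lambda>i. (1/2) ^ i"]) (auto intro!: exI[of _ 0] hint summable_geometric)
    then show ?thesis by (rule summable_Suc_iff[THEN iffD1])
  qed
  have hAE: "AE t in delay. summable (\<lambda>j. cmod (h j t))"
    by (rule AE_summable_norm[OF L2_borel_integrable[OF h] hsum])
  define f where "f t = (\<Sum>j. h j t)" for t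
  have f: "L2_borel f"
  proof (rule L2_borel_AE_limit)
    show "f \<in> borel_measurable borel" unfolding f_def by measurable
    show "L2_borel (\<lambda>t. \<Sum>j\<le>n. h j t)" for n by (intro L2_borel_sum h)
    show "AE t in delay. (\<lambda>n. \<Sum>j\<le>n. h j t) \<longlonglongrightarrow> f t"
      using hAE by eventually_elim (auto simp: f_def intro!: summable_LIMSEQ' summable_norm_cancel)
    show "(\<integral>t. (cmod (\<Sum>j\<le>n. h j t))\<^sup>2 \<partial>delay) \<le> B\<^sup>2" for n
      unfolding h_def sumD e_def
      by (subst norm_sq_trig_sum) (auto intro: l2_le_sum_le[OF x])
  qed
  have "((\<lambda>l. x l * unit_laplace (w - freq l)) has_sum laplace f w) UNIV" for w
  proof -
    let ?g = "\<lambda>l. x l * unit_laplace (w - freq l)"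
    obtain C where C: "l2_le (\<lambda>l. unit_laplace (w - freq l)) C"
      using l2_le_unit_laplace by blast
    have hs: "(?g has_sum (infsum ?g UNIV)) UNIV"
      by (rule l2_le_has_sum[OF x C])
    have lap: "laplace (h j) w = sum ?g (D j)" for j
    proof -
      have "laplace (e l) w = ?g l" for l
        using laplace_cmult[of "x l" "\<lambda>t. exp (- freq l * of_real t)" w] laplace_exp[of "- freq l" w]
        by (simp add: e_def[abs_def])
      then show ?thesis unfolding h_def[abs_def] laplace_sum[OF e] by simp
    qed
    have hw: "integrable delay (\<lambda>t. exp (w * of_real t) * h j t)" for j
      by (intro L2_borel_integrable L2_borel_exp_mult h)
    have bd: "(\<integral>t. cmod (exp (w * of_real t) * h j t) \<partial>delay) \<le> exp (cmod w) * (\<integral>t. cmod (h j t) \<partial>delay)" for j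
      unfolding integral_mult_right_zero[symmetric]
      using hw[of j] L2_borel_integrable[OF h[of j]]
      by (intro integral_delay_mono integrable_norm integrable_mult_right)
         (auto simp del: norm_exp_eq_Re simp: norm_mult intro!: mult_right_mono cmod_exp_delay)
    have "(\<lambda>j. laplace (h j) w) sums (\<integral>t. (\<Sum>j. exp (w * of_real t) * h j t) \<partial>delay)"
      unfolding laplace_def
    proof (rule sums_integral[OF hw])
      show "AE t in delay. summable (\<lambda>j. cmod (exp (w * of_real t) * h j t))"
        using hAE by eventually_elim (auto simp: norm_mult)
      show "summable (\<lambda>j. \<integral>t. cmod (exp (w * of_real t) * h j t) \<partial>delay)"
        using bd by (intro summable_comparison_test[OF _ summable_mult[OF hsum]]) auto
    qed
    also have "(\<integral>t. (\<Sum>j. exp (w * of_real t) * h j t) \<partial>delay) = laplace f w"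
      unfolding laplace_def f_def
    proof (rule integral_cong_AE)
      show "AE t in delay. (\<Sum>j. exp (w * of_real t) * h j t) = exp (w * of_real t) * (\<Sum>j. h j t)"
        using hAE by eventually_elim (auto intro!: suminf_mult summable_norm_cancel)
    qed auto
    finally have "(\<lambda>n. \<Sum>j\<le>n. laplace (h j) w) \<longlonglongrightarrow> laplace f w"
      by (simp add: sums_def_le)
    then have lim1: "(\<lambda>n. sum ?g (A n)) \<longlonglongrightarrow> laplace f w"
      unfolding lap sumD .
    have "filterlim A (finite_subsets_at_top UNIV) sequentially"
      unfolding filterlim_finite_subsets_at_top eventually_sequentially
      using Aex Amono by (metis finA subset_trans top_greatest)
    then have "(\<lambda>n. sum ?g (A n)) \<longlonglongrightarrow> infsum ?g UNIV"
      using hs unfolding has_sum_def by (rule filterlim_compose[rotated])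
    then have "laplace f w = infsum ?g UNIV" by (rule LIMSEQ_unique[OF lim1])
    with hs show ?thesis by simp
  qed
  with f show ?thesis using that by blast
qed

text \<open>
  The quotient is the transform of the solution of \<open>g' + w0 g = - f\<close> with \<open>g = 0\<close> at \<open>-1\<close>,
  as an exchange of the order of integration shows.
\<close>

lemma laplace_division:
  assumes f: "L2_borel f"
  obtains g where "L2_borel g" "\<And>w. w \<noteq> w0 \<Longrightarrow> laplace g w = (laplace f w - laplace f w0) / (w - w0)"
proof -
  have [measurable]: "f \<in> borel_measurable borel" using f by (simp add: L2_borel_def)
  \<comment> \<open>Variation of constants for the differential equation.\<close>
  define k where "k s t = (if t \<le> s then - exp (w0 * of_real (t - s)) * f t else 0)" for s t :: real
  define g where "g s = (\<integral>t. k s t \<partial>delay)" for s :: real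
  have fi: "integrable delay (\<lambda>t. cmod (f t))"
    using L2_borel_integrable[OF f] by simp
  have gm: "g \<in> borel_measurable borel"
    unfolding g_def
  proof (rule delay.borel_measurable_lebesgue_integral)
    show "(\<lambda>(s, t). k s t) \<in> borel_measurable (borel \<Otimes>\<^sub>M delay)"
      unfolding k_def by measurable
  qed
  have gb: "cmod (g s) \<le> exp (cmod w0) * (\<integral>t. cmod (f t) \<partial>delay)" if s: "s \<in> {-1..0}" for s
  proof -
    have *: "cmod (k s t) \<le> exp (cmod w0) * cmod (f t)" if "t \<in> {-1..0}" for t
    proof (cases "t \<le> s")
      case True
      then have "cmod (exp (w0 * of_real (t - s))) \<le> exp (cmod w0)"
        using s that by (intro cmod_exp_delay) auto
      then show ?thesis using True by (simp add: k_def norm_mult mult_right_mono)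
    qed (simp add: k_def)
    have "cmod (g s) \<le> (\<integral>t. cmod (k s t) \<partial>delay)"
      unfolding g_def by (rule integral_norm_bound)
    also have "\<dots> \<le> (\<integral>t. exp (cmod w0) * cmod (f t) \<partial>delay)"
    proof (rule integral_delay_mono[OF _ _ *])
      show "integrable delay (\<lambda>t. exp (cmod w0) * cmod (f t))" using fi by simp
      show "integrable delay (\<lambda>t. cmod (k s t))"
      proof (rule Bochner_Integration.integrable_bound)
        show "integrable delay (\<lambda>t. exp (cmod w0) * cmod (f t))" using fi by simp
        show "AE t in delay. norm (cmod (k s t)) \<le> norm (exp (cmod w0) * cmod (f t))"
          using AE_delay by eventually_elim (use * in auto)
      qed (unfold k_def, measurable)
    qed
    finally show ?thesis by simp
  qed
  have g: "L2_borel g"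
    by (rule L2_borel_bounded[OF gm gb])
  have "laplace g w = (laplace f w - laplace f w0) / (w - w0)" if w: "w \<noteq> w0" for w
  proof -
    define v where "v = w - w0"
    have v: "v \<noteq> 0" using w by (simp add: v_def)
    interpret P: pair_sigma_finite delay delay ..
    define F where "F t s = (if t \<le> s then - exp (w0 * of_real t) * f t * exp (v * of_real s) else 0)" for t s :: real
    have Fm: "case_prod F \<in> borel_measurable (delay \<Otimes>\<^sub>M delay)"
      unfolding F_def by measurable
    have Fb: "cmod (F t s) \<le> exp (cmod w0) * exp (cmod v) * cmod (f t)" if "t \<in> {-1..0}" "s \<in> {-1..0}" for t s
    proof -
      have "cmod (F t s) \<le> cmod (exp (w0 * of_real t)) * cmod (f t) * cmod (exp (v * of_real s))"
        unfolding F_def by (auto simp: norm_mult)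
      also have "\<dots> \<le> exp (cmod w0) * cmod (f t) * exp (cmod v)"
        using that by (intro mult_mono cmod_exp_delay) auto
      finally show ?thesis by (simp add: mult_ac)
    qed
    have Fi: "integrable (delay \<Otimes>\<^sub>M delay) (case_prod F)"
    proof (rule P.Fubini_integrable[OF Fm])
      let ?C = "exp (cmod w0) * exp (cmod v)"
      have Ft [measurable]: "F t \<in> borel_measurable borel" for t
        unfolding F_def by measurable
      show "integrable delay (\<lambda>t. \<integral>s. norm (case_prod F (t, s)) \<partial>delay)"
      proof (rule Bochner_Integration.integrable_bound)
        show "integrable delay (\<lambda>t. ?C * cmod (f t))" using fi by simp
        show "(\<lambda>t. \<integral>s. norm (case_prod F (t, s)) \<partial>delay) \<in> borel_measurable delay"
          unfolding case_prod_conv F_def by measurable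
        show "AE t in delay. norm (\<integral>s. norm (case_prod F (t, s)) \<partial>delay) \<le> norm (?C * cmod (f t))"
          using AE_delay
        proof eventually_elim
          case (elim t)
          have "(\<integral>s. norm (F t s) \<partial>delay) \<le> ?C * cmod (f t)"
            by (rule integral_delay_le) (use Fb[OF elim] in auto)
          then show ?case by (simp add: abs_of_nonneg)
        qed
      qed
      show "AE t in delay. integrable delay (\<lambda>s. case_prod F (t, s))"
        using AE_delay
        by eventually_elim (simp, rule integrable_delay_bounded[OF Ft Fb], auto)
    qed
    have "laplace g w = (\<integral>s. (\<integral>t. F t s \<partial>delay) \<partial>delay)"
      unfolding laplace_def g_def integral_mult_right_zero[symmetric]
      by (intro Bochner_Integration.integral_cong refl)
        (simp add: F_def k_def v_def left_diff_distrib right_diff_distrib exp_diff field_simps)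
    also have "\<dots> = (\<integral>t. (\<integral>s. F t s \<partial>delay) \<partial>delay)"
      by (rule P.Fubini_integral[OF Fi])
    also have "\<dots> = (\<integral>t. (exp (w * of_real t) * f t - exp (w0 * of_real t) * f t) / v \<partial>delay)"
    proof (rule integral_cong_AE)
      have inner: "(\<integral>s. F t s \<partial>delay) = (exp (w * of_real t) * f t - exp (w0 * of_real t) * f t) / v" if t: "t \<in> {-1..0}" for t
      proof -
        have "(\<integral>s. F t s \<partial>delay) = - exp (w0 * of_real t) * f t * (\<integral>s. indicator {t..} s * exp (v * of_real s) \<partial>delay)"
          unfolding F_def integral_mult_right_zero[symmetric]
          by (intro Bochner_Integration.integral_cong refl) (auto split: split_indicator)
        also have "(\<integral>s. indicator {t..} s * exp (v * of_real s) \<partial>delay) = (LBINT s. indicator {t..0} s *\<^sub>R exp (v * of_real s))"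
          unfolding integral_delay[OF borel_measurable_times[OF borel_measurable_indicator borel_measurable_continuous_onI]]
          apply (subst integral_delay) subgoal by measurable
          unfolding set_lebesgue_integral_def
          by (intro Bochner_Integration.integral_cong refl) (use t in \<open>auto split: split_indicator\<close>)
        also have "\<dots> = exp (v * of_real 0) / v - exp (v * of_real t) / v"
          by (rule integral_FTC_atLeastAtMost)
            (use t in \<open>auto intro!: continuous_intros derivative_eq_intros has_vector_derivative_real_field simp: v\<close>)
        finally have "(\<integral>s. F t s \<partial>delay) = - exp (w0 * of_real t) * f t * (1 / v - exp (v * of_real t) / v)"
          by simp
        moreover have "exp (w * of_real t) = exp (w0 * of_real t) * exp (v * of_real t)"
          by (simp add: v_def left_diff_distrib flip: exp_add)
        ultimately show ?thesis
          by (simp add: diff_divide_distrib algebra_simps)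
      qed
      show "AE t in delay. (\<integral>s. F t s \<partial>delay) = (exp (w * of_real t) * f t - exp (w0 * of_real t) * f t) / v"
        by (rule eventually_mono[OF AE_delay inner])
      show "(\<lambda>t. \<integral>s. F t s \<partial>delay) \<in> borel_measurable delay"
        by (rule delay.borel_measurable_lebesgue_integral[OF Fm])
    qed auto
    also have "\<dots> = (laplace f w - laplace f w0) / (w - w0)"
      unfolding laplace_def v_def
      by (simp add: L2_borel_integrable[OF L2_borel_exp_mult[OF f]])
    finally show ?thesis .
  qed
  with g show ?thesis using that by blast
qed

lemma laplace_norm_le:
  assumes "L2_borel f"
  shows "cmod (laplace f w) \<le> exp (cmod w) * (\<integral>t. cmod (f t) \<partial>delay)"
proof -
  have "cmod (laplace f w) \<le> (\<integral>t. cmod (exp (w * of_real t) * f t) \<partial>delay)"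
    unfolding laplace_def by (rule integral_norm_bound)
  also have "\<dots> \<le> (\<integral>t. exp (cmod w) * cmod (f t) \<partial>delay)"
    using L2_borel_integrable[OF assms] L2_borel_integrable[OF L2_borel_exp_mult[OF assms, of w]]
    by (intro integral_delay_mono integrable_norm integrable_mult_right)
      (auto simp del: norm_exp_eq_Re simp: norm_mult intro!: mult_right_mono cmod_exp_delay)
  finally show ?thesis by simp
qed

text \<open>
  By division, the difference quotient of a transform is again a transform, hence locally bounded.
\<close>

lemma isCont_laplace:
  assumes f: "L2_borel f"
  shows "isCont (laplace f) w0"
proof -
  obtain g where g: "L2_borel g" "\<And>w. w \<noteq> w0 \<Longrightarrow> laplace g w = (laplace f w - laplace f w0) / (w - w0)"
    using laplace_division[OF f] by blast
  let ?C = "\<integral>t. cmod (g t) \<partial>delay"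
  have "((\<lambda>w. laplace f w - laplace f w0) \<longlongrightarrow> 0) (at w0)"
  proof (rule Lim_null_comparison)
    show "\<forall>\<^sub>F w in at w0. norm (laplace f w - laplace f w0) \<le> cmod (w - w0) * (exp (cmod w) * ?C)"
    proof (intro eventually_mono[OF eventually_at_filter[THEN iffD2, OF always_eventually]] allI impI)
      fix w :: complex assume "w \<noteq> w0"
      then have "laplace f w - laplace f w0 = (w - w0) * laplace g w" using g(2) by simp
      then show "norm (laplace f w - laplace f w0) \<le> cmod (w - w0) * (exp (cmod w) * ?C)"
        by (auto simp: norm_mult intro!: mult_left_mono laplace_norm_le[OF g(1)])
    qed
    have "((\<lambda>w. cmod (w - w0) * (exp (cmod w) * ?C)) \<longlongrightarrow> cmod (w0 - w0) * (exp (cmod w0) * ?C)) (at w0)"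
      by (intro tendsto_intros)
    then show "((\<lambda>w. cmod (w - w0) * (exp (cmod w) * ?C)) \<longlongrightarrow> 0) (at w0)" by simp
  qed
  then show ?thesis unfolding isCont_def by (simp add: LIM_zero_iff)
qed

section \<open>Completeness of the exponentials\<close>

lemma integrable_mult_bounded_delay:
  fixes g k :: "real \<Rightarrow> complex"
  assumes g: "integrable delay g" and k: "k \<in> borel_measurable borel" "\<And>t. t \<in> {-1..0} \<Longrightarrow> cmod (k t) \<le> B"
  shows "integrable delay (\<lambda>t. k t * g t)"
proof (rule Bochner_Integration.integrable_bound)
  have [measurable]: "g \<in> borel_measurable borel" using g by auto
  note [measurable] = k(1)
  show "integrable delay (\<lambda>t. B * cmod (g t))" using g by simp
  show "(\<lambda>t. k t * g t) \<in> borel_measurable delay" by simp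
  show "AE t in delay. cmod (k t * g t) \<le> norm (B * cmod (g t))"
    using AE_delay
  proof eventually_elim
    case (elim t)
    have "cmod (k t) * cmod (g t) \<le> B * cmod (g t)" by (intro mult_right_mono k(2) elim) auto
    also have "\<dots> \<le> \<bar>B * cmod (g t)\<bar>" by simp
    finally show ?case by (simp add: norm_mult)
  qed
qed

text \<open>
  Functions all of whose Fourier coefficients vanish. Being closed under multiplication by
  exponentials, hence by trigonometric polynomials, this class allows an induction over
  polynomial functions.
\<close>

definition freq_null :: "(real \<Rightarrow> complex) \<Rightarrow> bool" where
  "freq_null g \<longleftrightarrow> integrable delay g \<and> (\<forall>l. laplace g (freq l) = 0)"

lemma freq_null_mult_exp:
  assumes "freq_null g"
  shows "freq_null (\<lambda>t. exp (freq k * of_real t) * g t)"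
  unfolding freq_null_def laplace_shift freq_arith
  using assms integrable_mult_bounded_delay[OF _ _ cmod_exp_delay[of _ "freq k"], of g]
  by (auto simp: freq_null_def)

lemma freq_null_lincomb:
  assumes "freq_null f" "freq_null g"
  shows "freq_null (\<lambda>t. a * f t + b * g t)"
proof -
  have "integrable delay (\<lambda>t. exp (freq l * of_real t) * f t)"
       "integrable delay (\<lambda>t. exp (freq l * of_real t) * g t)" for l
    using freq_null_mult_exp assms by (auto simp: freq_null_def)
  moreover from this have "laplace (\<lambda>t. a * f t + b * g t) (freq l) = a * laplace f (freq l) + b * laplace g (freq l)" for l
    unfolding laplace_def by (simp add: distrib_left mult.left_commute[of _ a] mult.left_commute[of _ b])
  ultimately show ?thesis using assms by (auto simp: freq_null_def)
qed

text \<open>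
  On the unit circle a real-linear function of \<open>z\<close> is a combination of \<open>z\<close> and \<open>1/z\<close>, so multiplication
  by it only shifts and combines Fourier coefficients.
\<close>

lemma freq_null_mult_polynomial:
  fixes p :: "complex \<Rightarrow> real"
  assumes "real_polynomial_function p" "freq_null g"
  shows "freq_null (\<lambda>t. of_real (p (exp (freq 1 * of_real t))) * g t)"
  using assms
proof (induction p arbitrary: g)
  case (linear h)
  interpret h: bounded_linear h by fact
  define a b where "a = (of_real (h 1) - \<i> * of_real (h \<i>)) / 2" and "b = (of_real (h 1) + \<i> * of_real (h \<i>)) / 2"
  have hz: "complex_of_real (h z) = a * z + b * cnj z" for z
  proof -
    have "h z = h (Re z *\<^sub>R 1 + Im z *\<^sub>R \<i>)"
      by (rule arg_cong[of _ _ h]) (simp add: complex_eq_iff)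
    also have "\<dots> = Re z * h 1 + Im z * h \<i>" by (simp add: h.add h.scaleR)
    finally show ?thesis
      by (simp add: a_def b_def complex_eq_iff field_simps)
  qed
  have "of_real (h (exp (freq 1 * of_real t))) * g t
     = a * (exp (freq 1 * of_real t) * g t) + b * (exp (freq (-1) * of_real t) * g t)" for t
    unfolding hz cnj_exp_freq freq_arith by (simp add: algebra_simps)
  then show ?case
    using freq_null_lincomb[OF freq_null_mult_exp[OF linear(2), of 1] freq_null_mult_exp[OF linear(2), of "-1"], of a b]
    by simp
next
  case (const c)
  then show ?case using freq_null_lincomb[of g g "of_real c" 0] by simp
next
  case (add p q)
  then show ?case using freq_null_lincomb[OF add.IH(1)[OF add.prems] add.IH(2)[OF add.prems], of 1 1]
    by (simp add: distrib_right)
next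
  case (mult p q)
  then show ?case using mult.IH(1)[OF mult.IH(2)[OF mult.prems]] by (simp add: mult.assoc)
qed

lemma freq_null_mult_complex_polynomial:
  fixes P :: "complex \<Rightarrow> complex"
  assumes "polynomial_function P" "freq_null g"
  shows "freq_null (\<lambda>t. P (exp (freq 1 * of_real t)) * g t)"
proof -
  have "real_polynomial_function (\<lambda>z. Re (P z))" "real_polynomial_function (\<lambda>z. Im (P z))"
    using assms(1) bounded_linear_Re bounded_linear_Im by (auto simp: polynomial_function_def o_def)
  from freq_null_lincomb[OF freq_null_mult_polynomial[OF this(1) assms(2)] freq_null_mult_polynomial[OF this(2) assms(2)], of 1 \<i>]
  have "freq_null (\<lambda>t. (of_real (Re (P (exp (freq 1 * of_real t)))) + \<i> * of_real (Im (P (exp (freq 1 * of_real t))))) * g t)"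
    by (simp only: distrib_right mult.assoc mult_1_left)
  then show ?thesis by (simp only: complex_eq[symmetric])
qed

text \<open>
  By the Stone-Weierstrass theorem \<open>\<phi>\<close> is a uniform limit of polynomial functions on the circle, for each of which
  the integral vanishes.
\<close>

lemma integral_mult_circle_continuous_eq_0:
  assumes g: "freq_null g" and \<phi>: "continuous_on (sphere 0 1) \<phi>"
    and m: "(\<lambda>t. \<phi> (exp (freq 1 * of_real t))) \<in> borel_measurable borel"
  shows "(\<integral>t. \<phi> (exp (freq 1 * of_real t)) * g t \<partial>delay) = 0"
proof -
  let ?E = "\<lambda>t::real. exp (freq 1 * of_real t)"
  have gi: "integrable delay g" using g by (simp add: freq_null_def)
  have E: "?E t \<in> sphere 0 1" for t by (simp add: freq_def)
  have bdd: "\<exists>B. \<forall>z\<in>sphere 0 1. cmod (\<phi> z) \<le> B"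
    using compact_imp_bounded[OF compact_continuous_image[OF \<phi>]] by (auto simp: bounded_iff)
  then obtain B where B: "\<And>t. cmod (\<phi> (?E t)) \<le> B" using E by blast
  let ?I = "cmod (\<integral>t. \<phi> (?E t) * g t \<partial>delay)" and ?G = "\<integral>t. cmod (g t) \<partial>delay"
  have "?I \<le> e * ?G" if "e > 0" for e
  proof -
    obtain P where P: "polynomial_function P" "\<And>z. z \<in> sphere 0 1 \<Longrightarrow> norm (\<phi> z - P z) < e"
      using Stone_Weierstrass_polynomial_function[OF compact_sphere \<phi> \<open>e > 0\<close>] by blast
    have n: "freq_null (\<lambda>t. P (?E t) * g t)" by (rule freq_null_mult_complex_polynomial[OF P(1) g])
    then have "laplace (\<lambda>t. P (?E t) * g t) (freq 0) = 0" by (simp add: freq_null_def)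
    then have P0: "(\<integral>t. P (?E t) * g t \<partial>delay) = 0" by (simp add: laplace_def freq_arith)
    have Pi: "integrable delay (\<lambda>t. P (?E t) * g t)" using n by (simp add: freq_null_def)
    have i: "integrable delay (\<lambda>t. \<phi> (?E t) * g t)"
      by (rule integrable_mult_bounded_delay[OF gi m B])
    have "(\<integral>t. \<phi> (?E t) * g t \<partial>delay) = (\<integral>t. (\<phi> (?E t) - P (?E t)) * g t \<partial>delay)"
      using P0 Pi i by (simp add: left_diff_distrib)
    also have "cmod \<dots> \<le> (\<integral>t. cmod ((\<phi> (?E t) - P (?E t)) * g t) \<partial>delay)"
      by (rule integral_norm_bound)
    also have "\<dots> \<le> (\<integral>t. e * cmod (g t) \<partial>delay)"
    proof (rule integral_mono)
      show "integrable delay (\<lambda>t. cmod ((\<phi> (?E t) - P (?E t)) * g t))"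
        using Pi i by (simp add: left_diff_distrib)
      show "integrable delay (\<lambda>t. e * cmod (g t))" using gi by simp
      show "cmod ((\<phi> (?E t) - P (?E t)) * g t) \<le> e * cmod (g t)" for t
        using P(2)[OF E, of t] by (auto simp: norm_mult intro!: mult_right_mono)
    qed
    finally show ?thesis by simp
  qed
  then have "?I \<le> 0"
  proof -
    assume *: "\<And>e. 0 < e \<Longrightarrow> ?I \<le> e * ?G"
    have G: "0 \<le> ?G" by simp
    show "?I \<le> 0"
    proof (rule field_le_epsilon)
      fix e :: real assume e: "0 < e"
      have "?I \<le> e / (?G + 1) * ?G" using G e by (intro *) (auto intro!: divide_pos_pos add_nonneg_pos)
      also have "\<dots> \<le> e"
        using mult_left_mono[of "?G / (?G + 1)" 1 e] G e by (simp add: divide_le_eq_1 add_nonneg_pos)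
      finally show "?I \<le> 0 + e" by simp
    qed
  qed
  then show ?thesis by simp
qed

text \<open>
  A continuous function on \<open>[-1,0]\<close> with equal end values factors through the circle.
\<close>

lemma circle_map_of_loop:
  fixes \<psi> :: "real \<Rightarrow> complex"
  assumes "continuous_on {-1..0} \<psi>" "\<psi> (-1) = \<psi> 0"
  obtains \<phi> where "continuous_on (sphere 0 1) \<phi>" "\<And>t. t \<in> {-1..0} \<Longrightarrow> \<phi> (exp (freq 1 * of_real t)) = \<psi> t"
proof
  define p where "p s = \<psi> (s - 1)" for s
  have p: "path p" unfolding path_def p_def
    by (rule continuous_on_compose2[OF assms(1)]) (auto intro!: continuous_intros)
  have "homotopic_loops UNIV p p"
    using p assms(2) by (simp add: homotopic_loops_refl p_def pathstart_def pathfinish_def)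
  from homotopic_loops_imp_homotopic_circlemaps[OF this]
  show "continuous_on (sphere 0 1) (p \<circ> (\<lambda>z. Arg2pi z / (2 * pi)))"
    using homotopic_with_imp_continuous by blast
  fix t :: real assume t: "t \<in> {-1..0}"
  show "(p \<circ> (\<lambda>z. Arg2pi z / (2 * pi))) (exp (freq 1 * of_real t)) = \<psi> t"
  proof (cases "t = 0")
    case True
    moreover have "Arg2pi 1 = 0" by (rule Arg2pi_unique[of 1]) auto
    ultimately show ?thesis using assms(2) by (simp add: p_def)
  next
    case False
    have "Arg2pi (exp (freq 1 * of_real t)) = 2 * pi * (t + 1)"
    proof (rule Arg2pi_unique)
      have "\<i> * of_real (2 * pi * (t + 1)) = freq 1 * of_real t + freq 1"
        by (simp add: freq_def algebra_simps)
      then show "of_real 1 * exp (\<i> * of_real (2 * pi * (t + 1))) = exp (freq 1 * of_real t)"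
        by (simp only: exp_add exp_freq) simp
    qed (use t False in auto)
    then show ?thesis by (simp add: p_def)
  qed
qed

text \<open>
  The exponential need not be periodic. Multiplied by a trapezoidal cut-off that vanishes at both ends of the interval
  it becomes so, and the cut-off functions converge to 1 almost everywhere, boundedly.
\<close>

lemma laplace_eq_0_of_freq_null:
  assumes g: "freq_null g"
  shows "laplace g w = 0"
proof -
  have gi: "integrable delay g" using g by (simp add: freq_null_def)
  define bump where "bump n t = max 0 (min 1 (real n * (t + 1))) * max 0 (min 1 (- real n * t))" for n :: nat and t :: real
  define \<psi> where "\<psi> n t = exp (w * of_real t) * of_real (bump n t)" for n and t :: real
  have chi: "0 \<le> bump n t" "bump n t \<le> 1" for n t
    by (auto simp: bump_def intro!: mult_le_one)
  have cont: "continuous_on UNIV (\<psi> n)" for n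
    unfolding \<psi>_def bump_def by (intro continuous_intros)
  then have [measurable]: "\<psi> n \<in> borel_measurable borel" for n
    by (rule borel_measurable_continuous_onI)
  have [measurable]: "g \<in> borel_measurable borel" using gi by auto
  have "(\<integral>t. \<psi> n t * g t \<partial>delay) = 0" for n
  proof -
    have c: "continuous_on {-1..0} (\<psi> n)" by (rule continuous_on_subset[OF cont]) simp
    have "\<psi> n (-1) = \<psi> n 0" by (simp add: \<psi>_def bump_def)
    from circle_map_of_loop[OF c this] obtain \<phi> where
      \<phi>: "continuous_on (sphere 0 1) \<phi>" "\<And>t. t \<in> {-1..0} \<Longrightarrow> \<phi> (exp (freq 1 * of_real t)) = \<psi> n t" by blast
    have "continuous_on UNIV (\<lambda>t::real. \<phi> (exp (freq 1 * of_real t)))"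
      by (rule continuous_on_compose2[OF \<phi>(1)]) (auto intro!: continuous_intros simp: freq_def)
    then have m: "(\<lambda>t. \<phi> (exp (freq 1 * of_real t))) \<in> borel_measurable borel"
      by (rule borel_measurable_continuous_onI)
    have "(\<integral>t. \<psi> n t * g t \<partial>delay) = (\<integral>t. \<phi> (exp (freq 1 * of_real t)) * g t \<partial>delay)"
    proof (rule integral_cong_AE)
      show "AE t in delay. \<psi> n t * g t = \<phi> (exp (freq 1 * of_real t)) * g t"
        using AE_delay by eventually_elim (simp add: \<phi>(2))
    qed (use m in simp_all)
    also have "\<dots> = 0" by (rule integral_mult_circle_continuous_eq_0[OF g \<phi>(1) m])
    finally show ?thesis .
  qed
  moreover have "(\<lambda>n. \<integral>t. \<psi> n t * g t \<partial>delay) \<longlonglongrightarrow> laplace g w"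
    unfolding laplace_def
  proof (rule integral_dominated_convergence)
    show "integrable delay (\<lambda>t. exp (cmod w) * cmod (g t))" using gi by simp
    have "AE t in delay. t \<noteq> -1 \<and> t \<noteq> 0"
      unfolding delay_def
      by (subst AE_density) (use AE_lborel_singleton[of "-1::real"] AE_lborel_singleton[of "0::real"] in \<open>auto elim: eventually_elim2\<close>)
    then show "AE t in delay. (\<lambda>n. \<psi> n t * g t) \<longlonglongrightarrow> exp (w * of_real t) * g t"
      using AE_delay
    proof eventually_elim
      case (elim t)
      then have t: "-1 < t" "t < 0" by auto
      obtain N where N: "real N > 1 / (t + 1)" "real N > 1 / (- t)"
        using reals_Archimedean2[of "max (1 / (t + 1)) (1 / (- t))"] by auto
      have "\<psi> n t * g t = exp (w * of_real t) * g t" if "n \<ge> N" for n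
      proof -
        have "real n > 1 / (t + 1)" "real n > 1 / (- t)" using N that by linarith+
        then have "real n * (t + 1) \<ge> 1" "- real n * t \<ge> 1"
          using t by (auto simp: field_simps)
        then show ?thesis by (simp add: \<psi>_def bump_def)
      qed
      then show ?case by (intro tendsto_eventually) (auto simp: eventually_sequentially)
    qed
    show "AE t in delay. cmod (\<psi> n t * g t) \<le> exp (cmod w) * cmod (g t)" for n
      using AE_delay
    proof eventually_elim
      case (elim t)
      have "cmod (\<psi> n t) \<le> exp (cmod w) * 1"
        unfolding \<psi>_def norm_mult using chi[of n t] by (intro mult_mono cmod_exp_delay elim) auto
      then show ?case by (simp add: norm_mult mult_right_mono)
    qed
  qed simp_all
  ultimately show ?thesis by (simp add: LIMSEQ_const_iff)
qed

section \<open>Linear systems and the generic choice of rows\<close>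

text \<open>
  Gaussian elimination: one equation removes one unknown.
\<close>

lemma underdetermined_system:
  fixes M :: "'a \<Rightarrow> 'b \<Rightarrow> 'c::field"
  assumes "finite A" "finite B" "card A < card B"
  shows "\<exists>v. (\<exists>j\<in>B. v j \<noteq> 0) \<and> (\<forall>i\<in>A. (\<Sum>j\<in>B. M i j * v j) = 0)"
  using assms
proof (induction A arbitrary: B M rule: finite_induct)
  case empty
  then have "B \<noteq> {}" by auto
  then show ?case by (auto intro!: exI[of _ "\<lambda>_. 1"])
next
  case (insert i A)
  show ?case
  proof (cases "\<forall>j\<in>B. M i j = 0")
    case True
    from insert.IH[of B M] insert.prems insert.hyps obtain v
      where "\<exists>j\<in>B. v j \<noteq> 0" "\<forall>k\<in>A. (\<Sum>j\<in>B. M k j * v j) = 0" by auto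
    with True show ?thesis by (intro exI[of _ v]) auto
  next
    case False
    then obtain j0 where j0: "j0 \<in> B" "M i j0 \<noteq> 0" by auto
    define B' where "B' = B - {j0}"
    have B: "B = insert j0 B'" "j0 \<notin> B'" "finite B'"
      using j0 insert.prems by (auto simp: B'_def)
    have "card A < card B'" using insert.prems insert.hyps B by auto
    from insert.IH[OF \<open>finite B'\<close> this, of "\<lambda>k j. M k j - M k j0 * M i j / M i j0"] obtain v
      where v: "\<exists>j\<in>B'. v j \<noteq> 0" "\<And>k. k \<in> A \<Longrightarrow> (\<Sum>j\<in>B'. (M k j - M k j0 * M i j / M i j0) * v j) = 0"
      by auto
    define u where "u = v(j0 := - (\<Sum>j\<in>B'. M i j * v j) / M i j0)"
    have uB: "(\<Sum>j\<in>B'. M k j * u j) = (\<Sum>j\<in>B'. M k j * v j)" for k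
      by (rule sum.cong) (use B in \<open>auto simp: u_def\<close>)
    have split: "(\<Sum>j\<in>B. M k j * u j) = M k j0 * u j0 + (\<Sum>j\<in>B'. M k j * v j)" for k
      using B by (simp add: uB)
    have "(\<Sum>j\<in>B. M k j * u j) = 0" if "k \<in> insert i A" for k
    proof (cases "k = i")
      case True
      then show ?thesis unfolding split using j0 by (simp add: u_def)
    next
      case False
      with that have "k \<in> A" by simp
      from v(2)[OF this] show ?thesis unfolding split using j0
        by (simp add: u_def left_diff_distrib sum_subtractf sum_distrib_left sum_divide_distrib mult.assoc)
    qed
    moreover have "\<exists>j\<in>B. u j \<noteq> 0" using v(1) B by (auto simp: u_def)
    ultimately show ?thesis by blast
  qed
qed

text \<open>
  Treat the right-hand side as the coefficient of an additional unknown. In a nontrivial solution of the enlarged homogeneous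
  system this unknown is not zero, since the system itself is injective; divide by it.
\<close>

lemma square_system_solvable:
  fixes M :: "'a \<Rightarrow> 'a \<Rightarrow> 'c::field"
  assumes K: "finite K"
    and inj: "\<And>v. (\<And>i. i \<in> K \<Longrightarrow> (\<Sum>j\<in>K. M i j * v j) = 0) \<Longrightarrow> (\<And>j. j \<in> K \<Longrightarrow> v j = 0)"
  obtains v where "\<And>i. i \<in> K \<Longrightarrow> (\<Sum>j\<in>K. M i j * v j) = b i"
proof -
  define M' where "M' i o' = (case o' of None \<Rightarrow> - b i | Some j \<Rightarrow> M i j)" for i o'
  define B where "B = insert None (Some ` K)"
  have "card K < card B" "finite B" using K by (auto simp: B_def card_image)
  from underdetermined_system[OF K this(2,1), of M'] obtain v
    where v: "\<exists>j\<in>B. v j \<noteq> 0" "\<And>i. i \<in> K \<Longrightarrow> (\<Sum>j\<in>B. M' i j * v j) = 0" by blast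
  have eq: "(\<Sum>j\<in>K. M i j * v (Some j)) = b i * v None" if "i \<in> K" for i
  proof -
    have "(\<Sum>j\<in>B. M' i j * v j) = - b i * v None + (\<Sum>j\<in>K. M i j * v (Some j))"
      using K by (simp add: B_def M'_def sum.reindex)
    with v(2)[OF that] show ?thesis by (simp add: add_eq_0_iff)
  qed
  have "v None \<noteq> 0"
  proof
    assume 0: "v None = 0"
    then have "v (Some j) = 0" if "j \<in> K" for j
      using inj[of "\<lambda>j. v (Some j)"] eq that by simp
    with 0 v(1) show False by (auto simp: B_def)
  qed
  then have "(\<Sum>j\<in>K. M i j * (v (Some j) / v None)) = b i" if "i \<in> K" for i
    using eq[OF that] by (simp add: sum_divide_distrib[symmetric])
  from that[OF this] show ?thesis .
qed

text \<open>
  The bilinear product of a row and a column, without conjugation.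
\<close>

definition bdot :: "complex^'n \<Rightarrow> complex^'n \<Rightarrow> complex" where
  "bdot q u = (\<Sum>p\<in>UNIV. q $ p * u $ p)"

lemma bdot_add_right: "bdot q (u + v) = bdot q u + bdot q v"
  by (simp add: bdot_def distrib_left sum.distrib)

lemma bdot_add_left: "bdot (q + r) u = bdot q u + bdot r u"
  by (simp add: bdot_def distrib_right sum.distrib)

lemma bdot_smult_right: "bdot q (c *s u) = c * bdot q u"
  by (simp add: bdot_def sum_distrib_left mult.left_commute)

lemma bdot_smult_left: "bdot (c *s q) u = c * bdot q u"
  by (simp add: bdot_def sum_distrib_left mult.assoc)

lemma bdot_0 [simp]: "bdot q 0 = 0" "bdot 0 u = 0"
  by (simp_all add: bdot_def)

lemma bdot_sum_right: "bdot q (\<Sum>i\<in>A. f i) = (\<Sum>i\<in>A. bdot q (f i))"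
  by (induction A rule: infinite_finite_induct) (simp_all add: bdot_add_right)

lemma bdot_cnj_self:
  assumes "u \<noteq> 0"
  shows "bdot (\<chi> p. cnj (u $ p)) u \<noteq> 0"
proof -
  have "bdot (\<chi> p. cnj (u $ p)) u = of_real (\<Sum>p\<in>UNIV. (cmod (u $ p))\<^sup>2)"
    by (simp add: bdot_def complex_norm_square mult.commute del: of_real_power)
  moreover from assms obtain p where "u $ p \<noteq> 0" by (auto simp: vec_eq_iff)
  then have "(\<Sum>p\<in>UNIV. (cmod (u $ p))\<^sup>2) > 0"
    by (intro sum_pos2[of _ p]) auto
  ultimately show ?thesis by (simp only: of_real_eq_0_iff)
qed

text \<open>
  Only upper bounds on dimensions of function spaces occur, and linear dependence expresses them without bases.
\<close>

definition dim_at_most :: "nat \<Rightarrow> (complex \<Rightarrow> complex^'n) set \<Rightarrow> bool" where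
  "dim_at_most k Y \<longleftrightarrow> (\<forall>\<Phi>::nat \<Rightarrow> complex \<Rightarrow> complex^'n. (\<forall>i\<le>k. \<Phi> i \<in> Y) \<longrightarrow>
     (\<exists>a. (\<exists>i\<le>k. a i \<noteq> 0) \<and> (\<forall>w. (\<Sum>i\<le>k. a i *s \<Phi> i w) = 0)))"

definition divisible_at :: "complex \<Rightarrow> (complex \<Rightarrow> complex^'n) set \<Rightarrow> bool" where
  "divisible_at w0 Y \<longleftrightarrow> (\<forall>\<Phi>\<in>Y. \<Phi> w0 = 0 \<longrightarrow> (\<exists>\<Psi>\<in>Y. \<forall>w. w \<noteq> w0 \<longrightarrow> \<Phi> w = (w - w0) *s \<Psi> w))"

lemma dim_at_mostD:
  assumes "dim_at_most k Y" "\<And>i. i \<le> k \<Longrightarrow> \<Phi> i \<in> Y"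
  shows "\<exists>a. (\<exists>i\<le>k. a i \<noteq> 0) \<and> (\<forall>w. (\<Sum>i\<le>k. a i *s \<Phi> i w) = 0)"
  using assms unfolding dim_at_most_def by blast

lemma continuous_eq_0_off_finite:
  fixes \<Phi> :: "complex \<Rightarrow> 'b::real_normed_vector"
  assumes "isCont \<Phi> w0" "finite S" "\<And>w. w \<notin> S \<Longrightarrow> \<Phi> w = 0"
  shows "\<Phi> w0 = 0"
proof -
  have "\<forall>\<^sub>F w in at w0. w \<notin> S"
  proof -
    have "open (- (S - {w0}))" using assms(2) by (intro open_Compl finite_imp_closed) auto
    then show ?thesis unfolding eventually_at_topological by (intro exI[of _ "- (S - {w0})"]) auto
  qed
  then have "\<forall>\<^sub>F w in at w0. \<Phi> w = 0" by eventually_elim (use assms(3) in auto)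
  then have "(\<Phi> \<longlongrightarrow> 0) (at w0)" by (rule tendsto_eventually)
  with assms(1) show ?thesis unfolding isCont_def by (intro LIM_unique)
qed

text \<open>
  If every member vanishes at \<open>w0\<close>, then \<open>\<Phi>\<close> can be divided by \<open>w - w0\<close> again and again within \<open>Y\<close>. The quotients
  \<open>\<Phi> w / (w - w0)\<^sup>r\<close> for \<open>r \<le> k\<close> are linearly dependent, so a nonzero polynomial in \<open>w - w0\<close>
  annihilates \<open>\<Phi>\<close>; thus \<open>\<Phi>\<close> vanishes off a finite set and, by continuity, everywhere.
\<close>

lemma vanishing_at_point_imp_zero:
  fixes Y :: "(complex \<Rightarrow> complex^'n) set"
  assumes dim: "dim_at_most k Y" and cont: "\<And>\<Phi> w. \<Phi> \<in> Y \<Longrightarrow> isCont \<Phi> w"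
    and div: "divisible_at w0 Y" and van: "\<And>\<Phi>. \<Phi> \<in> Y \<Longrightarrow> \<Phi> w0 = 0"
    and \<Phi>: "\<Phi> \<in> Y"
  shows "\<Phi> w = 0"
proof -
  have "\<forall>\<Phi>\<in>Y. \<exists>\<Psi>\<in>Y. \<forall>w. w \<noteq> w0 \<longrightarrow> \<Phi> w = (w - w0) *s \<Psi> w"
    using div van unfolding divisible_at_def by blast
  then obtain D where D: "\<And>\<Phi>. \<Phi> \<in> Y \<Longrightarrow> D \<Phi> \<in> Y" "\<And>\<Phi> w. \<Phi> \<in> Y \<Longrightarrow> w \<noteq> w0 \<Longrightarrow> \<Phi> w = (w - w0) *s D \<Phi> w"
    by metis
  define \<Theta> where "\<Theta> r = (D ^^ r) \<Phi>" for r
  have \<Theta>Y: "\<Theta> r \<in> Y" for r by (induction r) (auto simp: \<Theta>_def \<Phi> D)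
  have pow: "\<Phi> w = (w - w0) ^ r *s \<Theta> r w" if "w \<noteq> w0" for r w
  proof (induction r)
    case (Suc r)
    have "\<Theta> r w = (w - w0) *s \<Theta> (Suc r) w" using D(2)[OF \<Theta>Y that] by (simp add: \<Theta>_def)
    then have "(w - w0) ^ r *s \<Theta> r w = ((w - w0) ^ r * (w - w0)) *s \<Theta> (Suc r) w"
      by (simp only: vec.scale_scale)
    with Suc show ?case by (simp only: power_Suc mult.commute)
  qed (simp add: \<Theta>_def)
  obtain a i where a: "i \<le> k" "a i \<noteq> 0" "\<And>w. (\<Sum>r\<le>k. a r *s \<Theta> r w) = 0"
    using dim_at_mostD[of k Y \<Theta>, OF dim \<Theta>Y] by blast
  \<comment> \<open>The dependence, multiplied by \<open>(w - w0)\<^sup>k\<close>.\<close>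
  define P where "P = (\<Sum>r\<le>k. monom (a r) (k - r))"
  have "coeff P (k - i) = (\<Sum>r\<le>k. if r = i then a i else 0)"
    unfolding P_def coeff_sum coeff_monom by (intro sum.cong refl) (use a(1) in auto)
  then have "P \<noteq> 0" using a by auto
  then have fin: "finite {z. poly P z = 0}" by (rule poly_roots_finite)
  have rel: "poly P (w - w0) *s \<Phi> w = 0" if "w \<noteq> w0" for w
  proof -
    have "poly P (w - w0) *s \<Phi> w = (\<Sum>r\<le>k. (a r * (w - w0) ^ (k - r)) *s \<Phi> w)"
      by (simp add: P_def poly_sum poly_monom vec.scale_sum_left)
    also have "\<dots> = (\<Sum>r\<le>k. (w - w0) ^ k *s (a r *s \<Theta> r w))"
    proof (intro sum.cong refl)
      fix r assume "r \<in> {..k}"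
      then have e: "(w - w0) ^ (k - r) * (w - w0) ^ r = (w - w0) ^ k" by (simp flip: power_add)
      have "(a r * (w - w0) ^ (k - r)) *s \<Phi> w = (a r * ((w - w0) ^ (k - r) * (w - w0) ^ r)) *s \<Theta> r w"
        by (subst pow[OF that, of r]) (simp add: mult.assoc)
      then show "(a r * (w - w0) ^ (k - r)) *s \<Phi> w = (w - w0) ^ k *s (a r *s \<Theta> r w)"
        unfolding e by (simp add: mult.commute)
    qed
    also have "\<dots> = (w - w0) ^ k *s (\<Sum>r\<le>k. a r *s \<Theta> r w)" by (simp only: vec.scale_sum_right)
    also have "\<dots> = 0" by (simp only: a(3) vec.scale_zero_right)
    finally show ?thesis .
  qed
  show ?thesis
  proof (rule continuous_eq_0_off_finite[OF cont[OF \<Phi>]])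
    show "finite (insert w0 ((\<lambda>z. z + w0) ` {z. poly P z = 0}))" using fin by simp
    fix w assume w: "w \<notin> insert w0 ((\<lambda>z. z + w0) ` {z. poly P z = 0})"
    then have "poly P (w - w0) \<noteq> 0" by (auto simp: image_iff)
    with rel[of w] w show "\<Phi> w = 0" by simp
  qed
qed

text \<open>
  A functional that does not vanish on \<open>Y\<close> lowers the dimension: append \<open>\<Psi>\<close> to a family in the kernel
  and observe that its coefficient in a dependence is zero.
\<close>

lemma dim_at_most_kernel:
  fixes Y :: "(complex \<Rightarrow> complex^'n) set"
  assumes dim: "dim_at_most (Suc k) Y" and \<Psi>: "\<Psi> \<in> Y" "bdot q (\<Psi> w0) \<noteq> 0"
  shows "dim_at_most k {\<Phi>\<in>Y. bdot q (\<Phi> w0) = 0}"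
  unfolding dim_at_most_def
proof (intro allI impI)
  fix \<Phi> :: "nat \<Rightarrow> complex \<Rightarrow> complex^'n"
  assume \<Phi>: "\<forall>i\<le>k. \<Phi> i \<in> {\<Phi>\<in>Y. bdot q (\<Phi> w0) = 0}"
  define \<Theta> where "\<Theta> = \<Phi>(Suc k := \<Psi>)"
  have \<Theta>Y: "\<Theta> i \<in> Y" if "i \<le> Suc k" for i using \<Phi> \<Psi> that by (auto simp: \<Theta>_def le_Suc_eq)
  obtain a i where a: "i \<le> Suc k" "a i \<noteq> 0" "\<And>w. (\<Sum>i\<le>Suc k. a i *s \<Theta> i w) = 0"
    using dim_at_mostD[of "Suc k" Y \<Theta>, OF dim \<Theta>Y] by blast
  have split: "(\<Sum>i\<le>k. a i *s \<Phi> i w) + a (Suc k) *s \<Psi> w = 0" for w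
    using a(3)[of w] by (simp add: \<Theta>_def)
  have "bdot q ((\<Sum>i\<le>k. a i *s \<Phi> i w0) + a (Suc k) *s \<Psi> w0) = a (Suc k) * bdot q (\<Psi> w0)"
    unfolding bdot_add_right bdot_sum_right bdot_smult_right using \<Phi> by simp
  with split[of w0] \<Psi>(2) have "a (Suc k) = 0" by simp
  with a split show "\<exists>a. (\<exists>i\<le>k. a i \<noteq> 0) \<and> (\<forall>w. (\<Sum>i\<le>k. a i *s \<Phi> i w) = 0)"
    by (metis add.right_neutral le_Suc_eq vec.scale_zero_left)
qed

lemma nearby_row_not_orthogonal:
  fixes u :: "complex^'n"
  assumes "u \<noteq> 0" "\<delta> > 0"
  obtains q where "norm (q - qhat) < \<delta>" "bdot q u \<noteq> 0"
proof (cases "bdot qhat u = 0")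
  case True
  define v where "v = (\<chi> p. cnj (u $ p))"
  define t where "t = \<delta> / (2 * (norm v + 1))"
  have t: "t > 0" using assms(2) by (simp add: t_def add_nonneg_pos)
  have "norm (qhat + t *\<^sub>R v - qhat) = t * norm v" using t by simp
  also have "\<dots> \<le> t * (norm v + 1)" using t by simp
  also have "\<dots> = \<delta> / 2" using norm_ge_zero[of v] by (simp add: t_def field_simps del: norm_ge_zero)
  also have "\<dots> < \<delta>" using assms(2) by simp
  finally have n: "norm (qhat + t *\<^sub>R v - qhat) < \<delta>" .
  have "t *\<^sub>R v = complex_of_real t *s v" by (simp add: vec_eq_iff scaleR_conv_of_real[where 'a=complex])
  then have "bdot (qhat + t *\<^sub>R v) u = complex_of_real t * bdot v u"
    using True by (simp add: bdot_add_left bdot_smult_left)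
  also have "\<dots> \<noteq> 0" using t bdot_cnj_self[OF assms(1)] by (simp add: v_def)
  finally show ?thesis using n that by blast
next
  case False
  with assms(2) show ?thesis using that[of qhat] by simp
qed

text \<open>
  The points are treated one after the other. At each of them either some function of the current space does not vanish, and
  then a row near the given one detects it and cuts the dimension down, or the space is zero already. Imposing the condition
  at one point preserves divisibility at the others, because the points are distinct.
\<close>

lemma generic_rows:
  fixes Y :: "(complex \<Rightarrow> complex^'n) set" and pt :: "'s \<Rightarrow> complex"
  assumes "finite S" "dim_at_most (card S) Y" "\<And>\<Phi> w. \<Phi> \<in> Y \<Longrightarrow> isCont \<Phi> w"
    "inj_on pt S" "\<And>s. s \<in> S \<Longrightarrow> divisible_at (pt s) Y" "\<delta> > 0"
  shows "\<exists>q. (\<forall>s\<in>S. norm (q s - qhat s) < \<delta> \<and> q s \<noteq> 0) \<and>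
    (\<forall>\<Phi>\<in>Y. (\<forall>s\<in>S. bdot (q s) (\<Phi> (pt s)) = 0) \<longrightarrow> (\<forall>w. \<Phi> w = 0))"
  using assms
proof (induction S arbitrary: Y rule: finite_induct)
  case empty
  have "\<Phi> w = 0" if "\<Phi> \<in> Y" for \<Phi> w
  proof -
    have "dim_at_most 0 Y" using empty.prems(1) by simp
    from dim_at_mostD[OF this, of "\<lambda>_. \<Phi>", OF \<open>\<Phi> \<in> Y\<close>] show ?thesis by auto
  qed
  then show ?case by auto
next
  case (insert s S)
  note prems = insert.prems
  have "\<exists>qs. norm (qs - qhat s) < \<delta> \<and> qs \<noteq> 0 \<and> dim_at_most (card S) {\<Phi>\<in>Y. bdot qs (\<Phi> (pt s)) = 0}"
  proof (cases "\<exists>\<Psi>\<in>Y. \<Psi> (pt s) \<noteq> 0")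
    case True
    then obtain \<Psi> where \<Psi>: "\<Psi> \<in> Y" "\<Psi> (pt s) \<noteq> 0" by blast
    obtain qs where qs: "norm (qs - qhat s) < \<delta>" "bdot qs (\<Psi> (pt s)) \<noteq> 0"
      using nearby_row_not_orthogonal[OF \<Psi>(2) \<open>\<delta> > 0\<close>] by metis
    have "dim_at_most (card S) {\<Phi>\<in>Y. bdot qs (\<Phi> (pt s)) = 0}"
      using prems(1) insert.hyps by (intro dim_at_most_kernel[OF _ \<Psi>(1) qs(2)]) simp
    with qs show ?thesis by auto
  next
    case False
    have z: "\<Phi> w = 0" if "\<Phi> \<in> Y" for \<Phi> w
      by (rule vanishing_at_point_imp_zero[OF prems(1) prems(2) prems(4)[of s] _ that]) (use False in auto)
    obtain qs where qs: "norm (qs - qhat s) < \<delta>" "bdot qs (1::complex^'n) \<noteq> 0"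
      using nearby_row_not_orthogonal[of "1::complex^'n" \<delta> "qhat s"] \<open>\<delta> > 0\<close> by (metis zero_neq_one)
    have "dim_at_most (card S) {\<Phi>\<in>Y. bdot qs (\<Phi> (pt s)) = 0}"
      unfolding dim_at_most_def using z by (auto intro!: exI[of _ "\<lambda>_. 1"] exI[of _ 0] sum.neutral)
    with qs show ?thesis by auto
  qed
  then obtain qs where qs: "norm (qs - qhat s) < \<delta>" "qs \<noteq> 0"
    and dim: "dim_at_most (card S) {\<Phi>\<in>Y. bdot qs (\<Phi> (pt s)) = 0}" by blast
  let ?Y = "{\<Phi>\<in>Y. bdot qs (\<Phi> (pt s)) = 0}"
  have div: "divisible_at (pt t) ?Y" if t: "t \<in> S" for t
    unfolding divisible_at_def
  proof (intro ballI impI)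
    fix \<Phi> assume \<Phi>: "\<Phi> \<in> ?Y" "\<Phi> (pt t) = 0"
    then obtain \<Psi> where \<Psi>: "\<Psi> \<in> Y" "\<And>w. w \<noteq> pt t \<Longrightarrow> \<Phi> w = (w - pt t) *s \<Psi> w"
      using prems(4)[of t] t unfolding divisible_at_def by blast
    have ne: "pt s \<noteq> pt t" using prems(3) t insert.hyps(2) by (auto simp: inj_on_def)
    have "(pt s - pt t) * bdot qs (\<Psi> (pt s)) = 0"
      using \<Phi>(1) unfolding mem_Collect_eq \<Psi>(2)[OF ne] bdot_smult_right by blast
    with ne \<Psi> show "\<exists>\<Psi>\<in>?Y. \<forall>w. w \<noteq> pt t \<longrightarrow> \<Phi> w = (w - pt t) *s \<Psi> w" by auto
  qed
  from insert.IH[of ?Y] dim prems div obtain q where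
    q: "\<forall>t\<in>S. norm (q t - qhat t) < \<delta> \<and> q t \<noteq> 0"
      "\<forall>\<Phi>\<in>?Y. (\<forall>t\<in>S. bdot (q t) (\<Phi> (pt t)) = 0) \<longrightarrow> (\<forall>w. \<Phi> w = 0)" by auto
  have eq: "(q(s := qs)) t = q t" if "t \<in> S" for t using that insert.hyps(2) by auto
  show ?case
    by (rule exI[of _ "q(s := qs)"]) (use q qs eq in auto)
qed

section \<open>Vector transforms\<close>

lemma has_sum_single_point:
  fixes f :: "'a \<Rightarrow> 'b::{topological_comm_monoid_add, t2_space}"
  assumes "\<And>j. j \<noteq> i \<Longrightarrow> f j = 0"
  shows "(f has_sum f i) UNIV"
proof -
  have "(f has_sum f i) {i}" by (rule has_sum_finiteI) auto
  then show ?thesis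
    by (subst has_sum_cong_neutral[of "{i}" UNIV]) (use assms in auto)
qed

lemma riesz_fischer_value_at_freq:
  assumes "((\<lambda>l. x l * unit_laplace (freq k - freq l)) has_sum s) UNIV"
  shows "s = x k"
proof -
  have "((\<lambda>l. x l * unit_laplace (freq k - freq l)) has_sum x k * unit_laplace (freq k - freq k)) UNIV"
    by (rule has_sum_single_point) (simp add: freq_arith unit_laplace_freq)
  from has_sum_unique[OF assms this] show ?thesis by (simp add: unit_laplace_0)
qed

text \<open>
  Surjectivity of the moment map on a shifted lattice: a function with prescribed Fourier coefficients is weighted by an exponential.
\<close>

lemma laplace_interpolation:
  assumes x: "l2_le x B"
  obtains f where "L2_borel f" "\<And>l. laplace f (a + freq l) = x l"
proof -
  obtain g where g: "L2_borel g"
    "\<And>w. ((\<lambda>l. x l * unit_laplace (w - freq l)) has_sum laplace g w) UNIV"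
    using riesz_fischer[OF x] by metis
  have "laplace (\<lambda>t. exp (- a * of_real t) * g t) (a + freq l) = x l" for l
    unfolding laplace_shift using riesz_fischer_value_at_freq[OF g(2)[of "freq l"]] by simp
  with L2_borel_exp_mult[OF g(1), of "- a"] show ?thesis using that by blast
qed

text \<open>
  Injectivity of the moment map: a transform is the sum of the interpolation series of its values
  on the shifted lattice. The series is a transform with the same values by the Riesz-Fischer theorem, and
  transforms with the same values coincide by completeness.
\<close>

lemma laplace_expansion:
  assumes f: "L2_borel f"
  shows "((\<lambda>l. laplace f (a + freq l) * unit_laplace (w - (a + freq l))) has_sum laplace f w) UNIV"
    and "\<exists>B. l2_le (\<lambda>l. laplace f (a + freq l)) B"
proof -
  define h where "h t = exp (a * of_real t) * f t" for t :: real
  have h: "L2_borel h" unfolding h_def by (rule L2_borel_exp_mult[OF f])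
  have lh: "laplace h v = laplace f (v + a)" for v
    unfolding h_def by (rule laplace_shift)
  have l2: "l2_le (\<lambda>l. laplace h (freq l)) (sqrt (\<integral>t. (cmod (h t))\<^sup>2 \<partial>delay))"
    by (rule l2_le_laplace_freq[OF h])
  then show "\<exists>B. l2_le (\<lambda>l. laplace f (a + freq l)) B" by (auto simp: lh add.commute)
  obtain g where g: "L2_borel g"
    "\<And>w. ((\<lambda>l. laplace h (freq l) * unit_laplace (w - freq l)) has_sum laplace g w) UNIV"
    using riesz_fischer[OF l2] by metis
  have gk: "laplace g (freq k) = laplace h (freq k)" for k
    by (rule riesz_fischer_value_at_freq[OF g(2)])
  have "freq_null (\<lambda>t. h t - g t)"
    unfolding freq_null_def using gk
    by (auto simp: laplace_diff[OF h g(1)] L2_borel_integrable[OF h] L2_borel_integrable[OF g(1)])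
  from laplace_eq_0_of_freq_null[OF this] have hg: "laplace h v = laplace g v" for v
    by (simp add: laplace_diff[OF h g(1)])
  have "((\<lambda>l. laplace h (freq l) * unit_laplace ((w - a) - freq l)) has_sum laplace h (w - a)) UNIV"
    unfolding hg[of "w - a"] by (rule g(2))
  then show "((\<lambda>l. laplace f (a + freq l) * unit_laplace (w - (a + freq l))) has_sum laplace f w) UNIV"
    by (simp add: lh add.commute diff_diff_eq)
qed

text \<open>
  \<open>1 - exp (- w)\<close> is \<open>w\<close> times the transform of the constant 1.
\<close>

lemma norm_one_minus_exp_le: "cmod (1 - exp (- w)) \<le> cmod w * exp (cmod w)"
proof (cases "w = 0")
  case False
  have "cmod (unit_laplace w) \<le> exp (cmod w)"
    using laplace_norm_le[of "\<lambda>_. 1" w] by (simp add: unit_laplace_def L2_borel_def)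
  with False show ?thesis by (simp add: unit_laplace_eq norm_divide divide_le_eq mult.commute)
qed simp

definition transform :: "(complex \<Rightarrow> complex^'n) \<Rightarrow> bool" where
  "transform u \<longleftrightarrow> (\<exists>f. (\<forall>p. L2_borel (f p)) \<and> (\<forall>w p. u w $ p = laplace (f p) w))"

lemma transformE:
  assumes "transform u"
  obtains f where "\<And>p. L2_borel (f p)" "\<And>w p. u w $ p = laplace (f p) w"
  using assms unfolding transform_def by blast

lemma transformI:
  assumes "\<And>p. \<exists>f. L2_borel f \<and> (\<forall>w. u w $ p = laplace f w)"
  shows "transform u"
  using choice[of "\<lambda>p f. L2_borel f \<and> (\<forall>w. u w $ p = laplace f w)"] assms
  unfolding transform_def by blast

lemma transform_0: "transform (\<lambda>w. 0)"
  by (rule transformI, rule exI[of _ "\<lambda>_. 0"]) (simp add: L2_borel_def laplace_def)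

lemma transform_add_smult:
  assumes "transform u" "transform v"
  shows "transform (\<lambda>w. u w + c *s v w)"
proof -
  obtain f where f: "\<And>p. L2_borel (f p)" "\<And>w p. u w $ p = laplace (f p) w" using transformE[OF assms(1)] by metis
  obtain g where g: "\<And>p. L2_borel (g p)" "\<And>w p. v w $ p = laplace (g p) w" using transformE[OF assms(2)] by metis
  show ?thesis
  proof (rule transformI)
    fix p
    show "\<exists>h. L2_borel h \<and> (\<forall>w. (u w + c *s v w) $ p = laplace h w)"
      by (rule exI[of _ "\<lambda>t. f p t + c * g p t"])
        (simp add: f g L2_borel_add L2_borel_cmult laplace_add laplace_cmult)
  qed
qed

lemma transform_sum:
  "(\<And>i. i \<in> A \<Longrightarrow> transform (u i)) \<Longrightarrow> transform (\<lambda>w. \<Sum>i\<in>A. c i *s u i w)"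
proof (induction A rule: infinite_finite_induct)
  case (insert i A)
  then have "transform (\<lambda>w. (\<Sum>i\<in>A. c i *s u i w) + c i *s u i w)" by (intro transform_add_smult) auto
  with insert.hyps show ?case by (simp add: add.commute)
qed (simp_all add: transform_0)

lemma isCont_transform:
  assumes "transform u"
  shows "isCont u w"
proof -
  obtain f where f: "\<And>p. L2_borel (f p)" "\<And>w p. u w $ p = laplace (f p) w" using transformE[OF assms] by metis
  have "u = (\<lambda>w. \<chi> p. laplace (f p) w)" by (auto simp: vec_eq_iff f)
  then show ?thesis
    unfolding isCont_def using isCont_laplace[OF f(1)]
    by (auto intro!: vec_tendstoI simp: isCont_def)
qed

lemma transform_division:
  assumes "transform u"
  obtains v where "transform v" "\<And>w. w \<noteq> w0 \<Longrightarrow> u w - u w0 = (w - w0) *s v w"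
proof -
  obtain f where f: "\<And>p. L2_borel (f p)" "\<And>w p. u w $ p = laplace (f p) w" using transformE[OF assms] by metis
  have "\<forall>p. \<exists>g. L2_borel g \<and> (\<forall>w. w \<noteq> w0 \<longrightarrow> laplace g w = (laplace (f p) w - laplace (f p) w0) / (w - w0))"
    using laplace_division[OF f(1)] by metis
  then obtain g where g: "\<And>p. L2_borel (g p)"
    "\<And>p w. w \<noteq> w0 \<Longrightarrow> laplace (g p) w = (laplace (f p) w - laplace (f p) w0) / (w - w0)" by metis
  define v where "v w = (\<chi> p. laplace (g p) w)" for w
  have "transform v" unfolding v_def by (rule transformI) (use g(1) in auto)
  moreover have "u w - u w0 = (w - w0) *s v w" if "w \<noteq> w0" for w
    unfolding vec_eq_iff
  proof
    fix p
    have "w - w0 \<noteq> 0" using that by simp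
    then show "(u w - u w0) $ p = ((w - w0) *s v w) $ p"
      unfolding vector_minus_component vector_smult_component v_def vec_lambda_beta f g(2)[OF that]
      by simp
  qed
  ultimately show ?thesis using that by blast
qed

text \<open>
  The functions \<open>w u(w) + c\<close> are the contributions of the integral terms to one column of the characteristic matrix. The quotient by
  \<open>w - w0\<close> is a transform, namely \<open>u + w0 v\<close> with \<open>v\<close> the divided difference of \<open>u\<close>, and
  every transform is again of the form \<open>w v'(w) + d\<close>, by division at 0.
\<close>

lemma affine_division:
  assumes u: "transform u" and z: "w0 *s u w0 + c = 0"
  obtains v d where "transform v" "\<And>w. w \<noteq> w0 \<Longrightarrow> w *s u w + c = (w - w0) *s (w *s v w + d)"
proof -
  obtain v where v: "transform v" "\<And>w. w \<noteq> w0 \<Longrightarrow> u w - u w0 = (w - w0) *s v w"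
    using transform_division[OF u] by metis
  have t: "transform (\<lambda>w. u w + w0 *s v w)" by (rule transform_add_smult[OF u v(1)])
  obtain v' where v': "transform v'" "\<And>w. w \<noteq> 0 \<Longrightarrow> (u w + w0 *s v w) - (u 0 + w0 *s v 0) = (w - 0) *s v' w"
    using transform_division[OF t, of 0] by metis
  have split: "u w + w0 *s v w = w *s v' w + (u 0 + w0 *s v 0)" for w
    using v'(2)[of w] by (cases "w = 0") (auto simp: algebra_simps)
  have "w *s u w + c = (w - w0) *s (w *s v' w + (u 0 + w0 *s v 0))" if "w \<noteq> w0" for w
  proof -
    have c: "c = - (w0 *s u w0)" using z by (simp add: eq_neg_iff_add_eq_0 add.commute)
    have "(w - w0) *s (u w + w0 *s v w) = (w - w0) *s u w + w0 *s ((w - w0) *s v w)"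
      by (simp add: vec_eq_iff algebra_simps)
    also have "\<dots> = (w - w0) *s u w + w0 *s (u w - u w0)" unfolding v(2)[OF that] ..
    also have "\<dots> = w *s u w + c" unfolding c by (simp add: vec_eq_iff algebra_simps)
    finally show ?thesis unfolding split[of w] by (rule sym)
  qed
  with v'(1) show ?thesis using that by blast
qed

lemma bdot_norm_le: "cmod (bdot q u) \<le> real CARD('n) * norm q * norm u"
  for q u :: "complex^'n"
proof -
  have "cmod (bdot q u) \<le> (\<Sum>p\<in>UNIV. cmod (q $ p * u $ p))"
    unfolding bdot_def by (rule norm_sum)
  also have "\<dots> \<le> (\<Sum>p\<in>(UNIV::'n set). norm q * norm u)"
    unfolding norm_mult by (intro sum_mono mult_mono Finite_Cartesian_Product.norm_nth_le) auto
  finally show ?thesis by simp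
qed

lemma l2_le_prod:
  fixes x :: "'n::finite \<times> 'b \<Rightarrow> complex"
  assumes "\<And>p. l2_le (\<lambda>l. x (p, l)) (B p)"
  shows "l2_le x (\<Sum>p\<in>UNIV. B p)"
proof -
  have emb: "l2_le (\<lambda>i. if fst i = p then x i else 0) (B p)" for p
  proof -
    have "(\<Sum>i\<in>F. (cmod (if fst i = p then x i else 0))\<^sup>2) \<le> (B p)\<^sup>2" if F: "finite F" for F
    proof -
      have "(\<Sum>i\<in>F. (cmod (if fst i = p then x i else 0))\<^sup>2) = (\<Sum>i\<in>{i\<in>F. fst i = p}. (cmod (x i))\<^sup>2)"
        using F by (simp add: sum.inter_filter if_distrib[of cmod] if_distrib[of "\<lambda>z. z\<^sup>2"] cong: if_cong)
      also have "\<dots> = (\<Sum>l\<in>snd ` {i\<in>F. fst i = p}. (cmod (x (p, l)))\<^sup>2)"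
        by (rule sum.reindex_cong[of "Pair p"]) (force simp: inj_on_def image_iff)+
      also have "\<dots> \<le> (B p)\<^sup>2" using F by (intro l2_le_sum_le[OF assms]) auto
      finally show ?thesis .
    qed
    then show ?thesis using l2_le_nonneg[OF assms] by (simp add: l2_le_iff_sum)
  qed
  have "l2_le (\<lambda>i. \<Sum>p\<in>UNIV. if fst i = p then x i else 0) (\<Sum>p\<in>UNIV. B p)"
    by (intro l2_le_sum emb) auto
  then show ?thesis by simp
qed

definition tail :: "nat \<Rightarrow> 'n \<times> int \<Rightarrow> bool" where
  "tail N i \<longleftrightarrow> \<bar>snd i\<bar> > int N"

lemma finite_heads: "finite {i :: 'n::finite \<times> int. \<not> tail N i}"
proof -
  have "{i :: 'n \<times> int. \<not> tail N i} \<subseteq> UNIV \<times> {- int N..int N}" by (auto simp: tail_def)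
  then show ?thesis by (rule finite_subset) auto
qed

lemma l2_le_tail_small:
  fixes x :: "'n::finite \<times> int \<Rightarrow> complex"
  assumes "l2_le x B" "e > 0"
  shows "\<exists>N0. \<forall>N\<ge>N0. l2_le (\<lambda>i. if tail N i then x i else 0) e"
proof -
  obtain S where S: "finite S" "\<And>F. finite F \<Longrightarrow> F \<inter> S = {} \<Longrightarrow> (\<Sum>i\<in>F. (cmod (x i))\<^sup>2) < e\<^sup>2"
    using summable_on_small_tail[OF l2_le_imp_summable_on[OF assms(1)], of "e\<^sup>2"] assms(2) by (metis zero_less_power)
  obtain N0 where N0: "\<And>i. i \<in> S \<Longrightarrow> nat \<bar>snd i\<bar> \<le> N0"
    using finite_nat_set_iff_bounded_le[of "(\<lambda>i. nat \<bar>snd i\<bar>) ` S"] S(1) by auto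
  have "l2_le (\<lambda>i. if tail N i then x i else 0) e" if N: "N \<ge> N0" for N
  proof -
    have "(\<Sum>i\<in>F. (cmod (if tail N i then x i else 0))\<^sup>2) \<le> e\<^sup>2" if F: "finite F" for F
    proof -
      have "(\<Sum>i\<in>F. (cmod (if tail N i then x i else 0))\<^sup>2) = (\<Sum>i\<in>{i\<in>F. tail N i}. (cmod (x i))\<^sup>2)"
        using F by (simp add: sum.inter_filter if_distrib[of cmod] if_distrib[of "\<lambda>z. z\<^sup>2"] cong: if_cong)
      also have "\<dots> < e\<^sup>2" using F N N0 by (intro S(2)) (force simp: tail_def)+
      finally show ?thesis by simp
    qed
    then show ?thesis using assms(2) by (simp add: l2_le_iff_sum)
  qed
  then show ?thesis by blast
qed

section \<open>Moments at the unperturbed nodes and the perturbed moment problem\<close>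

text \<open>
  The unperturbed points: one shifted lattice for each component.
\<close>

definition node :: "('n \<Rightarrow> complex) \<Rightarrow> 'n \<times> int \<Rightarrow> complex" where
  "node a i = a (fst i) + freq (snd i)"

text \<open>
  The moment of the component \<open>fst i\<close> at its own node. These moments are coordinates on the space of transforms.
\<close>

definition coords :: "('n \<Rightarrow> complex) \<Rightarrow> (complex \<Rightarrow> complex^'n) \<Rightarrow> 'n \<times> int \<Rightarrow> complex" where
  "coords a u i = u (node a i) $ fst i"

text \<open>
  The functional \<open>u \<mapsto> bdot q (u w)\<close>, written in the coordinates \<open>coords a u\<close>.
\<close>

definition eval_row :: "('n \<Rightarrow> complex) \<Rightarrow> complex^'n \<Rightarrow> complex \<Rightarrow> 'n \<times> int \<Rightarrow> complex" where
  "eval_row a q w i = q $ fst i * unit_laplace (w - node a i)"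

lemma unit_laplace_node:
  "unit_laplace (node a (p, k) - node a (p, l)) = (if k = l then 1 else 0)"
  by (simp add: node_def freq_arith unit_laplace_freq)

lemma coords_l2:
  fixes u :: "complex \<Rightarrow> complex^'n"
  assumes "transform u"
  shows "\<exists>B. l2_le (coords a u) B"
proof -
  obtain f where f: "\<And>p. L2_borel (f p)" "\<And>w p. u w $ p = laplace (f p) w" using transformE[OF assms] by metis
  have "\<forall>p. \<exists>B. l2_le (\<lambda>l. coords a u (p, l)) B"
    unfolding coords_def node_def fst_conv snd_conv f using laplace_expansion(2)[OF f(1)] by blast
  then obtain B where "\<And>p. l2_le (\<lambda>l. coords a u (p, l)) (B p)" by metis
  from l2_le_prod[of "coords a u", OF this] show ?thesis by blast
qed

lemma eval_row_l2: "\<exists>B. l2_le (eval_row a q w) B"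
proof -
  have "\<forall>p. \<exists>B. l2_le (\<lambda>l. eval_row a q w (p, l)) B"
  proof
    fix p
    obtain B where "l2_le (\<lambda>l. unit_laplace (w - a p - freq l)) B"
      using l2_le_unit_laplace by blast
    from l2_le_cmult[OF this, of "q $ p"]
    show "\<exists>B. l2_le (\<lambda>l. eval_row a q w (p, l)) B"
      by (auto simp: eval_row_def node_def diff_diff_eq)
  qed
  then obtain B where "\<And>p. l2_le (\<lambda>l. eval_row a q w (p, l)) (B p)" by metis
  from l2_le_prod[of "eval_row a q w", OF this] show ?thesis by blast
qed

lemma eval_row_has_sum:
  fixes u :: "complex \<Rightarrow> complex^'n"
  assumes "transform u"
  shows "((\<lambda>i. eval_row a q w i * coords a u i) has_sum bdot q (u w)) UNIV"
proof -
  obtain f where f: "\<And>p. L2_borel (f p)" "\<And>w p. u w $ p = laplace (f p) w" using transformE[OF assms] by metis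
  obtain A B where AB: "l2_le (eval_row a q w) A" "l2_le (coords a u) B"
    using eval_row_l2 coords_l2[OF assms] by blast
  have "((\<lambda>i. eval_row a q w i * coords a u i) has_sum bdot q (u w)) (Sigma UNIV (\<lambda>_. UNIV))"
  proof (rule has_sum_SigmaI)
    show "((\<lambda>l. eval_row a q w (p, l) * coords a u (p, l)) has_sum q $ p * u w $ p) UNIV" for p
      using has_sum_cmult_right[OF laplace_expansion(1)[OF f(1)[of p], of "a p" w], of "q $ p"]
      by (simp add: eval_row_def coords_def node_def f mult_ac)
    show "((\<lambda>p. q $ p * u w $ p) has_sum bdot q (u w)) UNIV"
      unfolding bdot_def by (rule has_sum_finite) simp
    show "(\<lambda>i. eval_row a q w i * coords a u i) summable_on Sigma UNIV (\<lambda>_. UNIV)"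
      using l2_le_has_sum[OF AB] by (auto simp: summable_on_def)
  qed
  then show ?thesis by simp
qed

lemma transform_with_coords:
  fixes x :: "'n::finite \<times> int \<Rightarrow> complex"
  assumes x: "l2_le x B"
  obtains u where "transform u" "coords a u = x"
proof -
  have "\<forall>p. \<exists>f. L2_borel f \<and> (\<forall>l. laplace f (a p + freq l) = x (p, l))"
  proof
    fix p
    have "l2_le (\<lambda>l. x (p, l)) B" using l2_le_comp_inj[OF x, of "Pair p"] by (simp add: inj_on_def)
    from laplace_interpolation[OF this] show "\<exists>f. L2_borel f \<and> (\<forall>l. laplace f (a p + freq l) = x (p, l))" by metis
  qed
  then obtain f where f: "\<And>p. L2_borel (f p)" "\<And>p l. laplace (f p) (a p + freq l) = x (p, l)" by metis
  define u where "u w = (\<chi> p. laplace (f p) w)" for w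
  have "transform u" unfolding u_def by (rule transformI) (use f(1) in auto)
  moreover have "coords a u = x" by (rule ext) (simp add: coords_def node_def u_def f(2))
  ultimately show ?thesis using that by blast
qed

lemma transform_eq_0_of_coords:
  fixes u :: "complex \<Rightarrow> complex^'n"
  assumes "transform u" "\<And>i. coords a u i = 0"
  shows "u w = 0"
proof -
  have "bdot q (u w) = 0" for q
    using has_sum_unique[OF eval_row_has_sum[OF assms(1), of a q w] has_sum_0] assms(2) by simp
  from this[of "\<chi> p. cnj (u w $ p)"] bdot_cnj_self[of "u w"] show ?thesis by blast
qed

lemma coords_sum: "coords a (\<lambda>w. \<Sum>j\<in>A. c j *s u j w) i = (\<Sum>j\<in>A. c j * coords a (u j) i)"
  by (simp add: coords_def)

text \<open>
  The data after the change of basis: perturbed points and rows that are quadratically close to the nodes and to the unit rows.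
\<close>

locale spectral_data =
  fixes a :: "'n::finite \<Rightarrow> complex" and lam :: "'n \<times> int \<Rightarrow> complex" and qhat :: "'n \<times> int \<Rightarrow> complex^'n"
  assumes inj_lam: "inj lam"
    and lam_near: "\<exists>B. l2_le (\<lambda>i. lam i - node a i) B"
    and qhat_near: "\<exists>B. l2_le (\<lambda>i. of_real (norm (qhat i - axis (fst i) 1))) B"
begin

definition base_bound :: real where "base_bound = (\<Sum>m\<in>UNIV. cmod (a m))"

lemma cmod_a_le: "cmod (a m) \<le> base_bound"
  unfolding base_bound_def by (rule member_le_sum) auto

lemma cmod_exp_node:
  assumes "t \<in> {-1..0}"
  shows "cmod (exp (node a i * of_real t)) \<le> exp base_bound"
proof -
  have "exp (node a i * of_real t) = exp (a (fst i) * of_real t) * exp (freq (snd i) * of_real t)"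
    by (simp add: node_def distrib_right exp_add)
  moreover have "cmod (exp (freq (snd i) * of_real t)) = 1" by (simp add: freq_def)
  ultimately have "cmod (exp (node a i * of_real t)) = cmod (exp (a (fst i) * of_real t))"
    by (simp only: norm_mult mult_1_right)
  also have "\<dots> \<le> exp (cmod (a (fst i)))" by (rule cmod_exp_delay[OF assms])
  also have "\<dots> \<le> exp base_bound" using cmod_a_le by simp
  finally show ?thesis .
qed

definition defect :: "'n \<times> int \<Rightarrow> real" where
  "defect i = norm (qhat i - axis (fst i) 1) + cmod (lam i - node a i)"

lemma defect_l2: "\<exists>B. l2_le (\<lambda>i. of_real (defect i)) B"
proof -
  obtain A B where "l2_le (\<lambda>i. lam i - node a i) A"
    "l2_le (\<lambda>i. of_real (norm (qhat i - axis (fst i) 1)) :: complex) B"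
    using lam_near qhat_near by blast
  then have "l2_le (\<lambda>i. of_real (norm (qhat i - axis (fst i) 1)) + of_real (cmod (lam i - node a i))) (B + A)"
    by (intro l2_le_add) (auto elim!: l2_le_mono)
  then show ?thesis by (auto simp: defect_def)
qed

definition defect_row :: "'n \<times> int \<Rightarrow> 'n \<times> int \<Rightarrow> complex" where
  "defect_row i j = (if j = i then 1 else 0) - eval_row a (qhat i) (lam i) j"

text \<open>
  Up to sign, a row of the identity minus the moment operator consists of moments of the functions
  \<open>q\<^sub>p exp (lam i * t) - \<delta> exp (node a i * t)\<close>, so Bessel's inequality bounds it by their supremum norms,
  which are proportional to the perturbation of the point and of the row.
\<close>

lemma defect_row_l2: "\<exists>C\<ge>0. \<forall>i. l2_le (defect_row i) (C * defect i)"
proof -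
  obtain E where "l2_le (\<lambda>i. lam i - node a i) E" using lam_near by blast
  then have E: "cmod (lam i - node a i) \<le> E" for i by (rule l2_le_component)
  define C0 where "C0 = exp base_bound * (exp base_bound * exp E)"
  have C0: "C0 \<ge> 0" by (simp add: C0_def)
  have col: "l2_le (\<lambda>l. defect_row i (p, l)) (C0 * defect i)" for i p
  proof -
    define \<delta> :: complex where "\<delta> = (if p = fst i then 1 else 0)"
    define b where "b = qhat i $ p"
    define g where "g t = b * exp (lam i * of_real t) - \<delta> * exp (node a i * of_real t)" for t :: real
    define h where "h t = exp (- a p * of_real t) * g t" for t :: real
    have g: "L2_borel g"
      using L2_borel_add[OF L2_borel_cmult[OF L2_borel_exp, of b "lam i"]
          L2_borel_cmult[OF L2_borel_exp, of "- \<delta>" "node a i"]] by (simp add: g_def[abs_def])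
    have h: "L2_borel h" unfolding h_def by (rule L2_borel_exp_mult[OF g])
    have entry: "defect_row i (p, l) = - laplace h (- freq l)" for l
    proof -
      have "laplace h (- freq l) = laplace g (- freq l - a p)" unfolding h_def laplace_shift by simp
      also have "\<dots> = b * unit_laplace (lam i - node a (p, l)) - \<delta> * unit_laplace (node a i - node a (p, l))"
      proof -
        have v: "- freq l - a p + w = w - node a (p, l)" for w by (simp add: node_def)
        show ?thesis
          unfolding g_def laplace_diff[OF L2_borel_cmult[OF L2_borel_exp] L2_borel_cmult[OF L2_borel_exp]]
            laplace_cmult laplace_exp v ..
      qed
      also have "\<delta> * unit_laplace (node a i - node a (p, l)) = (if (p, l) = i then 1 else 0)"
        using unit_laplace_node[of a p "snd i" l] by (cases i) (auto simp: \<delta>_def)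
      finally show ?thesis by (simp add: defect_row_def eval_row_def b_def)
    qed
    have gb: "cmod (g t) \<le> exp base_bound * exp E * defect i" if t: "t \<in> {-1..0}" for t
    proof -
      define e where "e = exp ((lam i - node a i) * complex_of_real t)"
      have lame: "exp (lam i * of_real t) = exp (node a i * of_real t) * e"
        by (simp add: e_def left_diff_distrib flip: exp_add)
      have "cmod e \<le> exp (cmod (lam i - node a i))" unfolding e_def by (rule cmod_exp_delay[OF t])
      also have "\<dots> \<le> exp E" using E by simp
      finally have e1: "cmod e \<le> exp E" .
      have E0: "1 \<le> exp E" using order_trans[OF norm_ge_zero E] by simp
      have e2: "cmod (1 - e) \<le> cmod (lam i - node a i) * exp E"
      proof -
        let ?w = "- ((lam i - node a i) * complex_of_real t)"
        have le: "cmod ?w \<le> cmod (lam i - node a i)" using t mult_left_le[of "\<bar>t\<bar>" "cmod (lam i - node a i)"] by (auto simp: norm_mult)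
        have "cmod (1 - e) \<le> cmod ?w * exp (cmod ?w)"
          using norm_one_minus_exp_le[of ?w] by (simp add: e_def)
        also have "\<dots> \<le> cmod (lam i - node a i) * exp E"
          using le E[of i] by (intro mult_mono) auto
        finally show ?thesis .
      qed
      have "b - \<delta> = (qhat i - axis (fst i) 1) $ p" by (simp add: b_def \<delta>_def axis_def)
      then have bd: "cmod (b - \<delta>) \<le> norm (qhat i - axis (fst i) 1)"
        by (simp only: Finite_Cartesian_Product.norm_nth_le)
      have "g t = exp (node a i * of_real t) * ((b - \<delta>) * e - \<delta> * (1 - e))"
        unfolding g_def lame by (simp add: algebra_simps)
      also have "cmod \<dots> \<le> exp base_bound * (cmod (b - \<delta>) * cmod e + 1 * cmod (1 - e))"
        unfolding norm_mult[of "exp _"]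
      proof (intro mult_mono cmod_exp_node[OF t])
        have "cmod ((b - \<delta>) * e - \<delta> * (1 - e)) \<le> cmod ((b - \<delta>) * e) + cmod (\<delta> * (1 - e))"
          by (rule norm_triangle_ineq4)
        also have "\<dots> \<le> cmod (b - \<delta>) * cmod e + 1 * cmod (1 - e)"
          unfolding norm_mult by (intro add_mono mult_right_mono) (auto simp: \<delta>_def)
        finally show "cmod ((b - \<delta>) * e - \<delta> * (1 - e)) \<le> cmod (b - \<delta>) * cmod e + 1 * cmod (1 - e)" .
      qed auto
      also have "\<dots> \<le> exp base_bound * (norm (qhat i - axis (fst i) 1) * exp E + cmod (lam i - node a i) * exp E)"
        by (rule mult_left_mono[OF add_mono[OF mult_mono[OF bd e1]]]) (use e2 in auto)
      finally show ?thesis by (simp add: defect_def algebra_simps)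
    qed
    have hb: "cmod (h t) \<le> C0 * defect i" if t: "t \<in> {-1..0}" for t
    proof -
      have "cmod (exp (- a p * of_real t)) \<le> exp (cmod (- a p))" by (rule cmod_exp_delay[OF t])
      also have "\<dots> \<le> exp base_bound" using cmod_a_le[of p] by simp
      finally have "cmod (h t) \<le> exp base_bound * (exp base_bound * exp E * defect i)"
        unfolding h_def norm_mult[of "exp _"] by (intro mult_mono gb[OF t]) auto
      then show ?thesis by (simp add: C0_def mult.assoc)
    qed
    have d0: "0 \<le> defect i" by (simp add: defect_def)
    have "(\<integral>t. (cmod (h t))\<^sup>2 \<partial>delay) \<le> (C0 * defect i)\<^sup>2"
      using h hb by (intro integral_delay_le power_mono) (auto simp: L2_borel_def)
    then have "sqrt (\<integral>t. (cmod (h t))\<^sup>2 \<partial>delay) \<le> C0 * defect i"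
      using C0 d0 by (intro real_le_lsqrt) auto
    from l2_le_mono[OF l2_le_laplace_freq_uminus[OF h] _ this] show ?thesis
      by (simp add: entry)
  qed
  have "l2_le (defect_row i) ((real CARD('n) * C0) * defect i)" for i
    using l2_le_prod[of "defect_row i", OF col] by (simp add: mult.assoc)
  then show ?thesis using C0 by (intro exI[of _ "real CARD('n) * C0"]) auto
qed

text \<open>
  The identity minus the moment operator, with the equations of the head replaced by the prescription
  of the coordinates themselves, for which the difference is zero.
\<close>

definition tail_operator :: "nat \<Rightarrow> 'n \<times> int \<Rightarrow> 'n \<times> int \<Rightarrow> complex" where
  "tail_operator N i j = (if tail N i then defect_row i j else 0)"

lemma tail_operator_small: "\<exists>N0. \<forall>N\<ge>N0. hs_bounded (tail_operator N) (1/2)"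
proof -
  obtain C where C: "C \<ge> 0" "\<And>i. l2_le (defect_row i) (C * defect i)" using defect_row_l2 by blast
  obtain B where "l2_le (\<lambda>i. of_real (defect i)) B" using defect_l2 by blast
  from l2_le_cmult[OF this, of "of_real C"]
  have "l2_le (\<lambda>i. of_real C * of_real (defect i)) (cmod (of_real C) * B)" .
  from l2_le_tail_small[OF this, of "1/2"] obtain N0 where
    N0: "\<And>N. N \<ge> N0 \<Longrightarrow> l2_le (\<lambda>i. if tail N i then of_real C * of_real (defect i) else 0 :: complex) (1/2)" by auto
  have "hs_bounded (tail_operator N) (1/2)" if N: "N \<ge> N0" for N
    unfolding hs_bounded_def
  proof (intro conjI exI[of _ "\<lambda>i. if tail N i then C * defect i else 0"] allI)
    show "l2_le (tail_operator N i) (if tail N i then C * defect i else 0)" for i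
      using C(2)[of i] by (auto simp: tail_operator_def[abs_def])
    show "l2_le (\<lambda>i. of_real (if tail N i then C * defect i else 0)) (1/2)"
      using N0[OF N] by (simp add: if_distrib[of of_real] cong: if_cong)
  qed simp
  then show ?thesis by blast
qed

lemma row_apply_tail_operator:
  assumes "transform u"
  shows "row_apply (tail_operator N) (coords a u) i
     = (if tail N i then coords a u i - bdot (qhat i) (u (lam i)) else 0)"
proof (cases "tail N i")
  case True
  have "((\<lambda>j. (if j = i then 1 else 0) * coords a u j) has_sum (if i = i then 1 else 0) * coords a u i) UNIV"
    by (rule has_sum_single_point) simp
  from has_sum_add[OF this has_sum_cmult_right[OF eval_row_has_sum[OF assms, of a "qhat i" "lam i"], of "-1"]]
  have "((\<lambda>j. defect_row i j * coords a u j) has_sum (coords a u i - bdot (qhat i) (u (lam i)))) UNIV"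
    by (simp add: defect_row_def left_diff_distrib)
  then show ?thesis using True
    unfolding row_apply_def tail_operator_def by (auto intro: infsumI)
next
  case False
  then show ?thesis by (simp add: row_apply_def tail_operator_def)
qed

lemma tail_problem_solution:
  assumes K: "hs_bounded (tail_operator N) (1/2)" and y: "l2_le y B"
  obtains u where "transform u" "\<And>i. (if tail N i then bdot (qhat i) (u (lam i)) else coords a u i) = y i"
proof -
  obtain x where x: "l2_le x (B / (1 - 1/2))" "\<And>i. x i = y i + row_apply (tail_operator N) x i"
    using neumann_solution[OF K _ y] by auto
  obtain u where u: "transform u" "coords a u = x" using transform_with_coords[OF x(1)] by blast
  have "(if tail N i then bdot (qhat i) (u (lam i)) else coords a u i) = y i" for i
  proof -
    have "y i = coords a u i - row_apply (tail_operator N) (coords a u) i"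
      unfolding u(2) using x(2)[of i] add_diff_cancel_right' by metis
    then show ?thesis by (simp add: row_apply_tail_operator[OF u(1)])
  qed
  from that[OF u(1) this] show ?thesis .
qed

lemma tail_problem_estimate:
  assumes K: "hs_bounded (tail_operator N) (1/2)" and y: "l2_le y B" and u: "transform u"
    and eq: "\<And>i. (if tail N i then bdot (qhat i) (u (lam i)) else coords a u i) = y i"
  shows "l2_le (coords a u) (2 * B)"
proof -
  obtain A where A: "l2_le (coords a u) A" using coords_l2[OF u] by blast
  have "coords a u i = y i + row_apply (tail_operator N) (coords a u) i" for i
    using eq[of i] row_apply_tail_operator[OF u, of N i] by (auto split: if_splits)
  from neumann_estimate[OF K _ A y this] show ?thesis by (simp add: mult.commute)
qed

end

section \<open>The tail of the moment problem with the constant term\<close>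

text \<open>
  The sequence \<open>1 / (1 - freq k)\<close> dominates the inverses of the \<open>lam i\<close> in the tail. It is, up to a constant factor, a sequence of
  values of a transform, and hence square-summable by Bessel's inequality.
\<close>

lemma inverse_shifted_freq_l2:
  "\<exists>B. l2_le (\<lambda>i::'n::finite \<times> int. 1 / (1 - freq (snd i))) B"
proof -
  obtain B where B: "l2_le (\<lambda>l. unit_laplace (1 - freq l)) B" using l2_le_unit_laplace by blast
  \<comment> \<open>At the point 1, which is not a frequency, the numerator of \<open>unit_laplace\<close> is a nonzero constant.\<close>
  have ne: "1 - exp (- 1) \<noteq> (0::complex)"
  proof
    assume "1 - exp (- 1) = (0::complex)"
    then have "cmod (exp (- 1)) = 1" by simp
    then show False by simp
  qed
  have nz: "1 - freq l \<noteq> 0" for l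
  proof
    assume "1 - freq l = 0"
    from arg_cong[OF this, of Re] show False by (simp add: freq_def)
  qed
  have "1 / (1 - freq l) = (1 / (1 - exp (- 1))) * unit_laplace (1 - freq l)" for l
  proof -
    have "exp (- (1 - freq l)) = exp (- 1)" using exp_add[of "- 1" "freq l"] exp_freq(1)[of l] by simp
    then show ?thesis using ne unfolding unit_laplace_eq[OF nz] by simp
  qed
  with l2_le_cmult[OF B, of "1 / (1 - exp (- 1))"]
  have "l2_le (\<lambda>l. 1 / (1 - freq l)) (cmod (1 / (1 - exp (- 1))) * B)" by simp
  then have "l2_le (\<lambda>i::'n \<times> int. 1 / (1 - freq (snd i))) (\<Sum>p\<in>(UNIV::'n set). cmod (1 / (1 - exp (- 1))) * B)"
    by (intro l2_le_prod) simp
  then show ?thesis ..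
qed

lemma affine_combination:
  fixes u :: "'i \<Rightarrow> complex \<Rightarrow> complex^'n" and w :: complex
  shows "(\<Sum>i\<in>A. b i *s (w *s u i w + c i)) = w *s (\<Sum>i\<in>A. b i *s u i w) + (\<Sum>i\<in>A. b i *s c i)"
  by (simp add: vec_eq_iff sum_distrib_left sum.distrib algebra_simps)

lemma bdot_affine_combination:
  fixes u :: "'i \<Rightarrow> complex \<Rightarrow> complex^'n"
  shows "bdot q (w *s (\<Sum>i\<in>A. b i *s u i w) + (\<Sum>i\<in>A. b i *s c i)) = (\<Sum>i\<in>A. b i * bdot q (w *s u i w + c i))"
  unfolding affine_combination[symmetric] bdot_sum_right bdot_smult_right ..

lemma rows_bounded_below:
  fixes q0 :: "'n::finite \<Rightarrow> complex^'n"
  assumes "\<And>c. (\<And>j. bdot (q0 j) c = 0) \<Longrightarrow> c = 0"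
  shows "\<exists>\<delta>>0. \<forall>c. \<delta> * norm c \<le> (\<Sum>j\<in>UNIV. cmod (bdot (q0 j) c))"
proof -
  define f where "f c = (\<chi> j. bdot (q0 j) c)" for c
  have lin: "linear f"
  proof (rule linearI)
    show "f (b + c) = f b + f c" for b c by (simp add: f_def vec_eq_iff bdot_add_right)
    show "f (r *\<^sub>R c) = r *\<^sub>R f c" for r c
      by (simp add: f_def vec_eq_iff bdot_def scaleR_sum_right)
  qed
  have "inj f"
  proof (rule linear_injective_0[OF lin, THEN iffD2], intro allI impI)
    fix c assume "f c = 0"
    then show "c = 0" by (intro assms) (simp add: f_def vec_eq_iff)
  qed
  from linear_inj_bounded_below_pos[OF lin this] obtain \<delta> where \<delta>: "\<delta> > 0" "\<And>c. \<delta> * norm c \<le> norm (f c)" by blast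
  have "norm (f c) \<le> (\<Sum>j\<in>UNIV. cmod (bdot (q0 j) c))" for c
    unfolding norm_vec_def by (rule order_trans[OF L2_set_le_sum]) (auto simp: f_def)
  with \<delta> show ?thesis by (meson order_trans)
qed

context spectral_data
begin

lemma qhat_bounded: "\<exists>Q\<ge>0. \<forall>i. norm (qhat i) \<le> Q"
proof -
  obtain B where "l2_le (\<lambda>i. of_real (norm (qhat i - axis (fst i) 1)) :: complex) B"
    using qhat_near by blast
  from l2_le_component[OF this] have B: "norm (qhat i - axis (fst i) 1) \<le> B" for i by simp
  have "norm (qhat i) \<le> B + 1" for i
    using norm_triangle_sub[of "qhat i" "axis (fst i) 1"] B[of i] by simp
  then show ?thesis using order_trans[OF norm_ge_zero] by blast
qed

lemma qhat_tail_nonzero: "\<exists>N0. \<forall>N\<ge>N0. \<forall>i. tail N i \<longrightarrow> qhat i \<noteq> 0"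
proof -
  obtain B where "l2_le (\<lambda>i. of_real (norm (qhat i - axis (fst i) 1)) :: complex) B"
    using qhat_near by blast
  from l2_le_tail_small[OF this, of "1/2"] obtain N0 where
    N0: "\<And>N. N \<ge> N0 \<Longrightarrow> l2_le (\<lambda>i. if tail N i then of_real (norm (qhat i - axis (fst i) 1)) else 0 :: complex) (1/2)" by auto
  have "qhat i \<noteq> 0" if "N \<ge> N0" "tail N i" for N i
    using l2_le_component[OF N0[OF that(1)], of i] that(2) by auto
  then show ?thesis by blast
qed

lemma lam_tail: "\<exists>N0. \<forall>N\<ge>N0. \<forall>i. tail N i \<longrightarrow> lam i \<noteq> 0 \<and> cmod (1 / lam i) \<le> 2 * cmod (1 / (1 - freq (snd i)))"
proof -
  obtain E where "l2_le (\<lambda>i. lam i - node a i) E" using lam_near by blast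
  then have E: "cmod (lam i - node a i) \<le> E" for i by (rule l2_le_component)
  obtain N0 where N0: "real N0 \<ge> 2 * (base_bound + E) + 1" using real_arch_simple by blast
  have "lam i \<noteq> 0 \<and> cmod (1 / lam i) \<le> 2 * cmod (1 / (1 - freq (snd i)))" if "N \<ge> N0" "tail N i" for N i
  proof -
    define z where "z = freq (snd i)"
    have "cmod z = 2 * pi * \<bar>real_of_int (snd i)\<bar>" by (simp add: z_def freq_def norm_mult)
    moreover have "1 * \<bar>real_of_int (snd i)\<bar> \<le> 2 * pi * \<bar>real_of_int (snd i)\<bar>"
      using pi_gt3 by (intro mult_right_mono) auto
    moreover have "real N0 \<le> \<bar>real_of_int (snd i)\<bar>" using that by (auto simp: tail_def)
    ultimately have z: "2 * (base_bound + E) + 1 \<le> cmod z" using N0 by linarith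
    have "z = lam i - (lam i - node a i) - a (fst i)" by (simp add: node_def z_def)
    then have "cmod z \<le> cmod (lam i) + cmod (lam i - node a i) + cmod (a (fst i))"
      by (metis add_right_mono norm_triangle_ineq4 order_trans)
    then have lz: "cmod z \<le> cmod (lam i) + (base_bound + E)" using E[of i] cmod_a_le[of "fst i"] by linarith
    have z1: "cmod (1 - z) \<le> 1 + cmod z" using norm_triangle_ineq4[of 1 z] by simp
    have le: "cmod (1 - z) \<le> 2 * cmod (lam i)"
    proof -
      define s where "s = base_bound + E"
      show ?thesis using lz z z1 unfolding s_def[symmetric] by linarith
    qed
    have "1 - z \<noteq> 0"
    proof
      assume "1 - z = 0"
      from arg_cong[OF this, of Re] show False by (simp add: z_def freq_def)
    qed
    with le have pos: "0 < cmod (1 - z)" "lam i \<noteq> 0" by auto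
    have "cmod (1 / lam i) \<le> 2 * cmod (1 / (1 - z))"
      using le pos by (simp add: norm_divide field_simps)
    with pos show ?thesis by (simp add: z_def)
  qed
  then show ?thesis by blast
qed

text \<open>
  The constant term of the homogeneous tail equations, divided by \<open>lam i\<close> and moved to the right-hand side.
\<close>

definition load :: "nat \<Rightarrow> complex^'n \<Rightarrow> 'n \<times> int \<Rightarrow> complex" where
  "load N c i = (if tail N i then - bdot (qhat i) c / lam i else 0)"

text \<open>
  The entries are of size \<open>norm c / cmod (lam i)\<close>, and the inverses of the \<open>lam i\<close> are square-summable.
\<close>

lemma homogeneous_load_small:
  assumes "\<eta> > 0"
  shows "\<exists>N0. \<forall>N\<ge>N0. \<forall>c. l2_le (load N c) (norm c * \<eta>)"
proof -
  obtain Q where Q: "Q \<ge> 0" "\<And>i. norm (qhat i) \<le> Q" using qhat_bounded by blast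
  obtain N1 where N1: "\<And>N i. N \<ge> N1 \<Longrightarrow> tail N i \<Longrightarrow> cmod (1 / lam i) \<le> 2 * cmod (1 / (1 - freq (snd i)))"
    using lam_tail by blast
  obtain B where "l2_le (\<lambda>i::'n \<times> int. 1 / (1 - freq (snd i))) B" using inverse_shifted_freq_l2 by blast
  define C where "C = real CARD('n) * Q * 2"
  have C: "C \<ge> 0" using Q(1) by (simp add: C_def)
  from l2_le_cmult[OF \<open>l2_le _ B\<close>, of "of_real C"]
  have "l2_le (\<lambda>i::'n \<times> int. of_real C * (1 / (1 - freq (snd i)))) (cmod (of_real C) * B)" .
  from l2_le_tail_small[OF this assms] obtain N2 where
    N2: "\<And>N. N \<ge> N2 \<Longrightarrow> l2_le (\<lambda>i::'n \<times> int. if tail N i then of_real C * (1 / (1 - freq (snd i))) else 0) \<eta>" by auto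
  have "l2_le (load N c) (norm c * \<eta>)" if N: "N \<ge> max N1 N2" for N c
  proof -
    have "l2_le (\<lambda>i::'n \<times> int. of_real (norm c) * (if tail N i then of_real C * (1 / (1 - freq (snd i))) else 0)) (cmod (of_real (norm c)) * \<eta>)"
      by (rule l2_le_cmult[OF N2]) (use N in auto)
    then show ?thesis
    proof (rule l2_le_mono)
      fix i
      show "cmod (load N c i)
          \<le> cmod (of_real (norm c) * (if tail N i then of_real C * (1 / (1 - freq (snd i))) else 0))"
      proof (cases "tail N i")
        case True
        have "cmod (- bdot (qhat i) c / lam i) = cmod (bdot (qhat i) c) * cmod (1 / lam i)"
          by (simp add: norm_divide)
        also have "\<dots> \<le> (real CARD('n) * Q * norm c) * (2 * cmod (1 / (1 - freq (snd i))))"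
          using N True Q
          by (intro mult_mono N1 order_trans[OF bdot_norm_le] mult_right_mono mult_left_mono) auto
        also have "\<dots> = cmod (of_real (norm c) * (of_real C * (1 / (1 - freq (snd i)))))"
          using C Q by (simp add: norm_mult norm_divide C_def)
        finally show ?thesis using True by (simp add: load_def)
      qed (simp add: load_def)
    qed simp
  qed
  then show ?thesis by blast
qed

text \<open>
  The head coordinates determine a solution of the homogeneous tail equations and extra equations; by linearity it suffices to consider zero coordinates.
\<close>

definition heads_determine :: "nat \<Rightarrow> ('n \<Rightarrow> complex^'n) \<Rightarrow> ('n \<Rightarrow> complex) \<Rightarrow> bool" where
  "heads_determine N q0 lam0 \<longleftrightarrow> (\<forall>u c. transform u \<longrightarrow>
     (\<forall>i. tail N i \<longrightarrow> bdot (qhat i) (lam i *s u (lam i) + c) = 0) \<longrightarrow>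
     (\<forall>i. \<not> tail N i \<longrightarrow> coords a u i = 0) \<longrightarrow>
     (\<forall>j. bdot (q0 j) (lam0 j *s u (lam0 j) + c) = 0) \<longrightarrow> c = 0 \<and> (\<forall>w. u w = 0))"

definition tail_solvable :: "nat \<Rightarrow> bool" where
  "tail_solvable N \<longleftrightarrow> (\<forall>c h r B. l2_le r B \<longrightarrow> (\<exists>u. transform u \<and>
     (\<forall>i. tail N i \<longrightarrow> bdot (qhat i) (lam i *s u (lam i) + c) = lam i * r i) \<and>
     (\<forall>i. \<not> tail N i \<longrightarrow> coords a u i = h i)))"

text \<open>
  With zero head coordinates the tail equations give \<open>coords a u\<close> of size at most \<open>2 \<eta> norm c\<close> with \<open>\<eta>\<close> small for
  large \<open>N\<close>. The equations at the \<open>lam0 j\<close> then make every \<open>bdot (q0 j) c\<close> small compared with \<open>c\<close>, which is impossible for \<open>c \<noteq> 0\<close> as the rows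
  \<open>q0 j\<close> are jointly bounded below.
\<close>

lemma tail_and_extra_uniqueness:
  fixes q0 :: "'n \<Rightarrow> complex^'n" and lam0 :: "'n \<Rightarrow> complex"
  assumes inj: "\<And>c. (\<And>j. bdot (q0 j) c = 0) \<Longrightarrow> c = 0"
  shows "\<exists>N0. \<forall>N\<ge>N0. heads_determine N q0 lam0"
proof -
  obtain \<delta> where \<delta>: "\<delta> > 0" "\<And>c. \<delta> * norm c \<le> (\<Sum>j\<in>UNIV. cmod (bdot (q0 j) c))"
    using rows_bounded_below[OF inj] by blast
  have "\<forall>j. \<exists>R. l2_le (eval_row a (q0 j) (lam0 j)) R" using eval_row_l2 by blast
  then obtain R where R: "\<And>j. l2_le (eval_row a (q0 j) (lam0 j)) (R j)" by metis
  define S where "S = (\<Sum>j\<in>UNIV. cmod (lam0 j) * R j)"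
  have S: "S \<ge> 0" unfolding S_def by (intro sum_nonneg mult_nonneg_nonneg l2_le_nonneg[OF R]) auto
  \<comment> \<open>Chosen so that \<open>2 \<eta> S < \<delta>\<close>; the summand 1 covers \<open>S = 0\<close>.\<close>
  define \<eta> where "\<eta> = \<delta> / (4 * (S + 1))"
  have \<eta>: "\<eta> > 0" using \<delta>(1) S by (simp add: \<eta>_def)
  have "S * (2 * \<eta>) < \<delta>"
  proof -
    have "S * (2 * \<eta>) \<le> (S + 1) * (2 * \<eta>)" using \<eta> by simp
    also have "\<dots> = \<delta> / 2" using S by (simp add: \<eta>_def field_simps)
    also have "\<dots> < \<delta>" using \<delta>(1) by simp
    finally show ?thesis .
  qed
  obtain N1 where N1: "\<And>N. N \<ge> N1 \<Longrightarrow> hs_bounded (tail_operator N) (1/2)" using tail_operator_small by blast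
  obtain N2 where N2: "\<And>N c. N \<ge> N2 \<Longrightarrow> l2_le (load N c) (norm c * \<eta>)"
    using homogeneous_load_small[OF \<eta>] by blast
  obtain N3 where N3: "\<And>N i. N \<ge> N3 \<Longrightarrow> tail N i \<Longrightarrow> lam i \<noteq> 0" using lam_tail by blast
  have "c = 0 \<and> (\<forall>w. u w = 0)"
    if N: "N \<ge> max N1 (max N2 N3)" and u: "transform u"
      and t: "\<And>i. tail N i \<Longrightarrow> bdot (qhat i) (lam i *s u (lam i) + c) = 0"
      and h: "\<And>i. \<not> tail N i \<Longrightarrow> coords a u i = 0"
      and e: "\<And>j. bdot (q0 j) (lam0 j *s u (lam0 j) + c) = 0" for N u c
  proof -
    have eq: "(if tail N i then bdot (qhat i) (u (lam i)) else coords a u i)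
        = load N c i" for i
    proof (cases "tail N i")
      case True
      have "lam i \<noteq> 0" using N3[of N i] N True by simp
      moreover have "lam i * bdot (qhat i) (u (lam i)) + bdot (qhat i) c = 0"
        using t[OF True] by (simp only: bdot_add_right bdot_smult_right)
      ultimately show ?thesis using True by (simp add: load_def field_simps add_eq_0_iff)
    qed (simp add: h load_def)
    have K: "hs_bounded (tail_operator N) (1/2)" using N1 N by simp
    have l2: "l2_le (load N c) (norm c * \<eta>)" using N2 N by simp
    have x: "l2_le (coords a u) (2 * (norm c * \<eta>))"
      by (rule tail_problem_estimate[OF K l2 u eq])
    have "cmod (bdot (q0 j) c) \<le> cmod (lam0 j) * R j * (2 * \<eta>) * norm c" for j
    proof -
      have "bdot (q0 j) c = - (lam0 j * bdot (q0 j) (u (lam0 j)))"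
        using e[of j] by (simp only: bdot_add_right bdot_smult_right add_eq_0_iff)
      then have "cmod (bdot (q0 j) c) = cmod (lam0 j) * cmod (bdot (q0 j) (u (lam0 j)))"
        by (simp add: norm_mult)
      also have "bdot (q0 j) (u (lam0 j)) = (\<Sum>\<^sub>\<infinity>i. eval_row a (q0 j) (lam0 j) i * coords a u i)"
        by (rule infsumI[symmetric, OF eval_row_has_sum[OF u]])
      also have "cmod (lam0 j) * cmod \<dots> \<le> cmod (lam0 j) * (R j * (2 * (norm c * \<eta>)))"
        by (intro mult_left_mono l2_le_cauchy_schwarz(2)[OF R x]) auto
      finally show ?thesis by (simp add: mult_ac)
    qed
    then have "(\<Sum>j\<in>UNIV. cmod (bdot (q0 j) c)) \<le> (\<Sum>j\<in>UNIV. cmod (lam0 j) * R j * (2 * \<eta>) * norm c)"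
      by (intro sum_mono)
    also have "\<dots> = S * (2 * \<eta>) * norm c" by (simp add: S_def sum_distrib_right)
    finally have "\<delta> * norm c \<le> S * (2 * \<eta>) * norm c" using \<delta>(2)[of c] by linarith
    then have "c = 0" using \<open>S * (2 * \<eta>) < \<delta>\<close> by (metis mult_le_cancel_right norm_le_zero_iff not_le)
    moreover have "coords a u i = 0" for i
      using l2_le_component[OF x, of i] \<open>c = 0\<close> by simp
    then have "u w = 0" for w by (rule transform_eq_0_of_coords[OF u])
    ultimately show ?thesis by blast
  qed
  then show ?thesis unfolding heads_determine_def by blast
qed

text \<open>
  Head coordinates and the constant are free parameters of the solutions of the tail equations.
\<close>

lemma tail_problem_with_constant:
  "\<exists>N0. \<forall>N\<ge>N0. tail_solvable N"
proof -
  obtain N1 where N1: "\<And>N. N \<ge> N1 \<Longrightarrow> hs_bounded (tail_operator N) (1/2)" using tail_operator_small by blast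
  obtain N2 where N2: "\<And>N c. N \<ge> N2 \<Longrightarrow> l2_le (load N c) (norm c * 1)"
    using homogeneous_load_small[of 1] by auto
  obtain N3 where N3: "\<And>N i. N \<ge> N3 \<Longrightarrow> tail N i \<Longrightarrow> lam i \<noteq> 0" using lam_tail by blast
  have "\<exists>u. transform u \<and>
     (\<forall>i. tail N i \<longrightarrow> bdot (qhat i) (lam i *s u (lam i) + c) = lam i * r i) \<and>
     (\<forall>i. \<not> tail N i \<longrightarrow> coords a u i = h i)"
    if N: "N \<ge> max N1 (max N2 N3)" and r: "l2_le r B" for N c h r B
  proof -
    define y2 where "y2 i = (if tail N i then r i else 0)" for i
    define y3 where "y3 i = (if tail N i then 0 else h i)" for i
    have 1: "l2_le (load N c) (norm c)" using N2[of N c] N by simp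
    have 2: "l2_le y2 B" by (rule l2_le_mono[OF r]) (auto simp: y2_def)
    have 3: "\<exists>D. l2_le y3 D"
    proof (rule summable_on_imp_l2_le)
      have "(\<lambda>i. (cmod (y3 i))\<^sup>2) summable_on {i. \<not> tail N i}" by (rule summable_on_finite[OF finite_heads])
      then show "(\<lambda>i. (cmod (y3 i))\<^sup>2) summable_on UNIV"
        by (rule summable_on_cong_neutral[THEN iffD1, rotated -1]) (auto simp: y3_def)
    qed
    then obtain D where "l2_le y3 D" by blast
    from tail_problem_solution[OF _ l2_le_add[OF l2_le_add[OF 1 2] this], of N] N1[of N] N
    obtain u where u: "transform u"
      "\<And>i. (if tail N i then bdot (qhat i) (u (lam i)) else coords a u i) = load N c i + y2 i + y3 i" by auto
    have "bdot (qhat i) (lam i *s u (lam i) + c) = lam i * r i" if "tail N i" for i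
    proof -
      have "bdot (qhat i) (u (lam i)) = r i - bdot (qhat i) c / lam i"
        using u(2)[of i] that by (simp add: load_def y2_def y3_def)
      moreover have "lam i \<noteq> 0" using that N3[of N i] N by simp
      ultimately show ?thesis by (simp only: bdot_add_right bdot_smult_right) (simp add: right_diff_distrib)
    qed
    moreover have "coords a u i = h i" if "\<not> tail N i" for i
      using u(2)[of i] that by (simp add: load_def y2_def y3_def)
    ultimately show ?thesis using u(1) by blast
  qed
  then show ?thesis unfolding tail_solvable_def by blast
qed

end

section \<open>The remaining finitely many rows\<close>

context spectral_data
begin

text \<open>
  What remains after the tail equations and those at the \<open>lam0 j\<close> have been imposed.
\<close>

definition constrained_space :: "nat \<Rightarrow> ('n \<Rightarrow> complex^'n) \<Rightarrow> ('n \<Rightarrow> complex) \<Rightarrow> (complex \<Rightarrow> complex^'n) set" where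
  "constrained_space N q0 lam0 = {\<Phi>. (\<exists>u c. transform u \<and> \<Phi> = (\<lambda>w. w *s u w + c)) \<and>
     (\<forall>i. tail N i \<longrightarrow> bdot (qhat i) (\<Phi> (lam i)) = 0) \<and> (\<forall>j. bdot (q0 j) (\<Phi> (lam0 j)) = 0)}"

lemma isCont_constrained_space:
  assumes "\<Phi> \<in> constrained_space N q0 lam0"
  shows "isCont \<Phi> w"
proof -
  obtain u c where u: "transform u" "\<Phi> = (\<lambda>w. w *s u w + c)"
    using assms unfolding constrained_space_def by blast
  have "((\<lambda>w. w *s u w + c) \<longlongrightarrow> w *s u w + c) (at w)"
    using isCont_transform[OF u(1), of w]
    by (intro vec_tendstoI) (auto intro!: tendsto_intros simp: isCont_def)
  then show ?thesis by (simp add: u(2) isCont_def)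
qed

text \<open>
  Division by \<open>w - lam h\<close> preserves every homogeneous condition at a point different from \<open>lam h\<close>,
  and all conditions that define the space are of this kind.
\<close>

lemma divisible_constrained_space:
  assumes h: "\<not> tail N h" and ne: "\<And>j i. lam0 j \<noteq> lam i"
  shows "divisible_at (lam h) (constrained_space N q0 lam0)"
  unfolding divisible_at_def
proof (intro ballI impI)
  fix \<Phi> assume \<Phi>: "\<Phi> \<in> constrained_space N q0 lam0" "\<Phi> (lam h) = 0"
  then obtain u c where u: "transform u" "\<Phi> = (\<lambda>w. w *s u w + c)"
    unfolding constrained_space_def by blast
  from \<Phi>(2) u(2) have "lam h *s u (lam h) + c = 0" by simp
  from affine_division[OF u(1) this] obtain v d where v: "transform v"
    "\<And>w. w \<noteq> lam h \<Longrightarrow> w *s u w + c = (w - lam h) *s (w *s v w + d)" by metis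
  define \<Psi> where "\<Psi> w = w *s v w + d" for w
  have eq: "\<Phi> w = (w - lam h) *s \<Psi> w" if "w \<noteq> lam h" for w
    unfolding u(2) \<Psi>_def by (rule v(2)[OF that])
  have transfer: "bdot q (\<Psi> w) = 0" if "bdot q (\<Phi> w) = 0" "w \<noteq> lam h" for q w
    using that unfolding eq[OF that(2)] bdot_smult_right by simp
  have "\<Psi> \<in> constrained_space N q0 lam0"
    unfolding constrained_space_def mem_Collect_eq
  proof (intro conjI allI impI)
    show "\<exists>u c. transform u \<and> \<Psi> = (\<lambda>w. w *s u w + c)" using v(1) \<Psi>_def by blast
    show "bdot (qhat i) (\<Psi> (lam i)) = 0" if t: "tail N i" for i
    proof (rule transfer)
      show "bdot (qhat i) (\<Phi> (lam i)) = 0" using \<Phi>(1) t unfolding constrained_space_def by blast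
      show "lam i \<noteq> lam h" using inj_lam h t by (auto dest: injD)
    qed
    show "bdot (q0 j) (\<Psi> (lam0 j)) = 0" for j
    proof (rule transfer)
      show "bdot (q0 j) (\<Phi> (lam0 j)) = 0" using \<Phi>(1) unfolding constrained_space_def by blast
    qed (rule ne)
  qed
  with eq show "\<exists>\<Psi>\<in>constrained_space N q0 lam0. \<forall>w. w \<noteq> lam h \<longrightarrow> \<Phi> w = (w - lam h) *s \<Psi> w" by blast
qed

text \<open>
  The head coordinates separate the members of the space.
\<close>

lemma dim_constrained_space:
  assumes uniq: "heads_determine N q0 lam0"
  shows "dim_at_most (card {i :: 'n \<times> int. \<not> tail N i}) (constrained_space N q0 lam0)"
  unfolding dim_at_most_def
proof (intro allI impI)
  let ?H = "{i :: 'n \<times> int. \<not> tail N i}" and ?k = "card {i :: 'n \<times> int. \<not> tail N i}"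
  fix \<Phi> :: "nat \<Rightarrow> complex \<Rightarrow> complex^'n"
  assume \<Phi>: "\<forall>i\<le>?k. \<Phi> i \<in> constrained_space N q0 lam0"
  then have "\<forall>i. \<exists>u c. i \<le> ?k \<longrightarrow> transform u \<and> \<Phi> i = (\<lambda>w. w *s u w + c)"
    unfolding constrained_space_def by blast
  then obtain u c where u: "\<And>i. i \<le> ?k \<Longrightarrow> transform (u i)" "\<And>i. i \<le> ?k \<Longrightarrow> \<Phi> i = (\<lambda>w. w *s u i w + c i)"
    by metis
  have "card ?H < card {..?k}" by simp
  from underdetermined_system[OF finite_heads finite_atMost this, of "\<lambda>h i. coords a (u i) h"]
  obtain b where b: "\<exists>i\<in>{..?k}. b i \<noteq> 0" "\<And>h. \<not> tail N h \<Longrightarrow> (\<Sum>i\<le>?k. coords a (u i) h * b i) = 0"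
    by blast
  let ?u = "\<lambda>w. \<Sum>i\<le>?k. b i *s u i w" and ?c = "\<Sum>i\<le>?k. b i *s c i"
  have row: "bdot q (w *s ?u w + ?c) = (\<Sum>i\<le>?k. b i * bdot q (\<Phi> i w))" for q w
    unfolding bdot_affine_combination by (rule sum.cong) (simp_all add: u(2))
  have "?c = 0 \<and> (\<forall>w. ?u w = 0)"
  proof (rule uniq[unfolded heads_determine_def, rule_format])
    show "transform ?u" by (intro transform_sum u(1)) simp
    show "bdot (qhat i) (lam i *s ?u (lam i) + ?c) = 0" if t: "tail N i" for i
    proof -
      have "bdot (qhat i) (\<Phi> k (lam i)) = 0" if "k \<le> ?k" for k
        using \<Phi> that t unfolding constrained_space_def by blast
      then show ?thesis unfolding row by (intro sum.neutral) simp
    qed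
    show "coords a ?u i = 0" if "\<not> tail N i" for i
      using b(2)[OF that] by (simp add: coords_sum mult.commute)
    show "bdot (q0 j) (lam0 j *s ?u (lam0 j) + ?c) = 0" for j
      unfolding row using \<Phi> by (intro sum.neutral) (auto simp: constrained_space_def)
  qed
  moreover have "(\<Sum>i\<le>?k. b i *s \<Phi> i w) = w *s ?u w + ?c" for w
    unfolding affine_combination[symmetric] by (rule sum.cong) (simp_all add: u(2))
  ultimately have "(\<Sum>i\<le>?k. b i *s \<Phi> i w) = 0" for w by simp
  with b(1) show "\<exists>b. (\<exists>i\<le>?k. b i \<noteq> 0) \<and> (\<forall>w. (\<Sum>i\<le>?k. b i *s \<Phi> i w) = 0)" by blast
qed

definition rows_solvable :: "('n \<times> int \<Rightarrow> complex^'n) \<Rightarrow> ('n \<Rightarrow> complex^'n) \<Rightarrow> ('n \<Rightarrow> complex) \<Rightarrow> bool" where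
  "rows_solvable q q0 lam0 \<longleftrightarrow> (\<forall>r r0 B. l2_le r B \<longrightarrow> (\<exists>u c. transform u \<and>
     (\<forall>i. bdot (q i) (lam i *s u (lam i) + c) = lam i * r i) \<and>
     (\<forall>j. bdot (q0 j) (lam0 j *s u (lam0 j) + c) = r0 j)))"

text \<open>
  A particular solution of the tail equations plus a combination of the homogeneous solutions that belong to the single parameters.
  The coefficients are determined by a square system, with one equation for each head index and each
  \<open>lam0 j\<close>.
\<close>

lemma solvable_if_injective:
  fixes q :: "'n \<times> int \<Rightarrow> complex^'n" and q0 :: "'n \<Rightarrow> complex^'n" and lam0 :: "'n \<Rightarrow> complex"
  assumes solvable: "tail_solvable N"
    and q: "\<And>i. tail N i \<Longrightarrow> q i = qhat i"
    and inj: "\<And>u c. transform u \<Longrightarrow> (\<And>i. bdot (q i) (lam i *s u (lam i) + c) = 0) \<Longrightarrow>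
       (\<And>j. bdot (q0 j) (lam0 j *s u (lam0 j) + c) = 0) \<Longrightarrow> c = 0 \<and> (\<forall>w. u w = 0)"
  shows "rows_solvable q q0 lam0"
  unfolding rows_solvable_def
proof (intro allI impI)
  fix r :: "'n \<times> int \<Rightarrow> complex" and r0 :: "'n \<Rightarrow> complex" and B assume r: "l2_le r B"
  note solve = solvable[unfolded tail_solvable_def, rule_format]
  define K :: "(('n \<times> int) + 'n) set" where "K = Inl ` {i. \<not> tail N i} \<union> range Inr"
  have finK: "finite K" unfolding K_def using finite_heads by auto
  define c :: "('n \<times> int) + 'n \<Rightarrow> complex^'n" where "c = case_sum (\<lambda>_. 0) (\<lambda>p. axis p 1)"
  define h :: "('n \<times> int) + 'n \<Rightarrow> 'n \<times> int \<Rightarrow> complex" where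
    "h = case_sum (\<lambda>s i. if i = s then 1 else 0) (\<lambda>_ _. 0)"
  have "\<forall>j. \<exists>u. transform u \<and>
       (\<forall>i. tail N i \<longrightarrow> bdot (qhat i) (lam i *s u (lam i) + c j) = lam i * 0) \<and>
       (\<forall>i. \<not> tail N i \<longrightarrow> coords a u i = h j i)"
    using solve[OF l2_le_0] by blast
  then obtain U where U: "\<And>j. transform (U j)"
    "\<And>j i. tail N i \<Longrightarrow> bdot (q i) (lam i *s U j (lam i) + c j) = 0"
    "\<And>j i. \<not> tail N i \<Longrightarrow> coords a (U j) i = h j i"
    using q by (simp only: mult_zero_right) metis
  obtain P where P: "transform P" "\<And>i. tail N i \<Longrightarrow> bdot (q i) (lam i *s P (lam i)) = lam i * r i"
    using solve[OF r, of 0] q by (simp only: add_0_right) metis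
  define row :: "('n \<times> int) + 'n \<Rightarrow> (complex \<Rightarrow> complex^'n) \<Rightarrow> complex" where "row = case_sum (\<lambda>s \<Phi>. bdot (q s) (\<Phi> (lam s))) (\<lambda>j \<Phi>. bdot (q0 j) (\<Phi> (lam0 j)))"
  define rhs where "rhs = case_sum (\<lambda>s. lam s * r s) r0"
  define M where "M i j = row i (\<lambda>w. w *s U j w + c j)" for i j
  let ?u = "\<lambda>v w. \<Sum>j\<in>K. v j *s U j w" and ?c = "\<lambda>v. \<Sum>j\<in>K. v j *s c j"
  have row_sum: "row i (\<lambda>w. w *s ?u v w + ?c v) = (\<Sum>j\<in>K. M i j * v j)" for i v
    unfolding row_def M_def
    by (cases i) (simp_all only: sum.case bdot_affine_combination mult.commute)
  have tail_sum: "bdot (q i) (lam i *s ?u v (lam i) + ?c v) = 0" if "tail N i" for i v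
    unfolding bdot_affine_combination using U(2)[OF that] by simp
  have tr: "transform (?u v)" for v by (intro transform_sum U)
  have key: "v j = 0" if z: "\<And>i. i \<in> K \<Longrightarrow> (\<Sum>j\<in>K. M i j * v j) = 0" and j: "j \<in> K" for v j
  proof -
    have "?c v = 0 \<and> (\<forall>w. ?u v w = 0)"
    proof (rule inj[OF tr])
      show "bdot (q i) (lam i *s ?u v (lam i) + ?c v) = 0" for i
      proof (cases "tail N i")
        case False
        then have "row (Inl i) (\<lambda>w. w *s ?u v w + ?c v) = 0"
          unfolding row_sum by (intro z) (simp add: K_def)
        then show ?thesis by (simp add: row_def)
      qed (rule tail_sum)
      show "bdot (q0 j) (lam0 j *s ?u v (lam0 j) + ?c v) = 0" for j
      proof -
        have "row (Inr j) (\<lambda>w. w *s ?u v w + ?c v) = 0"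
          unfolding row_sum by (intro z) (simp add: K_def)
        then show ?thesis by (simp add: row_def)
      qed
    qed
    then have c0: "?c v = 0" and u0: "\<And>w. ?u v w = 0" by auto
    show ?thesis
    proof (cases j)
      case (Inl s)
      then have s: "\<not> tail N s" using j by (auto simp: K_def)
      have "coords a (?u v) s = (\<Sum>i\<in>K. if i = j then v i else 0)"
        unfolding coords_sum U(3)[OF s] by (rule sum.cong) (auto simp: h_def Inl split: sum.split)
      moreover have "coords a (?u v) s = 0" by (simp only: coords_def u0 zero_index)
      ultimately show ?thesis using finK j by simp
    next
      case (Inr p)
      have "?c v $ p = (\<Sum>i\<in>K. if i = j then v i else 0)"
        unfolding sum_component
        by (rule sum.cong) (auto simp: c_def Inr axis_def split: sum.split)
      moreover have "?c v $ p = 0" by (simp only: c0 zero_index)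
      ultimately show ?thesis using finK j by simp
    qed
  qed
  obtain v where v: "\<And>i. i \<in> K \<Longrightarrow> (\<Sum>j\<in>K. M i j * v j) = rhs i - row i (\<lambda>w. w *s P w)"
  proof (rule square_system_solvable[of K M "\<lambda>i. rhs i - row i (\<lambda>w. w *s P w)", OF finK])
    show "v j = 0" if "\<And>i. i \<in> K \<Longrightarrow> (\<Sum>j\<in>K. M i j * v j) = 0" "j \<in> K" for v j
      using that by (rule key)
  qed (rule that)
  let ?f = "\<lambda>w. P w + 1 *s ?u v w"
  have split: "w *s ?f w + ?c v = w *s P w + (w *s ?u v w + ?c v)" for w
    by (simp add: vec.scale_right_distrib)
  have "transform ?f" by (rule transform_add_smult[OF P(1) tr])
  moreover have "bdot (q i) (lam i *s ?f (lam i) + ?c v) = lam i * r i" for i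
  proof (cases "tail N i")
    case True
    then show ?thesis unfolding split bdot_add_right[of _ "lam i *s P (lam i)"] tail_sum[OF True] P(2)[OF True] by simp
  next
    case False
    then have "row (Inl i) (\<lambda>w. w *s ?u v w + ?c v) = rhs (Inl i) - row (Inl i) (\<lambda>w. w *s P w)"
      unfolding row_sum by (intro v) (simp add: K_def)
    then show ?thesis unfolding split bdot_add_right[of _ "lam i *s P (lam i)"]
      by (simp add: row_def rhs_def)
  qed
  moreover have "bdot (q0 j) (lam0 j *s ?f (lam0 j) + ?c v) = r0 j" for j
  proof -
    have "row (Inr j) (\<lambda>w. w *s ?u v w + ?c v) = rhs (Inr j) - row (Inr j) (\<lambda>w. w *s P w)"
      unfolding row_sum by (intro v) (simp add: K_def)
    then show ?thesis unfolding split bdot_add_right[of _ "lam0 j *s P (lam0 j)"]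
      by (simp add: row_def rhs_def)
  qed
  ultimately show "\<exists>u c. transform u \<and> (\<forall>i. bdot (q i) (lam i *s u (lam i) + c) = lam i * r i) \<and>
       (\<forall>j. bdot (q0 j) (lam0 j *s u (lam0 j) + c) = r0 j)" by blast
qed

text \<open>
  The interpolation theorem behind the main result, for a single column. The tolerance may depend on \<open>N\<close>, since the number of
  modified rows does.
\<close>

lemma row_interpolation:
  fixes q0 :: "'n \<Rightarrow> complex^'n" and lam0 :: "'n \<Rightarrow> complex" and \<delta> :: "nat \<Rightarrow> real"
  assumes inj0: "\<And>c. (\<And>j. bdot (q0 j) c = 0) \<Longrightarrow> c = 0"
    and ne: "\<And>j i. lam0 j \<noteq> lam i"
    and \<delta>: "\<And>N. \<delta> N > 0"
  shows "\<exists>N q. N > 0 \<and> (\<forall>i. q i \<noteq> 0) \<and> (\<forall>i. tail N i \<longrightarrow> q i = qhat i) \<and>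
     (\<forall>i. \<not> tail N i \<longrightarrow> norm (q i - qhat i) < \<delta> N) \<and>
     rows_solvable q q0 lam0"
proof -
  obtain N1 where N1: "\<And>N. N \<ge> N1 \<Longrightarrow> heads_determine N q0 lam0"
    using tail_and_extra_uniqueness[of q0 lam0, OF inj0] by blast
  obtain N2 where N2: "\<And>N. N \<ge> N2 \<Longrightarrow> tail_solvable N"
    using tail_problem_with_constant by blast
  obtain N3 where N3: "\<And>N i. N \<ge> N3 \<Longrightarrow> tail N i \<Longrightarrow> qhat i \<noteq> 0" using qhat_tail_nonzero by blast
  define N where "N = Suc (max N1 (max N2 N3))"
  have N: "N \<ge> N1" "N \<ge> N2" "N \<ge> N3" "N > 0" by (auto simp: N_def)
  let ?H = "{i :: 'n \<times> int. \<not> tail N i}" and ?Y = "constrained_space N q0 lam0"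
  have "\<exists>q. (\<forall>s\<in>?H. norm (q s - qhat s) < \<delta> N \<and> q s \<noteq> 0) \<and>
    (\<forall>\<Phi>\<in>?Y. (\<forall>s\<in>?H. bdot (q s) (\<Phi> (lam s)) = 0) \<longrightarrow> (\<forall>w. \<Phi> w = 0))"
  proof (rule generic_rows[OF finite_heads])
    show "dim_at_most (card ?H) ?Y" by (rule dim_constrained_space[OF N1[OF N(1)]])
    show "inj_on lam ?H" using inj_lam by (rule inj_on_subset) simp
    show "divisible_at (lam s) ?Y" if "s \<in> ?H" for s
      using that by (intro divisible_constrained_space ne) simp
  qed (use isCont_constrained_space \<delta> in auto)
  then obtain q' where q': "\<And>s. \<not> tail N s \<Longrightarrow> norm (q' s - qhat s) < \<delta> N \<and> q' s \<noteq> 0"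
    "\<And>\<Phi> w. \<Phi> \<in> ?Y \<Longrightarrow> (\<forall>s\<in>?H. bdot (q' s) (\<Phi> (lam s)) = 0) \<Longrightarrow> \<Phi> w = 0" by blast
  define q where "q i = (if tail N i then qhat i else q' i)" for i
  have inj: "c = 0 \<and> (\<forall>w. u w = 0)"
    if u: "transform u" and t: "\<And>i. bdot (q i) (lam i *s u (lam i) + c) = 0"
      and e: "\<And>j. bdot (q0 j) (lam0 j *s u (lam0 j) + c) = 0" for u c
  proof -
    have z: "w *s u w + c = 0" for w
    proof (rule q'(2)[of "\<lambda>w. w *s u w + c"])
      show "(\<lambda>w. w *s u w + c) \<in> ?Y"
        unfolding constrained_space_def mem_Collect_eq
      proof (intro conjI allI impI)
        show "bdot (qhat i) (lam i *s u (lam i) + c) = 0" if "tail N i" for i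
          using t[of i] that by (simp add: q_def)
      qed (use u e in blast)+
      show "\<forall>s\<in>?H. bdot (q' s) (lam s *s u (lam s) + c) = 0"
      proof
        fix s assume "s \<in> ?H"
        with t[of s] show "bdot (q' s) (lam s *s u (lam s) + c) = 0" by (simp add: q_def)
      qed
    qed
    from z[of 0] have c: "c = 0" by simp
    \<comment> \<open>At \<open>w = 0\<close> the factor \<open>w\<close> hides \<open>u w\<close>, so continuity is used there.\<close>
    have "u w = 0" for w
      by (rule continuous_eq_0_off_finite[OF isCont_transform[OF u], of "{0}"]) (use z c in auto)
    with c show ?thesis by blast
  qed
  show ?thesis
  proof (intro exI[of _ N] exI[of _ q] conjI allI impI)
    show "rows_solvable q q0 lam0"
      by (rule solvable_if_injective[OF N2[OF N(2)] _ inj]) (simp_all add: q_def)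
  qed (use N q' N3[OF N(3)] in \<open>auto simp: q_def\<close>)
qed

end

section \<open>Matrices, conjugation and the data of the interpolation problem\<close>

lemma LINT_lebesgue_delay:
  fixes f :: "real \<Rightarrow> complex"
  assumes [measurable]: "f \<in> borel_measurable borel"
  shows "(LINT t:{-1..0}|lebesgue. f t) = (\<integral>t. f t \<partial>delay)"
  unfolding integral_delay[OF assms] set_lebesgue_integral_def
  by (rule integral_completion) measurable

lemma L2_on_L2_borel:
  assumes "L2_borel f"
  shows "L2_on {-1..0} f"
proof -
  have [measurable]: "f \<in> borel_measurable borel" using assms by (simp add: L2_borel_def)
  have "set_integrable lborel {-1..0} (\<lambda>x. (cmod (f x))\<^sup>2)"
    using assms by (subst integrable_delay[symmetric]) (auto simp: L2_borel_def)
  then have "set_integrable lebesgue {-1..0} (\<lambda>x. (cmod (f x))\<^sup>2)"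
    unfolding set_integrable_def by (subst integrable_completion) auto
  moreover have "set_borel_measurable lebesgue {-1..0} f"
    unfolding set_borel_measurable_def by (rule measurable_completion) measurable
  ultimately show ?thesis by (simp add: L2_on_def)
qed

lemma L2_borel_ramp: "L2_borel (\<lambda>t. of_real (t + 1))"
proof (rule L2_borel_bounded)
  fix t :: real assume "t \<in> {-1..0}"
  then show "cmod (of_real (t + 1)) \<le> 1" unfolding norm_of_real by simp
qed simp

text \<open>
  The integrand is the derivative of \<open>(t + 1) exp (w * t)\<close>.
\<close>

lemma laplace_ramp: "w * laplace (\<lambda>t. of_real (t + 1)) w + unit_laplace w = 1"
proof -
  let ?F = "\<lambda>t::real. of_real (t + 1) * exp (w * of_real t)"
  have "w * laplace (\<lambda>t. of_real (t + 1)) w + unit_laplace w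
      = (\<integral>t. w * (exp (w * of_real t) * of_real (t + 1)) + exp (w * of_real t) \<partial>delay)"
    using L2_borel_integrable[OF L2_borel_exp_mult[OF L2_borel_ramp, of w]]
      L2_borel_integrable[OF L2_borel_exp[of w]]
    by (simp add: laplace_def unit_laplace_def)
  also have "\<dots> = (LBINT t. indicator {-1..0} t *\<^sub>R (w * (exp (w * of_real t) * of_real (t + 1)) + exp (w * of_real t)))"
    by (subst integral_delay) (auto simp: set_lebesgue_integral_def)
  also have "\<dots> = ?F 0 - ?F (-1)"
    by (rule integral_FTC_atLeastAtMost)
      (auto intro!: continuous_intros derivative_eq_intros has_vector_derivative_real_field simp: algebra_simps)
  finally show ?thesis by simp
qed

lemma bdot_vector_matrix_mult: "bdot (q v* A) x = bdot q (A *v x)"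
proof -
  have "bdot (q v* A) x = (\<Sum>j\<in>UNIV. \<Sum>i\<in>UNIV. q $ i * (A $ i $ j * x $ j))"
    by (simp add: bdot_def vector_matrix_mult_def sum_distrib_right mult.assoc)
  also have "\<dots> = (\<Sum>i\<in>UNIV. \<Sum>j\<in>UNIV. q $ i * (A $ i $ j * x $ j))" by (rule sum.swap)
  finally show ?thesis by (simp add: bdot_def matrix_vector_mult_def sum_distrib_left)
qed

lemma bdot_axis: "bdot (axis m 1) x = x $ m"
  by (simp add: bdot_def axis_def if_distrib[of "\<lambda>b. b * _"] cong: if_cong)

lemma conj_transpose_conj_transpose [simp]: "conj_transpose (conj_transpose v) = v"
  by (simp add: conj_transpose_def vec_eq_iff)

lemma norm_conj_transpose [simp]: "norm (conj_transpose v) = norm v"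
  by (simp add: conj_transpose_def norm_vec_def)

lemma conj_transpose_diff: "conj_transpose (v - w) = conj_transpose v - conj_transpose w"
  by (simp add: conj_transpose_def vec_eq_iff)

lemma norm_vector_matrix_mult_le:
  fixes A :: "complex^'n^'m"
  shows "\<exists>C>0. \<forall>v. norm (v v* A) \<le> norm v * C"
proof -
  have "bounded_linear (\<lambda>v. v v* A)"
    by (intro linear_conv_bounded_linear[THEN iffD1] linearI)
      (simp_all add: vector_matrix_left_distrib vec_eq_iff vector_matrix_mult_def scaleR_sum_right distrib_right sum.distrib)
  from bounded_linear.pos_bounded[OF this] show ?thesis by blast
qed

text \<open>
  Conjugation turns linear relations between the rows into relations between the vectors.
\<close>

lemma lin_indep_family_inverse:
  assumes "lin_indep_family (v :: 'n::finite \<Rightarrow> complex^'n)"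
  obtains B where "(\<chi> j. conj_transpose (v j)) ** B = mat 1" "B ** (\<chi> j. conj_transpose (v j)) = mat 1"
proof -
  let ?Z = "(\<chi> j. conj_transpose (v j)) :: complex^'n^'n"
  have inj: "inj v" and ind: "vec.independent (range v)" using assms by (auto simp: lin_indep_family_def)
  have "c i = 0" if c: "(\<Sum>i\<in>UNIV. c i *s row i ?Z) = 0" for c i
  proof -
    have "(\<Sum>i\<in>UNIV. cnj (c i) *s v i) = conj_transpose (\<Sum>i\<in>UNIV. c i *s row i ?Z)"
      by (simp add: vec_eq_iff conj_transpose_def row_def)
    also have "\<dots> = 0" unfolding c by (simp add: conj_transpose_def vec_eq_iff)
    finally have "(\<Sum>x\<in>range v. cnj (c (inv v x)) *s x) = 0"
      using inj by (simp add: sum.reindex)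
    from vec.independentD[OF ind _ _ this, of "v i"] inj show "c i = 0" by simp
  qed
  then obtain B where B: "?Z ** B = mat 1"
    using matrix_right_invertible_independent_rows[of ?Z] by blast
  with matrix_left_right_inverse show ?thesis using that by metis
qed

lemma lin_indep_family_nonzero:
  assumes "lin_indep_family v"
  shows "v j \<noteq> 0"
  using assms vec.dependent_zero[of "range v"] unfolding lin_indep_family_def by (metis rangeI)

lemma det_eq_0_of_left_kernel:
  fixes A :: "complex^'n^'n"
  assumes "v \<noteq> 0" "v v* A = 0"
  shows "det A = 0"
proof (rule ccontr)
  assume "det A \<noteq> 0"
  then obtain B where B: "A ** B = mat 1" using invertible_det_nz[of A] unfolding invertible_def by blast
  have "v = v v* (A ** B)" by (simp add: B)
  also have "\<dots> = 0" by (simp add: vector_matrix_mul_assoc[symmetric] assms(2))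
  finally show False using assms(1) by simp
qed

lemma l2_le_finite_modification:
  assumes "l2_le x B" "finite {i. y i \<noteq> x i}"
  shows "\<exists>C. l2_le y C"
proof -
  have "\<exists>D. l2_le (\<lambda>i. y i - x i) D"
  proof (rule summable_on_imp_l2_le)
    have "(\<lambda>i. (cmod (y i - x i))\<^sup>2) summable_on {i. y i \<noteq> x i}" by (rule summable_on_finite[OF assms(2)])
    then show "(\<lambda>i. (cmod (y i - x i))\<^sup>2) summable_on UNIV"
      by (rule summable_on_cong_neutral[THEN iffD1, rotated -1]) auto
  qed
  then obtain D where "l2_le (\<lambda>i. y i - x i) D" by blast
  from l2_le_add[OF assms(1) this] show ?thesis by auto
qed

lemma l2_le_family:
  fixes g :: "int \<Rightarrow> 'n::finite \<Rightarrow> complex"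
  assumes "\<And>m. (\<lambda>k. (cmod (g k m))\<^sup>2) summable_on UNIV"
  shows "\<exists>B. l2_le (\<lambda>(m, k). g k m) B"
proof -
  have "\<forall>m. \<exists>B. l2_le (\<lambda>k. g k m) B" by (intro allI summable_on_imp_l2_le assms)
  then obtain B where "\<And>m. l2_le (\<lambda>k. g k m) (B m)" by metis
  then have "l2_le (\<lambda>(m, k). g k m) (\<Sum>m\<in>UNIV. B m)" by (intro l2_le_prod) simp
  then show ?thesis ..
qed

text \<open>
  The logarithm of \<open>\<mu> m\<close> for which \<open>lambda_tilde\<close> runs through the corresponding shifted lattice.
\<close>

definition log_base :: "('n \<Rightarrow> complex) \<Rightarrow> 'n \<Rightarrow> complex" where
  "log_base \<mu> m = of_real (ln (cmod (\<mu> m))) + \<i> * of_real (Arg (\<mu> m))"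

lemma node_log_base: "node (log_base \<mu>) (m, k) = lambda_tilde \<mu> k m"
  by (simp add: node_def log_base_def lambda_tilde_def freq_def algebra_simps)

lemma exp_log_base: "\<mu> m \<noteq> 0 \<Longrightarrow> exp (log_base \<mu> m) = \<mu> m"
  using Arg_eq[of "\<mu> m"] by (simp add: log_base_def exp_add exp_of_real)

lemma exp_node: "exp (node a i) = exp (a (fst i))" "exp (- node a i) = exp (- a (fst i))"
proof -
  show *: "exp (node a i) = exp (a (fst i))" by (simp add: node_def exp_add exp_freq)
  show "exp (- node a i) = exp (- a (fst i))" unfolding exp_minus * ..
qed

context spectral_data
begin

text \<open>
  The terms \<open>w I - w exp (- w) A\<close> of the characteristic matrix, divided by \<open>w\<close> and evaluated at the data. The row is close to
  the unit row of index \<open>fst i\<close>, and in that component the factor \<open>1 - exp (- lam i) * exp (a s)\<close> is small.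
\<close>

lemma principal_part_l2:
  fixes q :: "'n \<times> int \<Rightarrow> complex^'n" and b :: "'n \<Rightarrow> complex"
  assumes q: "finite {i. q i \<noteq> qhat i}"
  shows "\<exists>B. l2_le (\<lambda>i. bdot (q i) (\<chi> s. (1 - exp (- lam i) * exp (a s)) * b s)) B"
proof -
  obtain E where E0: "l2_le (\<lambda>i. lam i - node a i) E" using lam_near by blast
  then have E: "cmod (lam i - node a i) \<le> E" for i by (rule l2_le_component)
  obtain D where D: "l2_le (\<lambda>i. of_real (norm (qhat i - axis (fst i) 1)) :: complex) D" using qhat_near by blast
  have fin: "finite {i. complex_of_real (norm (q i - axis (fst i) 1)) \<noteq> of_real (norm (qhat i - axis (fst i) 1))}"
    by (rule finite_subset[OF _ q]) auto
  obtain F where F: "l2_le (\<lambda>i. of_real (norm (q i - axis (fst i) 1)) :: complex) F"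
    using l2_le_finite_modification[OF D fin] by blast
  define g where "g i = (\<chi> s. (1 - exp (- lam i) * exp (a s)) * b s)" for i
  define \<beta> where "\<beta> = (\<Sum>s\<in>UNIV. cmod (b s))"
  have \<beta>: "cmod (b s) \<le> \<beta>" for s unfolding \<beta>_def by (rule member_le_sum) auto
  have \<beta>0: "\<beta> \<ge> 0" unfolding \<beta>_def by (intro sum_nonneg) auto
  define G where "G = real CARD('n) * ((1 + exp (E + base_bound) * exp base_bound) * \<beta>)"
  have gs: "norm (g i) \<le> G" for i
  proof -
    have lam: "cmod (exp (- lam i)) \<le> exp (E + base_bound)"
    proof -
      have "exp (- lam i) = exp (- (lam i - node a i)) * exp (- a (fst i))"
        unfolding exp_node(2)[symmetric] exp_add[symmetric] by simp
      also have "cmod \<dots> \<le> exp (cmod (- (lam i - node a i))) * exp (cmod (- a (fst i)))"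
        unfolding norm_mult by (intro mult_mono norm_exp) auto
      also have "\<dots> \<le> exp E * exp base_bound"
        using E cmod_a_le by (intro mult_mono) (auto simp: norm_minus_commute)
      finally show ?thesis by (simp add: exp_add)
    qed
    have "cmod (g i $ s) \<le> (1 + exp (E + base_bound) * exp base_bound) * \<beta>" for s
    proof -
      have "cmod (1 - exp (- lam i) * exp (a s)) \<le> 1 + cmod (exp (- lam i)) * cmod (exp (a s))"
        using norm_triangle_ineq4[of 1 "exp (- lam i) * exp (a s)"] by (simp only: norm_mult norm_one)
      also have "\<dots> \<le> 1 + exp (E + base_bound) * exp base_bound"
        using order_trans[OF norm_exp, of "a s" "exp base_bound"] cmod_a_le[of s]
        by (intro add_left_mono mult_mono lam) auto
      finally show ?thesis unfolding g_def vec_lambda_beta norm_mult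
        using \<beta> by (intro mult_mono) auto
    qed
    then have "(\<Sum>s\<in>UNIV. cmod (g i $ s)) \<le> G"
      unfolding G_def by (intro sum_bounded_above) auto
    moreover have "norm (g i) \<le> (\<Sum>s\<in>UNIV. cmod (g i $ s))"
      unfolding norm_vec_def by (rule L2_set_le_sum) simp
    ultimately show ?thesis by linarith
  qed
  have G0: "G \<ge> 0" using order_trans[OF norm_ge_zero gs] .
  have own: "cmod (g i $ fst i) \<le> exp E * \<beta> * cmod (lam i - node a i)" for i
  proof -
    have "exp (- lam i) * exp (a (fst i)) = exp (- (lam i - node a i))"
      unfolding exp_node(1)[symmetric] exp_add[symmetric] by simp
    then have "cmod (g i $ fst i) = cmod (1 - exp (- (lam i - node a i))) * cmod (b (fst i))"
      by (simp add: g_def norm_mult)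
    also have "\<dots> \<le> (cmod (lam i - node a i) * exp (cmod (lam i - node a i))) * cmod (b (fst i))"
      by (intro mult_right_mono norm_one_minus_exp_le) auto
    also have "\<dots> \<le> (cmod (lam i - node a i) * exp E) * \<beta>"
      using E \<beta> by (intro mult_mono) auto
    finally show ?thesis by (simp add: mult_ac)
  qed
  have split: "bdot (q i) (g i) = bdot (q i - axis (fst i) 1) (g i) + g i $ fst i" for i
    using bdot_add_left[of "q i - axis (fst i) 1" "axis (fst i) 1" "g i"] by (simp add: bdot_axis)
  have "l2_le (\<lambda>i. of_real (real CARD('n) * G) * of_real (norm (q i - axis (fst i) 1))) (cmod (of_real (real CARD('n) * G)) * F)"
    by (rule l2_le_cmult[OF F])
  then have 1: "l2_le (\<lambda>i. bdot (q i - axis (fst i) 1) (g i)) (cmod (of_real (real CARD('n) * G)) * F)"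
  proof (rule l2_le_mono)
    fix i
    have "cmod (bdot (q i - axis (fst i) 1) (g i)) \<le> real CARD('n) * norm (q i - axis (fst i) 1) * norm (g i)"
      by (rule bdot_norm_le)
    also have "\<dots> \<le> real CARD('n) * norm (q i - axis (fst i) 1) * G"
      by (intro mult_left_mono gs) auto
    also have "\<dots> = cmod (of_real (real CARD('n) * G) * of_real (norm (q i - axis (fst i) 1)))"
      using G0 by (simp add: norm_mult)
    finally show "cmod (bdot (q i - axis (fst i) 1) (g i)) \<le> cmod (of_real (real CARD('n) * G) * of_real (norm (q i - axis (fst i) 1)))" .
  qed simp
  have "l2_le (\<lambda>i. of_real (exp E * \<beta>) * (lam i - node a i)) (cmod (of_real (exp E * \<beta>)) * E)"
    by (rule l2_le_cmult[OF E0])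
  then have 2: "l2_le (\<lambda>i. g i $ fst i) (cmod (of_real (exp E * \<beta>)) * E)"
    by (rule l2_le_mono) (use own \<beta>0 in \<open>auto simp: norm_mult\<close>)
  from l2_le_add[OF 1 2] show ?thesis unfolding split[symmetric] unfolding g_def by blast
qed

end

section \<open>Realisation by a neutral system\<close>

lemma transform_matrix_vector_mult:
  assumes "transform u"
  shows "transform (\<lambda>w. B *v u w)"
proof -
  obtain f where f: "\<And>p. L2_borel (f p)" "\<And>w p. u w $ p = laplace (f p) w" using transformE[OF assms] by metis
  show ?thesis
  proof (rule transformI)
    fix p
    show "\<exists>g. L2_borel g \<and> (\<forall>w. (B *v u w) $ p = laplace g w)"
      by (intro exI[of _ "\<lambda>t. \<Sum>s\<in>UNIV. B $ p $ s * f s t"] conjI allI L2_borel_sum L2_borel_cmult f(1))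
        (simp add: laplace_sum L2_borel_cmult f laplace_cmult matrix_vector_mult_def)
  qed
qed

text \<open>
  By \<open>laplace_ramp\<close>, the coefficient \<open>(t + 1) c\<close> in \<open>A2\<close> together with the constant \<open>c\<close> in \<open>A3\<close> contributes exactly \<open>c\<close>,
  at \<open>w = 0\<close> as well.
\<close>

lemma char_matrix_realization:
  fixes u :: "'n::finite \<Rightarrow> complex \<Rightarrow> complex^'n" and c :: "'n \<Rightarrow> complex^'n"
  assumes u: "\<And>j. transform (u j)"
  obtains A2 A3 where "L2_matrix_on {-1..0} A2" "L2_matrix_on {-1..0} A3"
    "\<And>A1 w p j. char_matrix A1 A2 A3 w $ p $ j
       = w * (mat 1 :: complex^'n^'n) $ p $ j - w * exp (- w) * A1 $ p $ j - (w *s u j w + c j) $ p"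
proof -
  have "\<forall>j. \<exists>f. (\<forall>p. L2_borel (f p)) \<and> (\<forall>w p. u j w $ p = laplace (f p) w)"
    using u unfolding transform_def by blast
  then obtain f where f: "\<And>j p. L2_borel (f j p)" "\<And>j w p. u j w $ p = laplace (f j p) w" by metis
  define A2 :: "real \<Rightarrow> complex^'n^'n" where "A2 t = (\<chi> p j. f j p t + c j $ p * of_real (t + 1))" for t
  define A3 :: "real \<Rightarrow> complex^'n^'n" where "A3 t = (\<chi> p j. c j $ p)" for t
  have s2: "L2_borel (\<lambda>t. A2 t $ p $ j)" for p j
    unfolding A2_def by (simp only: vec_lambda_beta)
      (intro L2_borel_add f L2_borel_cmult L2_borel_ramp)
  have s3: "L2_borel (\<lambda>t. A3 t $ p $ j)" for p j
    by (rule L2_borel_bounded[of _ "cmod (c j $ p)"]) (simp_all add: A3_def)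
  have i2: "(LINT t:{-1..0}|lebesgue. w * exp (w * complex_of_real t) * A2 t $ p $ j)
      = w * (u j w $ p + c j $ p * laplace (\<lambda>t. of_real (t + 1)) w)" for w p j
  proof -
    have "(LINT t:{-1..0}|lebesgue. w * exp (w * complex_of_real t) * A2 t $ p $ j)
        = (\<integral>t. w * exp (w * complex_of_real t) * A2 t $ p $ j \<partial>delay)"
      by (rule LINT_lebesgue_delay) (use s2[of p j] in \<open>auto simp: L2_borel_def\<close>)
    also have "\<dots> = w * laplace (\<lambda>t. A2 t $ p $ j) w" by (simp add: laplace_def mult.assoc)
    also have "laplace (\<lambda>t. A2 t $ p $ j) w = u j w $ p + c j $ p * laplace (\<lambda>t. of_real (t + 1)) w"
      unfolding A2_def vec_lambda_beta
        laplace_add[OF f(1) L2_borel_cmult[OF L2_borel_ramp]] laplace_cmult f(2) ..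
    finally show ?thesis .
  qed
  have i3: "(LINT t:{-1..0}|lebesgue. exp (w * complex_of_real t) * A3 t $ p $ j) = c j $ p * unit_laplace w" for w p j
  proof -
    have "(LINT t:{-1..0}|lebesgue. exp (w * complex_of_real t) * A3 t $ p $ j)
        = (\<integral>t. exp (w * complex_of_real t) * A3 t $ p $ j \<partial>delay)"
      by (rule LINT_lebesgue_delay) (simp add: A3_def)
    also have "\<dots> = laplace (\<lambda>t. c j $ p * 1) w" by (simp add: laplace_def A3_def)
    finally show ?thesis unfolding laplace_cmult unit_laplace_def .
  qed
  have "char_matrix A1 A2 A3 w $ p $ j
       = w * (mat 1 :: complex^'n^'n) $ p $ j - w * exp (- w) * A1 $ p $ j - (w *s u j w + c j) $ p" for A1 w p j
  proof -
    have "w * (c j $ p * laplace (\<lambda>t. of_real (t + 1)) w) + c j $ p * unit_laplace w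
        = c j $ p * (w * laplace (\<lambda>t. of_real (t + 1)) w + unit_laplace w)"
      by (simp add: distrib_left)
    also have "\<dots> = c j $ p" by (simp only: laplace_ramp mult_1_right)
    finally have e: "c j $ p * unit_laplace w = c j $ p - w * (c j $ p * laplace (\<lambda>t. of_real (t + 1)) w)"
      by (simp only: eq_diff_eq add.commute)
    show ?thesis
      unfolding char_matrix_def vec_lambda_beta i2 i3 e by (simp add: distrib_left)
  qed
  moreover have "L2_matrix_on {-1..0} A2" "L2_matrix_on {-1..0} A3"
    using s2 s3 by (auto simp: L2_matrix_on_def intro!: L2_on_L2_borel)
  ultimately show ?thesis using that by blast
qed

definition diag_matrix :: "('n \<Rightarrow> complex) \<Rightarrow> complex^'n^'n" where
  "diag_matrix b = (\<chi> i j. if i = j then b i else 0)"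

lemma diag_matrix_mult: "(diag_matrix b ** Z) $ s $ j = b s * Z $ s $ j"
  by (simp add: diag_matrix_def matrix_matrix_mult_def if_distrib[of "\<lambda>x. x * _"] cong: if_cong)

text \<open>
  Multiplication by \<open>Z\<close> diagonalises the neutral term, and the remaining equation is the interpolation condition, column by column.
\<close>

lemma annihilating_row:
  fixes Z Zi :: "complex^'n^'n"
  assumes inv: "Z ** Zi = mat 1"
    and ch: "\<And>p j. \<Delta> $ p $ j = w * (mat 1 :: complex^'n^'n) $ p $ j
        - w * exp (- w) * (Zi ** (diag_matrix b ** Z)) $ p $ j - (w *s (Zi *v u j) + Zi *v c j) $ p"
    and eq: "\<And>j. bdot q (w *s u j + c j) = w * bdot q (\<chi> s. (1 - exp (- w) * b s) * Z $ s $ j)"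
  shows "(q v* Z) v* \<Delta> = 0"
proof -
  have "((q v* Z) v* \<Delta>) $ j = 0" for j
  proof -
    let ?A = "Zi ** (diag_matrix b ** Z)"
    have "Z ** ?A = diag_matrix b ** Z" by (simp add: matrix_mul_assoc inv)
    then have ZA: "(Z ** ?A) $ s $ j = b s * Z $ s $ j" for s by (simp only: diag_matrix_mult)
    have "((q v* Z) v* \<Delta>) $ j = bdot (q v* Z) (\<chi> p. \<Delta> $ p $ j)"
      by (simp add: vector_matrix_mult_def bdot_def)
    also have "\<dots> = bdot q (Z *v (\<chi> p. \<Delta> $ p $ j))" by (rule bdot_vector_matrix_mult)
    also have "Z *v (\<chi> p. \<Delta> $ p $ j) = w *s (\<chi> s. (1 - exp (- w) * b s) * Z $ s $ j) + (- 1) *s (w *s u j + c j)"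
    proof -
      have col: "(\<chi> p. \<Delta> $ p $ j) = w *s (\<chi> p. (mat 1 :: complex^'n^'n) $ p $ j)
          + (- (w * exp (- w))) *s (\<chi> p. ?A $ p $ j) + (- 1) *s (Zi *v (w *s u j + c j))"
        by (simp add: vec_eq_iff ch matrix_vector_right_distrib vector_scalar_commute)
      have c1: "Z *v (\<chi> p. (mat 1 :: complex^'n^'n) $ p $ j) = (\<chi> s. Z $ s $ j)"
        by (simp add: vec_eq_iff matrix_vector_mult_def mat_def if_distrib[of "\<lambda>x. _ * x"] cong: if_cong)
      have c2: "Z *v (\<chi> p. ?A $ p $ j) = (\<chi> s. b s * Z $ s $ j)"
        unfolding ZA[symmetric] by (simp add: vec_eq_iff matrix_vector_mult_def matrix_matrix_mult_def[of Z])
      have c3: "Z *v (Zi *v x) = x" for x by (simp add: matrix_vector_mul_assoc inv)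
      show ?thesis
        unfolding col matrix_vector_right_distrib vector_scalar_commute c1 c2 c3
        by (simp add: vec_eq_iff algebra_simps)
    qed
    also have "bdot q \<dots> = 0"
      unfolding bdot_add_right[of q "w *s (\<chi> s. (1 - exp (- w) * b s) * Z $ s $ j)" "(- 1) *s (w *s u j + c j)"]
        bdot_smult_right[of q w "\<chi> s. (1 - exp (- w) * b s) * Z $ s $ j"] bdot_smult_right[of q "- 1"] eq by simp
    finally show ?thesis .
  qed
  then show ?thesis by (simp add: vec_eq_iff)
qed

theorem theorem5p8:
  fixes \<mu> :: "'n::finite \<Rightarrow> complex"
    and z :: "'n \<Rightarrow> complex^'n"
    and lam :: "int \<Rightarrow> 'n \<Rightarrow> complex"
    and dhat :: "int \<Rightarrow> 'n \<Rightarrow> complex^'n"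
    and lam0 :: "'n \<Rightarrow> complex"
    and d0 :: "'n \<Rightarrow> complex^'n"
    and \<epsilon> :: real
  assumes "inj \<mu>"
    and "\<And>m. \<mu> m \<noteq> 0"
    and "\<And>m. z m \<noteq> 0"
    and "lin_indep_family z"
    and "\<And>k m k' m'. lam k m = lam k' m' \<Longrightarrow> k = k' \<and> m = m'"
    and "\<And>m. (\<lambda>k. (cmod (lam k m - lambda_tilde \<mu> k m))\<^sup>2) summable_on UNIV"
    and "\<And>k0 m0 k m. lam k0 m0 = lambda_tilde \<mu> k m \<Longrightarrow> m0 = m \<and> k0 = k"
    and "\<And>m. (\<lambda>k. (norm (dhat k m - z m))\<^sup>2) summable_on UNIV"
    and "inj lam0"
    and "\<And>j k m. lam0 j \<noteq> lam k m"
    and "lin_indep_family d0"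
    and "\<epsilon> > 0"
  shows "\<exists>(N::nat) (d :: int \<Rightarrow> 'n \<Rightarrow> complex^'n)
           (A1 :: complex^'n^'n) (A2 :: real \<Rightarrow> complex^'n^'n) (A3 :: real \<Rightarrow> complex^'n^'n).
      N > 0
    \<and> (\<forall>m. (\<lambda>k. (norm (d k m - dhat k m))\<^sup>2) summable_on UNIV
         \<and> (\<Sum>\<^sub>\<infinity>k. (norm (d k m - dhat k m))\<^sup>2) < \<epsilon>)
    \<and> (\<forall>k m. \<bar>k\<bar> > int N \<longrightarrow> d k m = dhat k m)
    \<and> L2_matrix_on {-1..0} A2
    \<and> L2_matrix_on {-1..0} A3
    \<and> (\<forall>k m. det (char_matrix A1 A2 A3 (lam k m)) = 0)
    \<and> (\<forall>j. det (char_matrix A1 A2 A3 (lam0 j)) = 0)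
    \<and> (\<forall>k m. conj_transpose (d k m) v* char_matrix A1 A2 A3 (lam k m) = 0)
    \<and> (\<forall>j. conj_transpose (d0 j) v* char_matrix A1 A2 A3 (lam0 j) = 0)"
proof -
  define a where "a = log_base \<mu>"
  have \<mu>: "\<mu> m = exp (a m)" for m using exp_log_base[of \<mu> m, OF assms(2)] by (simp add: a_def)
  define Z :: "complex^'n^'n" where "Z = (\<chi> j. conj_transpose (z j))"
  obtain Zi where Zi: "Z ** Zi = mat 1" "Zi ** Z = mat 1"
    using lin_indep_family_inverse[OF assms(4)] unfolding Z_def by blast
  have cancel: "(v v* Zi) v* Z = v" "(v v* Z) v* Zi = v" for v
    by (simp_all add: vector_matrix_mul_assoc Zi)
  define L where "L i = lam (snd i) (fst i)" for i
  define Q where "Q i = conj_transpose (dhat (snd i) (fst i)) v* Zi" for i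
  have zrow: "conj_transpose (z m) v* Zi = axis m 1" for m
  proof -
    have "conj_transpose (z m) = axis m 1 v* Z"
      by (simp add: Z_def vec_eq_iff vector_matrix_mult_def axis_def if_distrib[of "\<lambda>x. x * _"] cong: if_cong)
    then show ?thesis by (simp only: cancel)
  qed
  obtain C1 where C1: "C1 > 0" "\<And>v. norm (v v* Zi) \<le> norm v * C1" using norm_vector_matrix_mult_le by blast
  obtain C2 where C2: "C2 > 0" "\<And>v. norm (v v* Z) \<le> norm v * C2" using norm_vector_matrix_mult_le by blast
  interpret spectral_data a L Q
  proof
    show "inj L" using assms(5) by (auto simp: inj_on_def L_def)
    have "\<exists>B. l2_le (\<lambda>(m, k). lam k m - lambda_tilde \<mu> k m) B"
      by (rule l2_le_family) (rule assms(6))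
    moreover have "(\<lambda>(m, k). lam k m - lambda_tilde \<mu> k m) = (\<lambda>i. L i - node a i)"
      by (auto simp: fun_eq_iff L_def a_def node_log_base)
    ultimately show "\<exists>B. l2_le (\<lambda>i. L i - node a i) B" by simp
    have "\<exists>B. l2_le (\<lambda>(m, k). complex_of_real (norm (dhat k m - z m))) B"
      by (rule l2_le_family) (use assms(8) in simp)
    then obtain B where "l2_le (\<lambda>(m, k). complex_of_real (norm (dhat k m - z m))) B" ..
    from l2_le_cmult[OF this, of "of_real C1"]
    have "l2_le (\<lambda>i. of_real (norm (Q i - axis (fst i) 1)) :: complex) (cmod (of_real C1) * B)"
    proof (rule l2_le_mono)
      fix i :: "'n \<times> int"
      have "Q i - axis (fst i) 1 = conj_transpose (dhat (snd i) (fst i) - z (fst i)) v* Zi"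
        by (simp add: Q_def zrow[symmetric] conj_transpose_diff vector_matrix_mult_diff_distrib)
      then have "norm (Q i - axis (fst i) 1) \<le> C1 * norm (dhat (snd i) (fst i) - z (fst i))"
        using C1(2)[of "conj_transpose (dhat (snd i) (fst i) - z (fst i))"] by (simp add: mult.commute)
      then show "cmod (of_real (norm (Q i - axis (fst i) 1))) \<le> cmod (of_real C1 * (case i of (m, k) \<Rightarrow> complex_of_real (norm (dhat k m - z m))))"
        using C1(1) by (simp add: case_prod_beta norm_mult)
    qed simp
    then show "\<exists>B. l2_le (\<lambda>i. of_real (norm (Q i - axis (fst i) 1)) :: complex) B" ..
  qed
  define q0 where "q0 j = conj_transpose (d0 j) v* Zi" for j
  obtain D0i where D0i: "D0i ** (\<chi> j. conj_transpose (d0 j)) = mat 1"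
    using lin_indep_family_inverse[OF assms(11)] by blast
  have inj0: "c = 0" if "\<And>j. bdot (q0 j) c = 0" for c
  proof -
    have "((\<chi> j. conj_transpose (d0 j)) *v (Zi *v c)) $ j = bdot (q0 j) c" for j
      unfolding q0_def bdot_vector_matrix_mult by (simp add: matrix_vector_mult_def[of "\<chi> j. _ j"] bdot_def)
    then have "(\<chi> j. conj_transpose (d0 j)) *v (Zi *v c) = 0" using that by (simp add: vec_eq_iff)
    then have "D0i *v ((\<chi> j. conj_transpose (d0 j)) *v (Zi *v c)) = 0" by simp
    then have "Zi *v c = 0" by (simp add: matrix_vector_mul_assoc matrix_mul_assoc D0i)
    then have "Z *v (Zi *v c) = 0" by simp
    then show "c = 0" by (simp add: matrix_vector_mul_assoc Zi)
  qed
  \<comment> \<open>At most \<open>2 N + 1\<close> vectors are changed for each \<open>m\<close>; their squared changes add up to at most \<open>\<epsilon> / 2\<close>.\<close>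
  define \<delta> where "\<delta> N = sqrt (\<epsilon> / (2 * real (2 * N + 1))) / C2" for N
  have \<delta>: "\<delta> N > 0" for N using assms(12) C2(1) by (simp add: \<delta>_def)
  have ne: "lam0 j \<noteq> L i" for j i using assms(10) by (simp add: L_def)
  have "\<exists>N q. N > 0 \<and> (\<forall>i. q i \<noteq> 0) \<and> (\<forall>i. tail N i \<longrightarrow> q i = Q i) \<and>
     (\<forall>i. \<not> tail N i \<longrightarrow> norm (q i - Q i) < \<delta> N) \<and> rows_solvable q q0 lam0"
  proof (rule row_interpolation)
    show "c = 0" if "\<And>j. bdot (q0 j) c = 0" for c using that by (rule inj0)
  qed (rule ne \<delta>)+
  then obtain N q where N: "N > 0" and q0': "\<And>i. q i \<noteq> 0" and qtail: "\<And>i. tail N i \<Longrightarrow> q i = Q i"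
    and qhead: "\<And>i. \<not> tail N i \<Longrightarrow> norm (q i - Q i) < \<delta> N" and solvable: "rows_solvable q q0 lam0"
    by blast
  define rhs where "rhs w j = (\<chi> s. (1 - exp (- w) * exp (a s)) * Z $ s $ j)" for w j
  have "\<forall>j. \<exists>u c. transform u \<and> (\<forall>i. bdot (q i) (L i *s u (L i) + c) = L i * bdot (q i) (rhs (L i) j)) \<and>
        (\<forall>k. bdot (q0 k) (lam0 k *s u (lam0 k) + c) = lam0 k * bdot (q0 k) (rhs (lam0 k) j))"
  proof
    fix j
    have "finite {i. q i \<noteq> Q i}" by (rule finite_subset[OF _ finite_heads[of N]]) (use qtail in auto)
    from principal_part_l2[OF this, of "\<lambda>s. Z $ s $ j"] obtain B where
      "l2_le (\<lambda>i. bdot (q i) (rhs (L i) j)) B" unfolding rhs_def by blast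
    from solvable[unfolded rows_solvable_def, rule_format, OF this] show "\<exists>u c. transform u \<and> (\<forall>i. bdot (q i) (L i *s u (L i) + c) = L i * bdot (q i) (rhs (L i) j)) \<and>
        (\<forall>k. bdot (q0 k) (lam0 k *s u (lam0 k) + c) = lam0 k * bdot (q0 k) (rhs (lam0 k) j))" .
  qed
  then obtain u c where u: "\<And>j. transform (u j)"
    and ui: "\<And>j i. bdot (q i) (L i *s u j (L i) + c j) = L i * bdot (q i) (rhs (L i) j)"
    and u0: "\<And>j k. bdot (q0 k) (lam0 k *s u j (lam0 k) + c j) = lam0 k * bdot (q0 k) (rhs (lam0 k) j)"
    by metis
  define A1 where "A1 = Zi ** (diag_matrix (\<lambda>s. exp (a s)) ** Z)"
  obtain A2 A3 where L2: "L2_matrix_on {-1..0} A2" "L2_matrix_on {-1..0} A3"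
    and ch: "\<And>A1 w p j. char_matrix A1 A2 A3 w $ p $ j
       = w * (mat 1 :: complex^'n^'n) $ p $ j - w * exp (- w) * A1 $ p $ j - (w *s (Zi *v u j w) + Zi *v c j) $ p"
    using char_matrix_realization[of "\<lambda>j w. Zi *v u j w" "\<lambda>j. Zi *v c j"] transform_matrix_vector_mult[OF u] by metis
  define d where "d k m = conj_transpose (q (m, k) v* Z)" for k m
  have ct: "conj_transpose (d k m) = q (m, k) v* Z" for k m by (simp add: d_def)
  have dhat: "conj_transpose (dhat k m) = Q (m, k) v* Z" for k m by (simp add: Q_def cancel)
  have row: "(p v* Z) v* char_matrix A1 A2 A3 w = 0"
    if "\<And>j. bdot p (w *s u j w + c j) = w * bdot p (rhs w j)" for p w
    by (rule annihilating_row[where b="\<lambda>s. exp (a s)" and Z=Z and Zi=Zi, folded A1_def, OF Zi(1) ch])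
      (use that in \<open>simp only: rhs_def\<close>)
  have ker: "conj_transpose (d k m) v* char_matrix A1 A2 A3 (lam k m) = 0" for k m
    unfolding ct by (rule row) (use ui[of "(m, k)"] in \<open>simp only: L_def fst_conv snd_conv\<close>)
  have ker0: "conj_transpose (d0 k) v* char_matrix A1 A2 A3 (lam0 k) = 0" for k
    using row[of "q0 k", OF u0] by (simp add: q0_def cancel)
  have dnz: "conj_transpose (d k m) \<noteq> 0" for k m
    unfolding ct using q0'[of "(m, k)"] cancel(2)[of "q (m, k)"] by auto
  have d0nz: "conj_transpose (d0 j) \<noteq> 0" for j
  proof
    assume "conj_transpose (d0 j) = 0"
    then have "norm (d0 j) = 0" by (metis norm_conj_transpose norm_zero)
    with lin_indep_family_nonzero[OF assms(11)] show False by simp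
  qed
  have dtail: "d k m = dhat k m" if "\<bar>k\<bar> > int N" for k m
    using qtail[of "(m, k)"] that dhat[of k m] conj_transpose_conj_transpose[of "dhat k m"] by (simp add: d_def tail_def)
  have dhead: "(norm (d k m - dhat k m))\<^sup>2 \<le> \<epsilon> / (2 * real (2 * N + 1))" if "\<not> \<bar>k\<bar> > int N" for k m
  proof -
    have "norm (d k m - dhat k m) = norm (conj_transpose (d k m - dhat k m))" by simp
    also have "conj_transpose (d k m - dhat k m) = (q (m, k) - Q (m, k)) v* Z"
      unfolding conj_transpose_diff ct dhat vector_matrix_mult_diff_distrib ..
    also have "norm \<dots> \<le> norm (q (m, k) - Q (m, k)) * C2" by (rule C2(2))
    also have "\<dots> \<le> \<delta> N * C2" using qhead[of "(m, k)"] that C2(1) by (intro mult_right_mono) (auto simp: tail_def)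
    also have "\<dots> = sqrt (\<epsilon> / (2 * real (2 * N + 1)))" using C2(1) by (simp add: \<delta>_def)
    finally have "(norm (d k m - dhat k m))\<^sup>2 \<le> (sqrt (\<epsilon> / (2 * real (2 * N + 1))))\<^sup>2" by (intro power_mono) auto
    then show ?thesis using assms(12) by simp
  qed
  have sums: "(\<lambda>k. (norm (d k m - dhat k m))\<^sup>2) summable_on UNIV \<and> (\<Sum>\<^sub>\<infinity>k. (norm (d k m - dhat k m))\<^sup>2) < \<epsilon>" for m
  proof -
    let ?g = "\<lambda>k. (norm (d k m - dhat k m))\<^sup>2" and ?S = "{- int N..int N}"
    have "(?g has_sum sum ?g ?S) ?S" by (rule has_sum_finite) simp
    moreover have "?g k = 0" if "k \<in> UNIV - ?S" for k
      using that by (subst dtail) auto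
    ultimately have hs: "(?g has_sum sum ?g ?S) UNIV"
      by (subst has_sum_cong_neutral[of ?S UNIV]) auto
    have "sum ?g ?S \<le> of_nat (card ?S) * (\<epsilon> / (2 * real (2 * N + 1)))"
      by (rule sum_bounded_above, rule dhead) auto
    also have "card ?S = 2 * N + 1" by simp
    also have "of_nat (2 * N + 1) * (\<epsilon> / (2 * real (2 * N + 1))) = \<epsilon> / 2"
      by (simp add: field_simps del: of_nat_add of_nat_mult of_nat_Suc)
    also have "\<dots> < \<epsilon>" using assms(12) by simp
    finally show ?thesis using hs by (auto simp: summable_on_def infsumI)
  qed
  show ?thesis
    by (intro exI[of _ N] exI[of _ d] exI[of _ A1] exI[of _ A2] exI[of _ A3] conjI allI impI)
      (use N sums dtail L2 ker ker0 det_eq_0_of_left_kernel[OF dnz ker] det_eq_0_of_left_kernel[OF d0nz ker0] in blast)+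
qed

end
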